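(* Let $\mathcal{H}$ be an infinite dimensional separable Hilbert space, let $N$ be a contraction and $N_0$ a normal contraction on $\mathcal{H}$ such that $V=N-N_0\in\mathcal{B}_2(\mathcal{H})$. Put $N_s=N_0+sV$, $s\in[0,1]$. Then for every $\Phi\in\mathcal{F}_2^+(\mathbb{T})$, $$\Phi(N)-\Phi(N_0)-\frac{d}{ds}\Big|_{s=0}\Phi(N_s)\in\mathcal{B}_1(\mathcal{H}),$$ and there exists a function $\eta\in L^1(\mathbb{T})$, unique up to an analytic term (i.e. unique modulo $H^1(\mathbb{T})$), such that for every $\Phi\in\mathcal{F}_2^+(\mathbb{T})$, $$\operatorname{Tr}\Big\{\Phi(N)-\Phi(N_0)-\frac{d}{ds}\Big|_{s=0}\Phi(N_s)\Big\}=\int_{\mathbb{T}}\Phi''(z)\,\eta(z)\,dz.\qquad( * )$$ Furthermore, for every given $\epsilon>0$, the function $\eta$ satisfying $( * )$ can be chosen so that $$\|\eta\|_{L^1(\mathbb{T})}\le\Big(\frac12+\epsilon\Big)\|V\|_2^2.$$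
   Context: $\mathcal{B}_1(\mathcal{H})$ and $\mathcal{B}_2(\mathcal{H})$ are the trace class and Hilbert-Schmidt operators on $\mathcal{H}$; $\|\cdot\|_2$ is the Hilbert-Schmidt norm. A contraction is a bounded operator of norm at most $1$. $$\mathcal{F}_2^+(\mathbb{T})=\Big\{f(z)=\sum_{k=0}^\infty\hat f(k)z^k\in C^2(\mathbb{T}):\ \sum_{k=0}^\infty k^2|\hat f(k)|<\infty\Big\},$$ where $\hat f(k)$ are the Fourier coefficients of $f$. For $f\in\mathcal{F}_2^+(\mathbb{T})$ and a contraction $T$, $f(T)=\sum_{k\ge0}\hat f(k)T^k$, and $f''(z)=\sum_{k\ge2}k(k-1)\hat f(k)z^{k-2}$. The derivative in $s$ is taken in operator norm (one-sided at $s=0$ on $[0,1]$). $\mathbb{T}$ is the unit circle; $\int_{\mathbb{T}}f(z)\,dz=\int_0^{2\pi}f(e^{it})\,ie^{it}\,dt$, and $\|f\|_{L^1(\mathbb{T})}=\int_0^{2\pi}|f(e^{it})|\,dt$ (arc length). $H^1(\mathbb{T})=\{f\in L^1(\mathbb{T}):\hat f(n)=0\text{ for all }n<0\}$. *)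

theory Defs
  imports "HOL-Analysis.Analysis"
begin

section \<open>Complex Hilbert spaces\<close>

class scaleC =
  fixes scaleC :: "complex \<Rightarrow> 'a \<Rightarrow> 'a"  (infixr \<open>*\<^sub>C\<close> 75)

text \<open>The inner product is linear in its first argument. Positive definiteness is contained
  in \<open>cinner_self\<close>, since the norm is that of a real normed space.\<close>

class complex_hilbert_space = banach + scaleC +
  fixes cinner :: "'a \<Rightarrow> 'a \<Rightarrow> complex"
  assumes scaleC_add_right: "a *\<^sub>C (x + y) = a *\<^sub>C x + a *\<^sub>C y"
    and scaleC_add_left: "(a + b) *\<^sub>C x = a *\<^sub>C x + b *\<^sub>C x"
    and scaleC_scaleC: "a *\<^sub>C (b *\<^sub>C x) = (a * b) *\<^sub>C x"
    and scaleR_scaleC: "r *\<^sub>R x = complex_of_real r *\<^sub>C x"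
    and cinner_commute: "cinner x y = cnj (cinner y x)"
    and cinner_add_left: "cinner (x + y) z = cinner x z + cinner y z"
    and cinner_scaleC_left: "cinner (a *\<^sub>C x) y = a * cinner x y"
    and cinner_self: "cinner x x = complex_of_real ((norm x)\<^sup>2)"

global_interpretation complex_vector:
  vector_space "scaleC :: complex \<Rightarrow> 'a \<Rightarrow> 'a::complex_hilbert_space"
  defines cspan = complex_vector.span
  by unfold_locales
    (simp_all add: scaleC_add_right scaleC_add_left scaleC_scaleC
      scaleR_scaleC[of 1, simplified, symmetric])

lemma norm_scaleC: "norm (a *\<^sub>C x) = cmod a * norm (x :: 'a::complex_hilbert_space)"
proof -
  have "cinner (a *\<^sub>C x) (a *\<^sub>C x) = a * cnj a * cinner x x"
    by (metis cinner_commute cinner_scaleC_left complex_cnj_mult mult.assoc mult.left_commute)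
  then have "complex_of_real ((norm (a *\<^sub>C x))\<^sup>2) = complex_of_real ((cmod a * norm x)\<^sup>2)"
    by (simp add: cinner_self complex_norm_square[symmetric] power_mult_distrib)
  then have "(norm (a *\<^sub>C x))\<^sup>2 = (cmod a * norm x)\<^sup>2"
    using of_real_eq_iff by blast
  then show ?thesis
    by (simp add: power2_eq_iff_nonneg)
qed

lemma bounded_linear_scaleC: "bounded_linear (\<lambda>x :: 'a::complex_hilbert_space. a *\<^sub>C x)"
  by (rule bounded_linear_intro[where K = "cmod a"])
    (simp_all add: scaleC_add_right scaleR_scaleC scaleC_scaleC norm_scaleC mult.commute)

definition infinite_dimensional :: "'a::complex_hilbert_space itself \<Rightarrow> bool" where
  "infinite_dimensional _ \<longleftrightarrow> (\<nexists>B :: 'a set. finite B \<and> cspan B = UNIV)"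

definition orthonormal_basis :: "'a::complex_hilbert_space set \<Rightarrow> bool" where
  "orthonormal_basis E \<longleftrightarrow>
     (\<forall>x\<in>E. \<forall>y\<in>E. cinner x y = (if x = y then 1 else 0)) \<and>
     (\<forall>x. (\<forall>e\<in>E. cinner x e = 0) \<longrightarrow> x = 0)"

definition some_onb :: "'a::complex_hilbert_space set" where
  "some_onb = (SOME E. orthonormal_basis E)"

section \<open>Bounded operators\<close>

text \<open>Elements of the library type of bounded \<^emph>\<open>real\<close>-linear maps; the bounded
  operators on the complex Hilbert space are those satisfying \<open>clinear_op\<close>. The norm of the
  type is the operator norm.\<close>

definition clinear_op :: "('a::complex_hilbert_space \<Rightarrow>\<^sub>L 'a) \<Rightarrow> bool" where
  "clinear_op T \<longleftrightarrow> (\<forall>c x. blinfun_apply T (c *\<^sub>C x) = c *\<^sub>C blinfun_apply T x)"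

instantiation blinfun :: (real_normed_vector, complex_hilbert_space) scaleC
begin

lift_definition scaleC_blinfun :: "complex \<Rightarrow> ('a \<Rightarrow>\<^sub>L 'b) \<Rightarrow> 'a \<Rightarrow>\<^sub>L 'b"
  is "\<lambda>c f x. c *\<^sub>C f x"
  by (rule bounded_linear_compose[OF bounded_linear_scaleC])

instance ..

end

definition contraction :: "('a::complex_hilbert_space \<Rightarrow>\<^sub>L 'a) \<Rightarrow> bool" where
  "contraction T \<longleftrightarrow> clinear_op T \<and> norm T \<le> 1"

definition hadjoint :: "('a::complex_hilbert_space \<Rightarrow>\<^sub>L 'a) \<Rightarrow> 'a \<Rightarrow>\<^sub>L 'a" where
  "hadjoint T = (THE S. \<forall>x y. cinner (blinfun_apply S x) y = cinner x (blinfun_apply T y))"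

definition normal_op :: "('a::complex_hilbert_space \<Rightarrow>\<^sub>L 'a) \<Rightarrow> bool" where
  "normal_op T \<longleftrightarrow> clinear_op T \<and> T o\<^sub>L hadjoint T = hadjoint T o\<^sub>L T"

definition positive_op :: "('a::complex_hilbert_space \<Rightarrow>\<^sub>L 'a) \<Rightarrow> bool" where
  "positive_op P \<longleftrightarrow> clinear_op P \<and>
     (\<forall>x. cinner (blinfun_apply P x) x \<in> \<real> \<and> 0 \<le> Re (cinner (blinfun_apply P x) x))"

definition abs_op :: "('a::complex_hilbert_space \<Rightarrow>\<^sub>L 'a) \<Rightarrow> 'a \<Rightarrow>\<^sub>L 'a" where
  "abs_op T = (THE P. positive_op P \<and> P o\<^sub>L P = hadjoint T o\<^sub>L T)"

definition trace_class :: "('a::complex_hilbert_space \<Rightarrow>\<^sub>L 'a) \<Rightarrow> bool" where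
  "trace_class T \<longleftrightarrow> clinear_op T \<and>
     (\<exists>E. orthonormal_basis E \<and> (\<lambda>e. cinner (blinfun_apply (abs_op T) e) e) summable_on E)"

definition op_trace :: "('a::complex_hilbert_space \<Rightarrow>\<^sub>L 'a) \<Rightarrow> complex" where
  "op_trace T = (\<Sum>\<^sub>\<infinity>e\<in>some_onb. cinner (blinfun_apply T e) e)"

definition hilbert_schmidt :: "('a::complex_hilbert_space \<Rightarrow>\<^sub>L 'a) \<Rightarrow> bool" where
  "hilbert_schmidt T \<longleftrightarrow> clinear_op T \<and>
     (\<exists>E. orthonormal_basis E \<and> (\<lambda>e. (norm (blinfun_apply T e))\<^sup>2) summable_on E)"

definition hs_norm :: "('a::complex_hilbert_space \<Rightarrow>\<^sub>L 'a) \<Rightarrow> real" where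
  "hs_norm T = sqrt (\<Sum>\<^sub>\<infinity>e\<in>some_onb. (norm (blinfun_apply T e))\<^sup>2)"

definition op_power :: "('a::complex_hilbert_space \<Rightarrow>\<^sub>L 'a) \<Rightarrow> nat \<Rightarrow> 'a \<Rightarrow>\<^sub>L 'a" where
  "op_power T k = ((o\<^sub>L) T ^^ k) id_blinfun"

section \<open>Functions on the unit circle\<close>

text \<open>Functions on the circle are represented by functions of type
  \<^typ>\<open>complex \<Rightarrow> complex\<close>, of which only the values \<open>f (cis t)\<close> are used. Elements of \<open>L1_circle\<close>
  are representatives, not classes modulo null sets.\<close>

definition fourier_coeff :: "(complex \<Rightarrow> complex) \<Rightarrow> int \<Rightarrow> complex" where
  "fourier_coeff f n =
     integral {0..2*pi} (\<lambda>t. f (cis t) * cis (- (of_int n * t))) / of_real (2*pi)"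

definition circle_integral :: "(complex \<Rightarrow> complex) \<Rightarrow> complex" where
  "circle_integral f = integral {0..2*pi} (\<lambda>t. f (cis t) * (\<i> * cis t))"

definition L1_circle :: "(complex \<Rightarrow> complex) set" where
  "L1_circle = {f. (\<lambda>t. f (cis t)) absolutely_integrable_on {0..2*pi}}"

definition L1_norm :: "(complex \<Rightarrow> complex) \<Rightarrow> real" where
  "L1_norm f = integral {0..2*pi} (\<lambda>t. cmod (f (cis t)))"

definition H1_circle :: "(complex \<Rightarrow> complex) set" where
  "H1_circle = {f \<in> L1_circle. \<forall>n<0. fourier_coeff f n = 0}"

definition C2_circle :: "(complex \<Rightarrow> complex) set" where
  "C2_circle = {f. \<exists>g h :: real \<Rightarrow> complex.
     (\<forall>t. ((\<lambda>t. f (cis t)) has_vector_derivative g t) (at t)) \<and>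
     (\<forall>t. (g has_vector_derivative h t) (at t)) \<and> continuous_on UNIV h}"

definition F2_plus :: "(complex \<Rightarrow> complex) set" where
  "F2_plus = {f \<in> C2_circle.
     (\<forall>z\<in>sphere 0 1. (\<lambda>k. fourier_coeff f (int k) * z ^ k) sums f z) \<and>
     summable (\<lambda>k. (real k)\<^sup>2 * cmod (fourier_coeff f (int k)))}"

text \<open>The derivative in the complex variable. The terms with \<open>k < 2\<close> vanish, so the truncated
  subtractions are harmless.\<close>

definition second_deriv :: "(complex \<Rightarrow> complex) \<Rightarrow> complex \<Rightarrow> complex" where
  "second_deriv f z = (\<Sum>k. of_nat (k * (k - 1)) * fourier_coeff f (int k) * z ^ (k - 2))"

section \<open>Functional calculus and trace formula\<close>

definition fun_calc ::
  "(complex \<Rightarrow> complex) \<Rightarrow> ('a::complex_hilbert_space \<Rightarrow>\<^sub>L 'a) \<Rightarrow> 'a \<Rightarrow>\<^sub>L 'a" where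
  "fun_calc f T = (\<Sum>k. fourier_coeff f (int k) *\<^sub>C op_power T k)"

definition taylor_remainder ::
  "(complex \<Rightarrow> complex) \<Rightarrow> ('a::complex_hilbert_space \<Rightarrow>\<^sub>L 'a) \<Rightarrow> ('a \<Rightarrow>\<^sub>L 'a) \<Rightarrow> 'a \<Rightarrow>\<^sub>L 'a" where
  "taylor_remainder f N0 V = fun_calc f (N0 + V) - fun_calc f N0
     - vector_derivative (\<lambda>s. fun_calc f (N0 + s *\<^sub>R V)) (at 0 within {0..1})"

definition trace_formula ::
  "('a::complex_hilbert_space \<Rightarrow>\<^sub>L 'a) \<Rightarrow> ('a \<Rightarrow>\<^sub>L 'a) \<Rightarrow> (complex \<Rightarrow> complex) \<Rightarrow> bool" where
  "trace_formula N0 V \<eta> \<longleftrightarrow> (\<forall>\<Phi>\<in>F2_plus.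
     op_trace (taylor_remainder \<Phi> N0 V) = circle_integral (\<lambda>z. second_deriv \<Phi> z * \<eta> z))"

end

theory Submission
  imports Defs
begin

text \<open>With \<open>N\<^sub>s = N\<^sub>0 + s V\<close>, Taylor's formula and cyclicity of the trace give
  \<open>Tr (N\<^sup>n\<^sup>+\<^sup>2 - N\<^sub>0\<^sup>n\<^sup>+\<^sup>2 - \<dots>) = (n + 2) (\<integral> (1 - s) (\<Sum>k\<le>n. Tr (N\<^sub>s\<^sup>k V N\<^sub>s\<^sup>n\<^sup>-\<^sup>k V)) ds)\<close>. The sum over \<open>k\<close>
  is \<open>n + 1\<close> times the average over \<open>t \<in> [0, 1]\<close> of \<open>\<langle>M\<^sup>n V, V\<^sup>*\<rangle>\<close>, where
  \<open>M X = (1 - t) X N\<^sub>s + t N\<^sub>s X\<close> is a contraction on the Hilbert space of Hilbert-Schmidt operators.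
  So \<open>\<eta>\<close> has to be an integrable function whose \<open>n\<close>-th moment \<open>c\<^sub>n\<close> is the average of \<open>\<langle>M\<^sup>n V, V\<^sup>*\<rangle>\<close>
  with respect to \<open>(1 - s) ds dt\<close>, a measure of mass \<open>1/2\<close>.

  Positivity of the Poisson kernel of \<open>M\<close> represents \<open>r\<^sup>n c\<^sub>n\<close> for \<open>r < 1\<close> by a function of norm at most
  \<open>\<parallel>V\<parallel>\<^sup>2 / 2\<close>, and the same holds with \<open>V\<^sup>*\<close> replaced by any \<open>Y\<close>. To let \<open>r\<close> tend to 1, one uses that
  \<open>\<parallel>X\<parallel>\<^sup>2 - \<parallel>M X\<parallel>\<^sup>2 \<ge> t s (1 - s) \<parallel>V X\<parallel>\<^sup>2\<close> by strict convexity of the norm. If \<open>Y = V\<^sup>* Z\<close> with \<open>Z\<close>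
  Hilbert-Schmidt, then \<open>\<langle>M\<^sup>n V, Y\<rangle> = \<langle>V M\<^sup>n V, Z\<rangle>\<close> is therefore square summable in \<open>n\<close>, so that its average
  is represented by a function of norm at most \<open>\<parallel>V\<parallel> \<parallel>Y\<parallel> / 2 + \<epsilon>\<close>. Finally \<open>V\<^sup>*\<close> is a rapidly converging
  series of operators of this form.\<close>

section \<open>Complex Hilbert spaces\<close>

text \<open>The average over \<open>t\<close> works because left and right multiplication by
  \<open>N\<^sub>s\<close> commute: \<open>M\<^sup>n\<close> is a binomial sum, and each weight
  \<open>(n choose k) t^k (1 - t)^(n - k)\<close> has integral \<open>1 / (n + 1)\<close>. So
  \<open>n + 1\<close> traces become one averaged matrix coefficient of a power of a contraction,
  and the factors \<open>n + 2\<close> and \<open>n + 1\<close> are absorbed by the second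
  derivative. The obstacle is the limit in \<open>r\<close>: functions bounded in the integral norm
  converge in general only to a measure. Square summability excludes this, since the moments then
  differ from truncated Abel means by a sequence that is small in the square norm, and such a
  sequence is represented by a function of small integral norm. The bound on the defect degenerates
  where \<open>s = 0\<close>, \<open>t = 0\<close> or \<open>s = 1\<close>. The weight
  \<open>1 - s\<close> compensates the last edge; at the others the square norm of the moments grows
  at most like \<open>1 / sqrt (s t)\<close>, which is integrable. Every approximation costs an
  arbitrarily small amount of norm, whence the \<open>\<epsilon>\<close>.\<close>

lemma cinner_add_right: "cinner x (y + z) = cinner x y + cinner x (z::'a::complex_hilbert_space)"
  by (metis cinner_add_left cinner_commute complex_cnj_add)

lemma cinner_scaleC_right: "cinner x (a *\<^sub>C y) = cnj a * cinner x (y::'a::complex_hilbert_space)"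
  by (metis cinner_commute cinner_scaleC_left complex_cnj_mult)

lemma scaleC_of_real [simp]: "complex_of_real r *\<^sub>C x = r *\<^sub>R (x::'a::complex_hilbert_space)"
  by (simp add: scaleR_scaleC)

lemma cinner_scaleR_left: "cinner (r *\<^sub>R x) y = r *\<^sub>R cinner x (y::'a::complex_hilbert_space)"
  unfolding scaleR_scaleC by (simp add: cinner_scaleC_left scaleR_conv_of_real del: scaleC_of_real)

lemma cinner_scaleR_right: "cinner x (r *\<^sub>R y) = r *\<^sub>R cinner x (y::'a::complex_hilbert_space)"
  unfolding scaleR_scaleC by (simp add: cinner_scaleC_right scaleR_conv_of_real del: scaleC_of_real)

lemma Re_cinner_self: "Re (cinner x x) = (norm (x::'a::complex_hilbert_space))\<^sup>2"
  by (simp add: cinner_self)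

lemma norm_add_sq:
  "(norm (x + y))\<^sup>2 = (norm x)\<^sup>2 + 2 * Re (cinner x y) + (norm (y::'a::complex_hilbert_space))\<^sup>2"
proof -
  have "Re (cinner (x + y) (x + y)) = (norm x)\<^sup>2 + Re (cinner x y) + Re (cinner y x) + (norm y)\<^sup>2"
    unfolding cinner_add_left cinner_add_right by (simp add: cinner_self)
  moreover have "Re (cinner y x) = Re (cinner x y)"
    by (metis cinner_commute complex_cnj(1) cnj.sel(1))
  ultimately show ?thesis by (simp add: cinner_self)
qed

text \<open>The squared norm of \<open>?b x - ?a y\<close> factors as
  \<open>2 ?a ?b (?a ?b - Re (cinner x y))\<close>.\<close>

lemma Re_cinner_le: "Re (cinner x y) \<le> norm x * norm (y::'a::complex_hilbert_space)"
proof (cases "x = 0 \<or> y = 0")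
  case True
  have "cinner 0 y = 0" "cinner x 0 = 0" for x y :: 'a
    using cinner_scaleR_left[of 0 0 y] cinner_scaleR_right[of x 0 0] by simp_all
  with True show ?thesis by auto
next
  case False
  let ?a = "norm x" and ?b = "norm y"
  have "0 \<le> (norm (?b *\<^sub>R x + (- ?a) *\<^sub>R y))\<^sup>2" by simp
  also have "\<dots> = 2 * (?a * ?b) * (?a * ?b - Re (cinner x y))"
    by (simp only: norm_add_sq norm_scaleR cinner_scaleR_left cinner_scaleR_right)
      (simp add: power2_eq_square algebra_simps)
  finally have "0 \<le> 2 * (?a * ?b) * (?a * ?b - Re (cinner x y))" .
  moreover have "0 < ?a * ?b" using False by simp
  ultimately show ?thesis by (simp add: zero_le_mult_iff not_le)
qed

lemma cmod_cinner_le: "cmod (cinner x y) \<le> norm x * norm (y::'a::complex_hilbert_space)"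
proof (cases "cinner x y = 0")
  case False
  \<comment> \<open>A unimodular factor turns \<open>cinner x y\<close> into its absolute value,
    which reduces the complex case to real parts.\<close>
  define u where "u = cnj (cinner x y) / cmod (cinner x y)"
  have u: "cmod u = 1" using False by (simp add: u_def norm_divide)
  have "u * cinner x y = complex_of_real (cmod (cinner x y))"
    using False by (simp add: u_def complex_norm_square[symmetric] power2_eq_square mult.commute)
  then have "cmod (cinner x y) = Re (cinner (u *\<^sub>C x) y)"
    by (simp add: cinner_scaleC_left)
  also have "\<dots> \<le> norm x * norm y"
    using Re_cinner_le[of "u *\<^sub>C x" y] u by (simp add: norm_scaleC)
  finally show ?thesis .
qed simp

lemma bounded_bilinear_cinner: "bounded_bilinear (cinner :: 'a::complex_hilbert_space \<Rightarrow> 'a \<Rightarrow> complex)"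
  by (intro bounded_bilinear.intro cinner_add_left cinner_add_right cinner_scaleR_left
      cinner_scaleR_right exI[of _ 1]) (simp add: cmod_cinner_le)

interpretation cinner: bounded_bilinear "cinner :: 'a::complex_hilbert_space \<Rightarrow> 'a \<Rightarrow> complex"
  by (rule bounded_bilinear_cinner)

lemma bounded_bilinear_scaleC: "bounded_bilinear (scaleC :: complex \<Rightarrow> 'a::complex_hilbert_space \<Rightarrow> 'a)"
proof (intro bounded_bilinear.intro exI[of _ 1] allI)
  fix r :: real and a :: complex and x :: 'a
  show "(r *\<^sub>R a) *\<^sub>C x = r *\<^sub>R (a *\<^sub>C x)" "a *\<^sub>C (r *\<^sub>R x) = r *\<^sub>R (a *\<^sub>C x)"
    unfolding scaleR_scaleC
    by (simp_all add: scaleC_scaleC scaleR_conv_of_real mult.commute del: scaleC_of_real)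
qed (simp_all add: scaleC_add_left scaleC_add_right norm_scaleC)

interpretation scaleC: bounded_bilinear "scaleC :: complex \<Rightarrow> 'a::complex_hilbert_space \<Rightarrow> 'a"
  by (rule bounded_bilinear_scaleC)

lemma Re_cinner_commute: "Re (cinner y x) = Re (cinner x (y::'a::complex_hilbert_space))"
  by (metis cinner_commute cnj.sel(1))

lemma norm_diff_sq:
  "(norm (x - y))\<^sup>2 = (norm x)\<^sup>2 - 2 * Re (cinner x y) + (norm (y::'a::complex_hilbert_space))\<^sup>2"
  using norm_add_sq[of x "- y"] by (simp add: cinner.minus_right)

lemma cinner_ext: "(\<And>y. cinner x y = cinner x' y) \<Longrightarrow> x = (x'::'a::complex_hilbert_space)"
proof -
  assume "\<And>y. cinner x y = cinner x' y"
  then have "cinner (x - x') (x - x') = 0" by (simp add: cinner.diff_left)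
  then show ?thesis by (simp add: cinner_self)
qed

text \<open>Carries identities between norms over to inner products; needed in
  \<open>cinner_hs_adj\<close>, where the isometry of the adjoint is what is known.\<close>

lemma polarization:
  fixes A B :: "'a::complex_hilbert_space"
  shows "cinner A B = ((norm (A + B))\<^sup>2 - (norm (A - B))\<^sup>2) / 4
     + \<i> * (((norm (A + \<i> *\<^sub>C B))\<^sup>2 - (norm (A - \<i> *\<^sub>C B))\<^sup>2) / 4)"
  by (simp add: norm_add_sq norm_diff_sq cinner_scaleC_right complex_eq_iff)

section \<open>Orthonormal sets, the inequality of Bessel and the identity of Parseval\<close>

definition orthonormal :: "'a::complex_hilbert_space set \<Rightarrow> bool" where
  "orthonormal E \<longleftrightarrow> (\<forall>x\<in>E. \<forall>y\<in>E. cinner x y = (if x = y then 1 else 0))"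

lemma orthonormal_basis_alt:
  "orthonormal_basis E \<longleftrightarrow> orthonormal E \<and> (\<forall>x. (\<forall>e\<in>E. cinner x e = 0) \<longrightarrow> x = 0)"
  by (simp add: orthonormal_basis_def orthonormal_def)

text \<open>Zorn's lemma gives a maximal orthonormal set; a nonzero vector orthogonal to it could be
  normalized and added. This makes the choice in \<open>some_onb\<close> meaningful.\<close>

lemma orthonormal_basis_exists: "\<exists>E :: 'a::complex_hilbert_space set. orthonormal_basis E"
proof -
  have "\<exists>M\<in>{E. orthonormal E}. \<forall>X\<in>{E. orthonormal E}. M \<subseteq> X \<longrightarrow> X = (M :: 'a set)"
  proof (rule subset_Zorn', clarsimp simp del: UnionE)
    fix C :: "'a set set" assume C: "subset.chain {E. orthonormal E} C"
    show "orthonormal (\<Union>C)"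
      unfolding orthonormal_def
    proof (intro ballI)
      fix x y assume "x \<in> \<Union>C" "y \<in> \<Union>C"
      then obtain X Y where XY: "X \<in> C" "x \<in> X" "Y \<in> C" "y \<in> Y" by blast
      then have "X \<subseteq> Y \<or> Y \<subseteq> X" using C by (auto simp: subset.chain_def)
      then obtain Z where "Z \<in> C" "x \<in> Z" "y \<in> Z" using XY by blast
      then show "cinner x y = (if x = y then 1 else 0)"
        using C by (auto simp: subset.chain_def orthonormal_def)
    qed
  qed
  then obtain M :: "'a set" where M: "orthonormal M" and max: "\<And>X. orthonormal X \<Longrightarrow> M \<subseteq> X \<Longrightarrow> X = M"
    by auto
  have "x = 0" if x: "\<And>e. e \<in> M \<Longrightarrow> cinner x e = 0" for x
  proof (rule ccontr)
    assume "x \<noteq> 0"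
    define u where "u = (1 / norm x) *\<^sub>R x"
    have u1: "cinner u u = 1"
      using \<open>x \<noteq> 0\<close> by (simp add: cinner_self u_def)
    have u0: "cinner u e = 0" "cinner e u = 0" if "e \<in> M" for e
      using x[OF that] cinner_commute[of e x] by (simp_all add: u_def cinner_scaleR_left cinner_scaleR_right)
    have "orthonormal (insert u M)"
      unfolding orthonormal_def using M u1 u0 by (auto simp: orthonormal_def)
    then have "u \<in> M" using max[of "insert u M"] by auto
    then show False using u0 u1 by force
  qed
  with M show ?thesis unfolding orthonormal_basis_alt by blast
qed

lemma orthonormal_basis_some_onb: "orthonormal_basis (some_onb :: 'a::complex_hilbert_space set)"
  unfolding some_onb_def by (rule someI_ex[OF orthonormal_basis_exists])

lemma norm_sq_sum_orthonormal:
  assumes "orthonormal E" "finite F" "F \<subseteq> E"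
  shows "(norm (\<Sum>e\<in>F. a e *\<^sub>C e))\<^sup>2 = (\<Sum>e\<in>F. (cmod (a e))\<^sup>2)"
proof -
  have ON: "cinner e f = (if e = f then 1 else 0)" if "e \<in> F" "f \<in> F" for e f
    using that assms by (simp add: orthonormal_def subset_iff)
  have "cinner (\<Sum>e\<in>F. a e *\<^sub>C e) (\<Sum>e\<in>F. a e *\<^sub>C e)
      = (\<Sum>e\<in>F. \<Sum>e'\<in>F. a e * cnj (a e') * (if e = e' then 1 else 0))"
    unfolding cinner.sum_left cinner.sum_right
    by (intro sum.cong refl) (auto simp: cinner_scaleC_left cinner_scaleC_right ON)
  also have "\<dots> = (\<Sum>e\<in>F. complex_of_real ((cmod (a e))\<^sup>2))"
    using assms(2) by (intro sum.cong refl) (simp add: mult_delta_right flip: complex_norm_square)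
  finally have "Re (cinner (\<Sum>e\<in>F. a e *\<^sub>C e) (\<Sum>e\<in>F. a e *\<^sub>C e)) = (\<Sum>e\<in>F. (cmod (a e))\<^sup>2)"
    by (simp add: Re_sum)
  then show ?thesis by (simp only: Re_cinner_self)
qed

text \<open>The Riesz-Fischer theorem. By Pythagoras the squared distance of partial sums over
  nested finite sets is a difference of numerical partial sums, so the net over finite subsets is
  Cauchy.\<close>

lemma orthonormal_summable:
  fixes E :: "'a::complex_hilbert_space set"
  assumes E: "orthonormal E" and S: "(\<lambda>e. (cmod (a e))\<^sup>2) summable_on E"
  shows "(\<lambda>e. a e *\<^sub>C e) summable_on E"
proof -
  let ?f = "\<lambda>F. \<Sum>e\<in>F. a e *\<^sub>C e"
  let ?g = "\<lambda>F. \<Sum>e\<in>F. (cmod (a e))\<^sup>2"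
  have "\<exists>P. eventually P (finite_subsets_at_top E) \<and> (\<forall>F F'. P F \<and> P F' \<longrightarrow> dist (?f F) (?f F') < d)"
    if "d > 0" for d
  proof -
    have "((?g \<longlongrightarrow> infsum (\<lambda>e. (cmod (a e))\<^sup>2) E)) (finite_subsets_at_top E)"
      using S infsum_tendsto by blast
    \<comment> \<open>Two errors of \<open>d\<^sup>2/8\<close> give less than
      \<open>(d/2)\<^sup>2\<close> for the squared distance to the sum over \<open>F0\<close>; a
      detour over \<open>F0\<close> then costs less than \<open>d\<close>.\<close>
    then have ev: "eventually (\<lambda>F. dist (?g F) (infsum (\<lambda>e. (cmod (a e))\<^sup>2) E) < d\<^sup>2/8) (finite_subsets_at_top E)"
      using \<open>d > 0\<close> by (auto dest!: tendstoD[of _ _ _ "d\<^sup>2/8"])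
    then obtain F0 where F0: "finite F0" "F0 \<subseteq> E"
      and *: "\<forall>F. finite F \<and> F0 \<subseteq> F \<and> F \<subseteq> E \<longrightarrow> dist (?g F) (infsum (\<lambda>e. (cmod (a e))\<^sup>2) E) < d\<^sup>2/8"
      unfolding eventually_finite_subsets_at_top by (elim exE conjE) (rule that)
    define P where "P F \<longleftrightarrow> finite F \<and> F0 \<subseteq> F \<and> F \<subseteq> E" for F
    have evP: "eventually P (finite_subsets_at_top E)"
      unfolding eventually_finite_subsets_at_top P_def using F0 by blast
    have near: "norm (?f F - ?f F0) < d / 2" if "P F" for F
    proof -
      have "?f F - ?f F0 = ?f (F - F0)"
        using that F0 by (simp add: sum_diff P_def)
      then have "(norm (?f F - ?f F0))\<^sup>2 = ?g (F - F0)"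
        using norm_sq_sum_orthonormal[OF E, of "F - F0" a] that by (auto simp: P_def)
      also have "\<dots> = ?g F - ?g F0"
        using that F0 by (simp add: sum_diff P_def)
      also have "\<dots> < d\<^sup>2/4"
      proof -
        have "dist (?g F) (infsum (\<lambda>e. (cmod (a e))\<^sup>2) E) < d\<^sup>2/8"
          "dist (?g F0) (infsum (\<lambda>e. (cmod (a e))\<^sup>2) E) < d\<^sup>2/8"
          using * that F0 unfolding P_def by blast+
        then show ?thesis unfolding dist_real_def by linarith
      qed
      finally have "(norm (?f F - ?f F0))\<^sup>2 < (d/2)\<^sup>2" by (simp add: power2_eq_square)
      then show ?thesis using \<open>d > 0\<close> power2_less_imp_less by (metis half_gt_zero less_imp_le)
    qed
    have "dist (?f F) (?f F') < d" if "P F \<and> P F'" for F F'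
      using near[of F] near[of F'] that norm_triangle_ineq4[of "?f F - ?f F0" "?f F' - ?f F0"]
      by (simp add: dist_norm)
    with evP show ?thesis by blast
  qed
  then have "cauchy_filter (filtermap ?f (finite_subsets_at_top E))"
    unfolding cauchy_filter_metric_filtermap by blast
  moreover have "complete (UNIV::'a set)" by (simp add: complete_UNIV)
  moreover have "filtermap ?f (finite_subsets_at_top E) \<noteq> bot"
    by (simp add: filtermap_bot_iff)
  moreover have "filtermap ?f (finite_subsets_at_top E) \<le> principal UNIV" by simp
  ultimately obtain l where "filtermap ?f (finite_subsets_at_top E) \<le> nhds l"
    using complete_uniform[of "UNIV::'a set"] by meson
  then show ?thesis
    unfolding summable_on_def has_sum_def filterlim_def by blast
qed

text \<open>The squared distance from \<open>x\<close> to its projection \<open>?y\<close> is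
  nonnegative.\<close>

lemma bessel:
  assumes "orthonormal E" "finite F" "F \<subseteq> E"
  shows "(\<Sum>e\<in>F. (cmod (cinner x e))\<^sup>2) \<le> (norm x)\<^sup>2"
proof -
  let ?y = "\<Sum>e\<in>F. cinner x e *\<^sub>C e"
  have "cinner x ?y = (\<Sum>e\<in>F. complex_of_real ((cmod (cinner x e))\<^sup>2))"
    unfolding cinner.sum_right
    by (intro sum.cong refl)
      (simp add: cinner_scaleC_right mult.commute[of "cnj _"] flip: complex_norm_square)
  moreover have "0 \<le> (norm (x - ?y))\<^sup>2" by simp
  ultimately show ?thesis
    unfolding norm_diff_sq norm_sq_sum_orthonormal[OF assms] by simp
qed

text \<open>Bessel makes the series converge. Its sum has the same coefficients as \<open>x\<close>,
  so the completeness clause of a basis forces the difference to vanish.\<close>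

lemma onb_has_sum:
  assumes "orthonormal_basis E"
  shows "((\<lambda>e. cinner x e *\<^sub>C e) has_sum x) E"
proof -
  have E: "orthonormal E" using assms by (simp add: orthonormal_basis_alt)
  have "(\<lambda>e. (cmod (cinner x e))\<^sup>2) summable_on E"
    using bessel[OF E, of _ x] by (intro nonneg_bounded_partial_sums_imp_summable_on[where C = "(norm x)\<^sup>2"])
      (auto simp: eventually_finite_subsets_at_top intro!: exI[of _ "{}"])
  then obtain y where y: "((\<lambda>e. cinner x e *\<^sub>C e) has_sum y) E"
    using orthonormal_summable[OF E] by (auto simp: summable_on_def)
  have "cinner y e = cinner x e" if "e \<in> E" for e
  proof -
    have "((\<lambda>f. cinner (cinner x f *\<^sub>C f) e) has_sum cinner y e) E"
      using has_sum_bounded_linear[OF cinner.bounded_linear_left y, of e] by (simp add: o_def)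
    moreover have "((\<lambda>f. cinner (cinner x f *\<^sub>C f) e) has_sum cinner x e) E"
    proof (subst has_sum_cong_neutral)
      show "((\<lambda>f. cinner (cinner x f *\<^sub>C f) e) has_sum cinner x e) {e}"
        using E that by (auto simp: orthonormal_def cinner_scaleC_left intro!: has_sum_finiteI)
    qed (use E that in \<open>auto simp: orthonormal_def cinner_scaleC_left\<close>)
    ultimately show ?thesis using has_sum_unique by blast
  qed
  then have "x - y = 0"
    using assms unfolding orthonormal_basis_alt by (metis cinner.diff_left diff_self)
  with y show ?thesis by simp
qed

lemma parseval:
  assumes "orthonormal_basis E"
  shows "((\<lambda>e. (cmod (cinner x e))\<^sup>2) has_sum (norm x)\<^sup>2) E"
proof -
  have "((\<lambda>e. cinner x (cinner x e *\<^sub>C e)) has_sum cinner x x) E"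
    using has_sum_bounded_linear[OF cinner.bounded_linear_right onb_has_sum[OF assms, of x], of x]
    by (simp add: o_def)
  then have "((\<lambda>e. Re (cinner x (cinner x e *\<^sub>C e))) has_sum Re (cinner x x)) E"
    by (rule has_sum_Re)
  moreover have "Re (cinner x (cinner x e *\<^sub>C e)) = (cmod (cinner x e))\<^sup>2" for e
    by (metis Re_complex_of_real cinner_scaleC_right complex_norm_square mult.commute)
  ultimately show ?thesis by (simp add: cinner_self)
qed

section \<open>The Banach algebra of bounded operators\<close>

text \<open>Cancels one factor in \<open>(norm v)\<^sup>2 \<le> b * norm v\<close>, the usual
  outcome of testing an inequality on the vector itself.\<close>

lemma le_of_power2_le_mult: "a\<^sup>2 \<le> b * a \<Longrightarrow> 0 \<le> b \<Longrightarrow> a \<le> (b::real)"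
  by (cases "a \<le> 0") (simp_all add: power2_eq_square)

lemmas blinfun_compose_simps = bounded_bilinear.add_left[OF bounded_bilinear_blinfun_compose]
  bounded_bilinear.add_right[OF bounded_bilinear_blinfun_compose]
  bounded_bilinear.scaleR_left[OF bounded_bilinear_blinfun_compose]
  bounded_bilinear.scaleR_right[OF bounded_bilinear_blinfun_compose]

text \<open>A type of their own gives the complex-linear operators products and powers in the sense
  of the algebraic classes. The classes stop short of a unital normed algebra because
  \<open>norm 1 = 1\<close> fails on the zero space.\<close>

typedef (overloaded) 'a cop = "{T :: 'a::complex_hilbert_space \<Rightarrow>\<^sub>L 'a. clinear_op T}"
  morphisms blinfun_of Cop
  by (rule exI[of _ 0]) (simp add: clinear_op_def)

setup_lifting type_definition_cop

instantiation cop :: (complex_hilbert_space) "{real_normed_algebra, monoid_mult}"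
begin

lift_definition zero_cop :: "'a cop" is 0 by (simp add: clinear_op_def)
lift_definition one_cop :: "'a cop" is id_blinfun by (simp add: clinear_op_def)
lift_definition plus_cop :: "'a cop \<Rightarrow> 'a cop \<Rightarrow> 'a cop" is "(+)"
  by (simp add: clinear_op_def blinfun.add_left scaleC_add_right)
lift_definition minus_cop :: "'a cop \<Rightarrow> 'a cop \<Rightarrow> 'a cop" is "(-)"
  by (simp add: clinear_op_def blinfun.diff_left scaleC.diff_right)
lift_definition uminus_cop :: "'a cop \<Rightarrow> 'a cop" is uminus
  by (simp add: clinear_op_def blinfun.minus_left scaleC.minus_right)
lift_definition times_cop :: "'a cop \<Rightarrow> 'a cop \<Rightarrow> 'a cop" is "(o\<^sub>L)"
  by (simp add: clinear_op_def)
lift_definition scaleR_cop :: "real \<Rightarrow> 'a cop \<Rightarrow> 'a cop" is "scaleR"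
  by (simp add: clinear_op_def blinfun.scaleR_left scaleC.scaleR_right)
lift_definition norm_cop :: "'a cop \<Rightarrow> real" is norm .

definition dist_cop :: "'a cop \<Rightarrow> 'a cop \<Rightarrow> real" where "dist_cop A B = norm (A - B)"
definition sgn_cop :: "'a cop \<Rightarrow> 'a cop" where "sgn_cop A = inverse (norm A) *\<^sub>R A"
definition uniformity_cop :: "('a cop \<times> 'a cop) filter" where
  "uniformity_cop = (INF e\<in>{0<..}. principal {(x, y). dist x y < e})"
definition open_cop :: "'a cop set \<Rightarrow> bool" where
  "open_cop S = (\<forall>x\<in>S. \<forall>\<^sub>F (x', y) in uniformity. x' = x \<longrightarrow> y \<in> S)"

instance
proof
  fix A B C :: "'a cop" and r s :: real
  show "A + B + C = A + (B + C)" "A + B = B + A" "0 + A = A" "- A + A = 0" "A - B = A + - B"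
    by (transfer, simp add: ac_simps)+
  show "A * B * C = A * (B * C)" "1 * A = A" "A * 1 = A"
    by (transfer, rule blinfun_eqI, simp)+
  show "(A + B) * C = A * C + B * C" "A * (B + C) = A * B + A * C"
    "r *\<^sub>R A * B = r *\<^sub>R (A * B)" "A * r *\<^sub>R B = r *\<^sub>R (A * B)"
    by (transfer, simp add: blinfun_compose_simps)+
  show "r *\<^sub>R (A + B) = r *\<^sub>R A + r *\<^sub>R B" "(r + s) *\<^sub>R A = r *\<^sub>R A + s *\<^sub>R A"
    "r *\<^sub>R s *\<^sub>R A = (r * s) *\<^sub>R A" "1 *\<^sub>R A = A"
    by (transfer, simp add: scaleR_add_right scaleR_add_left)+
  show "(norm A = 0) = (A = 0)" "norm (A + B) \<le> norm A + norm B" "norm (r *\<^sub>R A) = \<bar>r\<bar> * norm A"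
    "norm (A * B) \<le> norm A * norm B"
    by (transfer, simp add: norm_triangle_ineq norm_blinfun_compose)+
qed (rule dist_cop_def sgn_cop_def uniformity_cop_def open_cop_def)+

end

instantiation cop :: (complex_hilbert_space) scaleC
begin
lift_definition scaleC_cop :: "complex \<Rightarrow> 'a cop \<Rightarrow> 'a cop" is scaleC
  by (simp add: clinear_op_def scaleC_blinfun.rep_eq scaleC_scaleC mult.commute)
instance ..
end

lift_definition cop_apply :: "'a::complex_hilbert_space cop \<Rightarrow> 'a \<Rightarrow> 'a" (infixr \<open>\<cdot>\<close> 68) is blinfun_apply .

lemma bounded_bilinear_cop_apply: "bounded_bilinear (cop_apply :: 'a::complex_hilbert_space cop \<Rightarrow> 'a \<Rightarrow> 'a)"
proof (intro bounded_bilinear.intro exI[of _ 1] allI)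
  fix A B :: "'a cop" and x y r
  show "(A + B) \<cdot> x = A \<cdot> x + B \<cdot> x" "A \<cdot> (x + y) = A \<cdot> x + A \<cdot> y"
    "(r *\<^sub>R A) \<cdot> x = r *\<^sub>R (A \<cdot> x)" "A \<cdot> (r *\<^sub>R x) = r *\<^sub>R (A \<cdot> x)"
    by (transfer, simp add: blinfun.add_left blinfun.add_right blinfun.scaleR_left blinfun.scaleR_right)+
  show "norm (A \<cdot> x) \<le> norm A * norm x * 1" by transfer (simp add: norm_blinfun)
qed

interpretation cop: bounded_bilinear "cop_apply :: 'a::complex_hilbert_space cop \<Rightarrow> 'a \<Rightarrow> 'a"
  by (rule bounded_bilinear_cop_apply)

declare cop.zero_left [simp] cop.zero_right [simp] cinner.zero_left [simp] cinner.zero_right [simp]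

lemma cop_apply_mult [simp]: "(A * B) \<cdot> x = A \<cdot> (B \<cdot> x)"
  by transfer simp

lemma cop_apply_one [simp]: "1 \<cdot> x = x"
  by transfer simp

lemma cop_apply_scaleC [simp]: "A \<cdot> (c *\<^sub>C x) = c *\<^sub>C (A \<cdot> x)"
  by transfer (simp add: clinear_op_def)

lemma scaleC_cop_apply [simp]: "(c *\<^sub>C A) \<cdot> x = c *\<^sub>C (A \<cdot> x)"
  by transfer (simp add: scaleC_blinfun.rep_eq)

lemma norm_cop_apply: "norm (A \<cdot> x) \<le> norm A * norm x"
  by transfer (rule norm_blinfun)

lemma norm_cop_bound: "0 \<le> b \<Longrightarrow> (\<And>x. norm (A \<cdot> x) \<le> b * norm x) \<Longrightarrow> norm A \<le> b"
  by transfer (rule norm_blinfun_bound)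

lemma cop_eqI: "(\<And>x. A \<cdot> x = B \<cdot> x) \<Longrightarrow> A = B"
  by transfer (rule blinfun_eqI)

lemma norm_cop_one_le: "norm (1 :: 'a::complex_hilbert_space cop) \<le> 1"
  by (rule norm_cop_bound) simp_all

lemma norm_cop_power_le: "norm (A ^ n :: 'a::complex_hilbert_space cop) \<le> norm A ^ n"
proof (induction n)
  case (Suc n)
  have "norm (A ^ Suc n) \<le> norm A * norm (A ^ n)" by (simp add: norm_mult_ineq)
  also have "\<dots> \<le> norm A * norm A ^ n" using Suc by (rule mult_left_mono) simp
  finally show ?case by simp
qed (simp add: norm_cop_one_le)

lemma contraction_power: "norm A \<le> 1 \<Longrightarrow> norm (A ^ n :: 'a::complex_hilbert_space cop) \<le> 1"
  using norm_cop_power_le[of A n] power_le_one[of "norm A" n] by simp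

lemma norm_mult_contraction:
  fixes A B :: "'a::complex_hilbert_space cop"
  assumes "norm A \<le> 1" shows "norm (A * B) \<le> norm B" and "norm (B * A) \<le> norm B"
  using norm_mult_ineq[of A B] norm_mult_ineq[of B A] assms
    mult_left_le_one_le[of "norm B" "norm A"] mult_left_le[of "norm A" "norm B"] by simp_all

lemma blinfun_of_clinear: "clinear_op (blinfun_of A)"
  using blinfun_of by blast

lemma Cop_inverse': "clinear_op T \<Longrightarrow> blinfun_of (Cop T) = T"
  by (simp add: Cop_inverse)

lemma bounded_linear_blinfun_of: "bounded_linear (blinfun_of :: 'a::complex_hilbert_space cop \<Rightarrow> _)"
  by (intro bounded_linear_intro[of _ 1])
    (simp_all add: plus_cop.rep_eq scaleR_cop.rep_eq norm_cop.rep_eq)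

lemma closed_clinear_op: "closed {T :: 'a::complex_hilbert_space \<Rightarrow>\<^sub>L 'a. clinear_op T}"
  unfolding clinear_op_def
  by (intro closed_Collect_all closed_Collect_eq continuous_intros bounded_linear.continuous_on[OF bounded_linear_scaleC])

instance cop :: (complex_hilbert_space) banach
proof
  fix X :: "nat \<Rightarrow> 'a cop" assume "Cauchy X"
  then have "Cauchy (\<lambda>n. blinfun_of (X n))"
    unfolding Cauchy_def dist_norm by (simp add: norm_cop.rep_eq minus_cop.rep_eq)
  then obtain T where T: "(\<lambda>n. blinfun_of (X n)) \<longlonglongrightarrow> T"
    using convergent_eq_Cauchy by blast
  then have "T \<in> {T. clinear_op T}"
    by (rule closed_sequentially[OF closed_clinear_op, rotated]) (simp add: blinfun_of_clinear)
  then have "clinear_op T" by simp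
  then have "(\<lambda>n. norm (X n - Cop T)) \<longlonglongrightarrow> 0"
    using T by (simp add: norm_cop.rep_eq minus_cop.rep_eq Cop_inverse' LIM_zero tendsto_norm_zero)
  then have "X \<longlonglongrightarrow> Cop T"
    by (rule LIM_zero_cancel[OF tendsto_norm_zero_cancel])
  then show "convergent X"
    by (rule convergentI)
qed

section \<open>Adjoints\<close>

text \<open>The candidate for the image of \<open>x\<close> has the coefficients
  \<open>cinner x (T \<cdot> e)\<close>. They are square summable: pairing \<open>x\<close> with
  \<open>T\<close> applied to a partial sum \<open>?z\<close> gives
  \<open>(norm ?z)\<^sup>2 \<le> norm x * norm T * norm ?z\<close>.\<close>

lemma adjoint_exists: "\<exists>S. \<forall>x y. cinner (S \<cdot> x) y = cinner x (T \<cdot> y)"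
proof -
  let ?E = "some_onb :: 'a set"
  have onb: "orthonormal_basis ?E" by (rule orthonormal_basis_some_onb)
  then have E: "orthonormal ?E" by (simp add: orthonormal_basis_alt)
  have bound: "(\<Sum>e\<in>F. (cmod (cinner x (T \<cdot> e)))\<^sup>2) \<le> (norm x * norm T)\<^sup>2"
    if F: "finite F" "F \<subseteq> ?E" for F x
  proof -
    let ?S = "\<Sum>e\<in>F. (cmod (cinner x (T \<cdot> e)))\<^sup>2"
    let ?z = "\<Sum>e\<in>F. cinner x (T \<cdot> e) *\<^sub>C e"
    have z: "(norm ?z)\<^sup>2 = ?S" by (rule norm_sq_sum_orthonormal[OF E F])
    have "cinner x (T \<cdot> ?z) = (\<Sum>e\<in>F. complex_of_real ((cmod (cinner x (T \<cdot> e)))\<^sup>2))"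
      unfolding cop.sum_right cinner.sum_right
      by (intro sum.cong refl)
        (simp add: cinner_scaleC_right mult.commute[of "cnj _"] flip: complex_norm_square)
    then have "?S = Re (cinner x (T \<cdot> ?z))" by simp
    also have "\<dots> \<le> norm x * (norm T * norm ?z)"
      by (rule order_trans[OF Re_cinner_le]) (simp add: mult_left_mono norm_cop_apply)
    finally have "(norm ?z)\<^sup>2 \<le> (norm x * norm T) * norm ?z" using z by simp
    then have "norm ?z \<le> norm x * norm T"
      by (rule le_of_power2_le_mult) simp
    then show ?thesis unfolding z[symmetric] by (rule power_mono) simp
  qed
  have "\<exists>s. \<forall>y. cinner s y = cinner x (T \<cdot> y)" for x
  proof -
    have "(\<lambda>e. (cmod (cinner x (T \<cdot> e)))\<^sup>2) summable_on ?E"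
      using bound[of _ x] by (intro nonneg_bounded_partial_sums_imp_summable_on[where C = "(norm x * norm T)\<^sup>2"])
        (auto simp: eventually_finite_subsets_at_top intro!: exI[of _ "{}"])
    then obtain s where s: "((\<lambda>e. cinner x (T \<cdot> e) *\<^sub>C e) has_sum s) ?E"
      using orthonormal_summable[OF E] unfolding summable_on_def by meson
    have "cinner s y = cinner x (T \<cdot> y)" for y
    proof -
      have 1: "((\<lambda>e. cinner (cinner x (T \<cdot> e) *\<^sub>C e) y) has_sum cinner s y) ?E"
        using has_sum_bounded_linear[OF cinner.bounded_linear_left s, of y] by (simp add: o_def)
      have "((\<lambda>e. T \<cdot> (cinner y e *\<^sub>C e)) has_sum T \<cdot> y) ?E"
        using has_sum_bounded_linear[OF cop.bounded_linear_right onb_has_sum[OF onb, of y], of T]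
        by (simp add: o_def)
      from has_sum_bounded_linear[OF cinner.bounded_linear_right this, of x]
      have 2: "((\<lambda>e. cinner x (T \<cdot> (cinner y e *\<^sub>C e))) has_sum cinner x (T \<cdot> y)) ?E"
        by (simp add: o_def)
      have "cinner (cinner x (T \<cdot> e) *\<^sub>C e) y = cinner x (T \<cdot> (cinner y e *\<^sub>C e))" for e
        by (simp add: cinner_scaleC_left cinner_scaleC_right flip: cinner_commute[of e y])
      with 1 2 show ?thesis using has_sum_unique by force
    qed
    then show ?thesis by blast
  qed
  then obtain s where s: "\<And>x y. cinner (s x) y = cinner x (T \<cdot> y)" by metis
  have add: "s (x + y) = s x + s y" for x y
    by (rule cinner_ext) (simp add: s cinner_add_left)
  have scale: "s (c *\<^sub>C x) = c *\<^sub>C s x" for c x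
    by (rule cinner_ext) (simp add: s cinner_scaleC_left)
  have "norm (s x) \<le> norm x * norm T" for x
  proof -
    have "(norm (s x))\<^sup>2 = Re (cinner x (T \<cdot> s x))"
      by (metis Re_cinner_self s)
    also have "\<dots> \<le> norm x * (norm T * norm (s x))"
      by (rule order_trans[OF Re_cinner_le]) (simp add: mult_left_mono norm_cop_apply)
    finally have "(norm (s x))\<^sup>2 \<le> (norm x * norm T) * norm (s x)" by simp
    then show ?thesis by (rule le_of_power2_le_mult) simp
  qed
  then have bl: "bounded_linear s"
    using add scale[of "complex_of_real _"] by (intro bounded_linear_intro) simp_all
  have "blinfun_of (Cop (Blinfun s)) = Blinfun s"
    by (rule Cop_inverse') (simp add: clinear_op_def bounded_linear_Blinfun_apply[OF bl] scale)
  then have "Cop (Blinfun s) \<cdot> x = s x" for x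
    by (simp add: cop_apply.rep_eq bounded_linear_Blinfun_apply[OF bl])
  with s show ?thesis by metis
qed

definition adj :: "'a::complex_hilbert_space cop \<Rightarrow> 'a cop" where
  "adj T = (SOME S. \<forall>x y. cinner (S \<cdot> x) y = cinner x (T \<cdot> y))"

lemma cinner_adj_left: "cinner (adj T \<cdot> x) y = cinner x (T \<cdot> y)"
  using someI_ex[OF adjoint_exists[of T]] unfolding adj_def by blast

lemma cinner_adj_right: "cinner x (adj T \<cdot> y) = cinner (T \<cdot> x) y"
  by (metis cinner_adj_left cinner_commute)

lemma adj_eqI: "(\<And>x y. cinner (S \<cdot> x) y = cinner x (T \<cdot> y)) \<Longrightarrow> adj T = S"
  by (metis cinner_adj_left cinner_ext cop_eqI)

lemma adj_adj [simp]: "adj (adj T) = T"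
  by (rule adj_eqI) (simp add: cinner_adj_right)

lemma adj_mult: "adj (A * B) = adj B * adj A"
  by (rule adj_eqI) (simp add: cinner_adj_left)

lemma adj_one [simp]: "adj 1 = 1"
  by (rule adj_eqI) simp

lemma adj_add: "adj (A + B) = adj A + adj B"
  by (rule adj_eqI) (simp add: cinner_adj_left cop.add_left cinner.add_left cinner.add_right)

lemma adj_diff: "adj (A - B) = adj A - adj B"
  by (rule adj_eqI) (simp add: cinner_adj_left cop.diff_left cinner.diff_left cinner.diff_right)

lemma adj_scaleR: "adj (r *\<^sub>R A) = r *\<^sub>R adj A"
  by (rule adj_eqI) (simp add: cinner_adj_left cop.scaleR_left cinner.scaleR_left cinner.scaleR_right)

lemma norm_adj_le: "norm (adj T) \<le> norm T"
proof (rule norm_cop_bound)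
  fix x
  have "(norm (adj T \<cdot> x))\<^sup>2 = Re (cinner x (T \<cdot> (adj T \<cdot> x)))"
    by (metis Re_cinner_self cinner_adj_left)
  also have "\<dots> \<le> norm x * (norm T * norm (adj T \<cdot> x))"
    by (rule order_trans[OF Re_cinner_le]) (simp add: mult_left_mono norm_cop_apply)
  finally have "(norm (adj T \<cdot> x))\<^sup>2 \<le> (norm T * norm x) * norm (adj T \<cdot> x)"
    by (simp add: ac_simps)
  then show "norm (adj T \<cdot> x) \<le> norm T * norm x"
    by (rule le_of_power2_le_mult) simp
qed simp

lemma norm_adj [simp]: "norm (adj T) = norm T"
  using norm_adj_le[of T] norm_adj_le[of "adj T"] by simp

lemma bounded_linear_adj: "bounded_linear adj"
  by (intro bounded_linear_intro[of _ 1]) (simp_all add: adj_add adj_scaleR)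

text \<open>The description in \<open>hadjoint\<close> ranges over all bounded real-linear maps, but
  its defining identity already determines every value, so a competitor \<open>S\<close> need not be
  known to be complex-linear.\<close>

lemma hadjoint_blinfun_of: "hadjoint (blinfun_of T) = blinfun_of (adj T)"
  unfolding hadjoint_def
proof (rule the_equality)
  show "\<forall>x y. cinner (blinfun_apply (blinfun_of (adj T)) x) y = cinner x (blinfun_apply (blinfun_of T) y)"
    using cinner_adj_left[of T] by (simp add: cop_apply.rep_eq)
  fix S assume "\<forall>x y. cinner (blinfun_apply S x) y = cinner x (blinfun_apply (blinfun_of T) y)"
  then have "cinner (blinfun_apply S x) y = cinner (adj T \<cdot> x) y" for x y
    by (simp add: cinner_adj_left flip: cop_apply.rep_eq)
  then show "S = blinfun_of (adj T)"
    by (metis blinfun_eqI cinner_ext cop_apply.rep_eq)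
qed

section \<open>Positive operators and the trace class\<close>

definition pos :: "'a::complex_hilbert_space cop \<Rightarrow> bool" where
  "pos P \<longleftrightarrow> (\<forall>x. Im (cinner (P \<cdot> x) x) = 0 \<and> 0 \<le> Re (cinner (P \<cdot> x) x))"

lemma positive_op_blinfun_of: "positive_op (blinfun_of P) \<longleftrightarrow> pos P"
  by (simp add: positive_op_def pos_def blinfun_of_clinear complex_is_Real_iff flip: cop_apply.rep_eq)

text \<open>A form that is real at \<open>x + y\<close> and at \<open>x + \<i> y\<close> is
  hermitian.\<close>

lemma pos_selfadj:
  assumes "pos P" shows "adj P = P"
proof (rule adj_eqI)
  fix x y
  have "Im (cinner (P \<cdot> (x + y)) (x + y)) = 0" "Im (cinner (P \<cdot> (x + \<i> *\<^sub>C y)) (x + \<i> *\<^sub>C y)) = 0"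
    "Im (cinner (P \<cdot> x) x) = 0" "Im (cinner (P \<cdot> y) y) = 0"
    using assms by (simp_all add: pos_def)
  then have "Im (cinner (P \<cdot> x) y) + Im (cinner (P \<cdot> y) x) = 0"
      "Re (cinner (P \<cdot> y) x) - Re (cinner (P \<cdot> x) y) = 0"
    by (simp_all add: cop.add_right cinner.add_left cinner.add_right cinner_scaleC_left
        cinner_scaleC_right)
  then have "cinner (P \<cdot> x) y = cnj (cinner (P \<cdot> y) x)"
    by (simp add: complex_eq_iff)
  then show "cinner (P \<cdot> x) y = cinner x (P \<cdot> y)"
    by (metis cinner_commute)
qed

text \<open>The norm of a self-adjoint operator is its numerical radius: four times
  \<open>Re (cinner (K \<cdot> x) y)\<close> is a difference of the form at \<open>x + y\<close> and
  \<open>x - y\<close>, and the parallelogram law bounds it.\<close>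

lemma selfadj_norm_le_1:
  assumes K: "adj K = K" and le: "\<And>x. \<bar>Re (cinner (K \<cdot> x) x)\<bar> \<le> (norm x)\<^sup>2"
  shows "norm K \<le> 1"
proof (rule norm_cop_bound)
  fix x
  have *: "Re (cinner (K \<cdot> x) y) \<le> ((norm x)\<^sup>2 + (norm y)\<^sup>2) / 2" for y
  proof -
    have "Re (cinner (K \<cdot> y) x) = Re (cinner (K \<cdot> x) y)"
      by (metis K Re_cinner_commute cinner_adj_left)
    then have "4 * Re (cinner (K \<cdot> x) y)
        = Re (cinner (K \<cdot> (x + y)) (x + y)) - Re (cinner (K \<cdot> (x - y)) (x - y))"
      by (simp add: cop.add_right cop.diff_right cinner.add_left cinner.add_right
          cinner.diff_left cinner.diff_right)
    also have "\<dots> \<le> (norm (x + y))\<^sup>2 + (norm (x - y))\<^sup>2"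
      using le[of "x + y"] le[of "x - y"] by linarith
    also have "\<dots> = 2 * ((norm x)\<^sup>2 + (norm y)\<^sup>2)"
      by (simp add: norm_add_sq norm_diff_sq)
    finally show ?thesis by simp
  qed
  show "norm (K \<cdot> x) \<le> 1 * norm x"
  proof (cases "K \<cdot> x = 0")
    case False
    then have "x \<noteq> 0" by auto
    \<comment> \<open>\<open>?c\<close> rescales the image of \<open>x\<close> to the length of
      \<open>x\<close>, where the arithmetic mean in the bound above equals the product of the
      norms.\<close>
    let ?c = "norm x / norm (K \<cdot> x)"
    have "norm x * norm (K \<cdot> x) = ?c * (norm (K \<cdot> x))\<^sup>2"
      using False by (simp add: power2_eq_square)
    also have "\<dots> = Re (cinner (K \<cdot> x) (?c *\<^sub>R (K \<cdot> x)))"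
      by (simp add: cinner_scaleR_right Re_cinner_self)
    also have "\<dots> \<le> ((norm x)\<^sup>2 + (norm (?c *\<^sub>R (K \<cdot> x)))\<^sup>2) / 2"
      by (rule *)
    also have "\<dots> = norm x * norm x"
      using False by (simp add: power2_eq_square)
    finally show ?thesis using \<open>x \<noteq> 0\<close> by simp
  qed simp
qed simp

text \<open>The iteration \<open>Y \<mapsto> (K + Y\<^sup>2) / 2\<close> is dominated termwise by the scalar one with \<open>K = 1\<close>,
  which increases to 1; its limit satisfies \<open>(1 - Y)\<^sup>2 = 1 - K\<close>.\<close>

lemma sqrt_iteration:
  fixes K :: "'a::complex_hilbert_space cop"
  assumes K: "adj K = K" "norm K \<le> 1"
  shows "\<exists>Y. adj Y = Y \<and> norm Y \<le> 1 \<and> Y = (1/2) *\<^sub>R (K + Y * Y) \<and> (\<forall>A. A * K = K * A \<longrightarrow> A * Y = Y * A)"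
proof -
  define Y where "Y n = ((\<lambda>Y. (1/2) *\<^sub>R (K + Y * Y)) ^^ n) 0" for n
  define y :: "nat \<Rightarrow> real" where "y n = ((\<lambda>y. (1/2) * (1 + y * y)) ^^ n) 0" for n
  have Y0: "Y 0 = 0" and YS: "Y (Suc n) = (1/2) *\<^sub>R (K + Y n * Y n)" for n
    by (simp_all add: Y_def)
  have y0: "y 0 = 0" and yS: "y (Suc n) = (1/2) * (1 + y n * y n)" for n
    by (simp_all add: y_def)
  have y1: "0 \<le> y n \<and> y n \<le> 1" for n
    by (induction n) (simp_all add: y0 yS mult_le_one)
  \<comment> \<open>Both bounds need one induction: the difference of the squares of consecutive
    iterates splits into two products with the factor \<open>Y (Suc n) - Y n\<close>, so the next
    increment is controlled by the present one together with the norms.\<close>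
  have step: "norm (Y (Suc n) - Y n) \<le> y (Suc n) - y n \<and> norm (Y n) \<le> y n" for n
  proof (induction n)
    case 0
    then show ?case using K by (simp add: YS yS Y0 y0)
  next
    case (Suc n)
    have nY: "norm (Y (Suc n)) \<le> y (Suc n)"
      using Suc norm_triangle_sub[of "Y (Suc n)" "Y n"] by linarith
    have d: "0 \<le> y (Suc n) - y n"
      using Suc order_trans[OF norm_ge_zero] by blast
    have "Y (Suc (Suc n)) - Y (Suc n)
        = (1/2) *\<^sub>R (Y (Suc n) * (Y (Suc n) - Y n) + (Y (Suc n) - Y n) * Y n)"
      unfolding YS[of "Suc n"] by (subst (2) YS) (simp add: algebra_simps)
    also have "norm \<dots> \<le> (1/2) * (norm (Y (Suc n)) * norm (Y (Suc n) - Y n) + norm (Y (Suc n) - Y n) * norm (Y n))"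
      by (simp add: norm_triangle_le norm_mult_ineq add_mono)
    also have "\<dots> \<le> (1/2) * (y (Suc n) * (y (Suc n) - y n) + (y (Suc n) - y n) * y n)"
      using Suc nY y1 d by (intro mult_left_mono add_mono mult_mono) auto
    also have "\<dots> = y (Suc (Suc n)) - y (Suc n)"
      unfolding yS[of "Suc n"] by (subst (5) yS) (simp add: algebra_simps)
    finally show ?case using nY by simp
  qed
  have "incseq y"
  proof (rule incseq_SucI)
    show "y n \<le> y (Suc n)" for n
      using step[of n] order_trans[OF norm_ge_zero, of "Y (Suc n) - Y n" "y (Suc n) - y n"] by simp
  qed
  have diff: "norm (Y (n + k) - Y n) \<le> y (n + k) - y n" for n k
  proof (induction k)
    case (Suc k)
    have "norm (Y (n + Suc k) - Y n) \<le> norm (Y (Suc (n + k)) - Y (n + k)) + norm (Y (n + k) - Y n)"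
      by (metis add_Suc_right diff_add_cancel add_diff_eq norm_triangle_ineq)
    also have "\<dots> \<le> y (Suc (n + k)) - y (n + k) + (y (n + k) - y n)"
      using step[of "n + k"] Suc by linarith
    finally show ?case by simp
  qed simp
  \<comment> \<open>The scalar iterates are monotone and bounded by 1, hence Cauchy; by
    \<open>diff\<close> this passes to the operators.\<close>
  have "convergent y"
    by (rule Bseq_monoseq_convergent[OF BseqI'[of _ 1] incseq_imp_monoseq[OF \<open>incseq y\<close>]]) (use y1 in auto)
  then have "Cauchy y" by (rule convergent_Cauchy)
  have "Cauchy Y"
  proof (rule metric_CauchyI)
    fix e :: real assume "e > 0"
    then obtain M where M: "\<And>m n. m \<ge> M \<Longrightarrow> n \<ge> M \<Longrightarrow> dist (y m) (y n) < e / 2"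
      using \<open>Cauchy y\<close> unfolding Cauchy_def by (meson half_gt_zero)
    have near: "norm (Y m - Y M) < e / 2" if "m \<ge> M" for m
    proof -
      have "norm (Y m - Y M) \<le> y m - y M" using diff[of M "m - M"] that by simp
      also have "\<dots> < e / 2" using M[OF that, of M] unfolding dist_real_def by linarith
      finally show ?thesis .
    qed
    have "dist (Y m) (Y n) < e" if "m \<ge> M" "n \<ge> M" for m n
    proof -
      have "dist (Y m) (Y n) \<le> norm (Y m - Y M) + norm (Y n - Y M)"
        by (metis dist_norm dist_triangle2)
      then show ?thesis using near[OF that(1)] near[OF that(2)] by simp
    qed
    then show "\<exists>M. \<forall>m\<ge>M. \<forall>n\<ge>M. dist (Y m) (Y n) < e" by blast
  qed
  then obtain L where L: "Y \<longlonglongrightarrow> L" using Cauchy_convergent_iff convergent_def by blast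
  have 1: "L = (1/2) *\<^sub>R (K + L * L)"
  proof (rule LIMSEQ_unique)
    show "(\<lambda>n. Y (Suc n)) \<longlonglongrightarrow> L" using L by (simp add: LIMSEQ_Suc)
    show "(\<lambda>n. Y (Suc n)) \<longlonglongrightarrow> (1/2) *\<^sub>R (K + L * L)" unfolding YS by (intro tendsto_intros L)
  qed
  have 2: "adj L = L"
  proof (rule LIMSEQ_unique)
    have "adj (Y n) = Y n" for n
      by (induction n) (simp_all add: Y0 YS adj_scaleR adj_add adj_mult K linear_0[OF bounded_linear.linear[OF bounded_linear_adj]])
    then show "(\<lambda>n. adj (Y n)) \<longlonglongrightarrow> L" using L by simp
    show "(\<lambda>n. adj (Y n)) \<longlonglongrightarrow> adj L" by (rule bounded_linear.tendsto[OF bounded_linear_adj L])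
  qed
  have 3: "norm L \<le> 1"
  proof (rule LIMSEQ_le_const2[OF tendsto_norm[OF L]])
    show "\<exists>N. \<forall>n\<ge>N. norm (Y n) \<le> 1" using step y1 order_trans by blast
  qed
  have 4: "A * L = L * A" if A: "A * K = K * A" for A
  proof (rule LIMSEQ_unique)
    have "A * Y n = Y n * A" for n
    proof (induction n)
      case (Suc n)
      have "A * (Y n * Y n) = Y n * Y n * A" by (metis Suc mult.assoc)
      then show ?case by (simp add: YS A distrib_left distrib_right)
    qed (simp add: Y0)
    then show "(\<lambda>n. A * Y n) \<longlonglongrightarrow> L * A" using tendsto_mult_right[OF L, of A] by (simp add: tendsto_mult L)
    show "(\<lambda>n. A * Y n) \<longlonglongrightarrow> A * L" by (intro tendsto_intros L)
  qed
  show ?thesis using 1 2 3 4 by blast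
qed

text \<open>After scaling, the form of \<open>P\<close> lies between 0 and that of the identity, so
  the complement is a self-adjoint contraction. Square root and resolvent both start from
  it.\<close>

lemma pos_scaled_complement:
  assumes "pos P" and c: "norm P \<le> c" "0 < c"
  shows "adj (1 - (1/c) *\<^sub>R P) = 1 - (1/c) *\<^sub>R P" and "norm (1 - (1/c) *\<^sub>R P) \<le> 1"
proof -
  show *: "adj (1 - (1/c) *\<^sub>R P) = 1 - (1/c) *\<^sub>R P"
    by (simp add: adj_diff adj_scaleR pos_selfadj[OF assms(1)])
  show "norm (1 - (1/c) *\<^sub>R P) \<le> 1"
  proof (rule selfadj_norm_le_1[OF *])
    fix x
    have "0 \<le> Re (cinner (P \<cdot> x) x)" using assms(1) by (simp add: pos_def)
    moreover have "Re (cinner (P \<cdot> x) x) \<le> norm P * norm x * norm x"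
      by (rule order_trans[OF Re_cinner_le]) (simp add: mult_right_mono norm_cop_apply)
    moreover have "norm P * norm x * norm x \<le> c * (norm x)\<^sup>2"
      unfolding power2_eq_square mult.assoc using c by (intro mult_right_mono) simp_all
    moreover have "Re (cinner ((1 - (1/c) *\<^sub>R P) \<cdot> x) x) = (norm x)\<^sup>2 - Re (cinner (P \<cdot> x) x) / c"
      by (simp add: cop.diff_left cop.scaleR_left cinner.diff_left cinner.scaleR_left Re_cinner_self)
    moreover from calculation have "0 \<le> Re (cinner (P \<cdot> x) x) / c" "Re (cinner (P \<cdot> x) x) / c \<le> (norm x)\<^sup>2"
      using c by (simp_all add: divide_le_eq mult.commute[of c])
    ultimately show "\<bar>Re (cinner ((1 - (1/c) *\<^sub>R P) \<cdot> x) x)\<bar> \<le> (norm x)\<^sup>2"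
      by linarith
  qed
qed

text \<open>The fixed point \<open>Y\<close> for \<open>K = 1 - P / c\<close> yields the root
  \<open>sqrt c (1 - Y)\<close>. The commutation clause is what uniqueness of the root will rest
  on.\<close>

lemma pos_sqrt_exists:
  assumes "pos P"
  shows "\<exists>S. pos S \<and> S * S = P \<and> (\<forall>A. A * P = P * A \<longrightarrow> A * S = S * A)"
proof -
  \<comment> \<open>The summand 1 keeps \<open>c\<close> positive when \<open>P = 0\<close>.\<close>
  define c where "c = norm P + 1"
  have c: "norm P \<le> c" "0 < c" by (simp_all add: c_def add_nonneg_pos)
  define K where "K = 1 - (1/c) *\<^sub>R P"
  obtain Y where Y: "adj Y = Y" "norm Y \<le> 1" "Y = (1/2) *\<^sub>R (K + Y * Y)"
    and comm: "\<And>A. A * K = K * A \<Longrightarrow> A * Y = Y * A"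
    using sqrt_iteration[of K] pos_scaled_complement[OF assms c] unfolding K_def by blast
  define S where "S = sqrt c *\<^sub>R (1 - Y)"
  have "2 *\<^sub>R Y = K + Y * Y" using arg_cong[OF Y(3), of "scaleR 2"] by simp
  then have "(1 - Y) * (1 - Y) = 1 - K" by (simp add: algebra_simps scaleR_2)
  then have SS: "S * S = P" using c by (simp add: S_def K_def)
  have "pos S"
    unfolding pos_def
  proof (intro allI conjI)
    fix x
    have "cinner (Y \<cdot> x) x = cnj (cinner (Y \<cdot> x) x)"
      by (metis Y(1) cinner_adj_left cinner_commute)
    then have "Im (cinner (Y \<cdot> x) x) = 0"
      by (metis Reals_cnj_iff complex_is_Real_iff)
    then show "Im (cinner (S \<cdot> x) x) = 0"
      by (simp add: S_def cop.diff_left cop.scaleR_left cinner.diff_left cinner.scaleR_left cinner_self)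
    have "Re (cinner (Y \<cdot> x) x) \<le> norm (Y \<cdot> x) * norm x" by (rule Re_cinner_le)
    also have "\<dots> \<le> 1 * norm x * norm x"
      by (intro mult_right_mono order_trans[OF norm_cop_apply] Y(2) norm_ge_zero)
    finally show "0 \<le> Re (cinner (S \<cdot> x) x)"
      using c by (simp add: S_def cop.diff_left cop.scaleR_left cinner.diff_left cinner.scaleR_left
          Re_cinner_self power2_eq_square)
  qed
  moreover have "A * S = S * A" if "A * P = P * A" for A
  proof -
    have "A * K = K * A" using that by (simp add: K_def algebra_simps)
    from comm[OF this] show ?thesis by (simp add: S_def algebra_simps)
  qed
  ultimately show ?thesis using SS by blast
qed

lemma pos_apply_eq_0:
  assumes "pos P" "Re (cinner (P \<cdot> x) x) = 0" shows "P \<cdot> x = 0"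
proof -
  obtain S where S: "pos S" "S * S = P" using pos_sqrt_exists[OF assms(1)] by blast
  have "Re (cinner (P \<cdot> x) x) = (norm (S \<cdot> x))\<^sup>2"
    unfolding S(2)[symmetric] cop_apply_mult
    by (metis Re_cinner_self S(1) cinner_adj_left pos_selfadj)
  then have "S \<cdot> x = 0" using assms(2) by simp
  then show ?thesis by (simp flip: S(2))
qed

text \<open>By commutation \<open>(S + Q) * (S - Q) = 0\<close>. At \<open>y\<close>, in the range
  of \<open>S - Q\<close>, two nonnegative forms thus add up to 0, so \<open>S\<close> and
  \<open>Q\<close> both annihilate \<open>y\<close>; self-adjointness of \<open>S - Q\<close> then
  gives \<open>cinner y y = 0\<close>.\<close>

lemma pos_sqrt_unique:
  assumes "pos Q" "pos S" "Q * Q = S * S" and comm: "Q * S = S * Q"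
  shows "Q = S"
proof (rule cop_eqI)
  fix x
  define y where "y = (S - Q) \<cdot> x"
  have "(S + Q) * (S - Q) = 0" using assms(3) comm by (simp add: algebra_simps)
  then have "(S + Q) \<cdot> y = 0" unfolding y_def by (metis cop.zero_left cop_apply_mult)
  then have "cinner (S \<cdot> y) y + cinner (Q \<cdot> y) y = 0"
    by (metis cinner.add_left cinner.zero_left cop.add_left)
  then have "Re (cinner (S \<cdot> y) y) + Re (cinner (Q \<cdot> y) y) = 0" by (metis plus_complex.sel(1) zero_complex.sel(1))
  moreover have "0 \<le> Re (cinner (S \<cdot> y) y)" "0 \<le> Re (cinner (Q \<cdot> y) y)"
    using assms(1,2) by (simp_all add: pos_def)
  ultimately have "Re (cinner (S \<cdot> y) y) = 0" "Re (cinner (Q \<cdot> y) y) = 0" by linarith+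
  then have "S \<cdot> y = 0" "Q \<cdot> y = 0" using pos_apply_eq_0 assms(1,2) by blast+
  then have "(S - Q) \<cdot> y = 0" by (simp add: cop.diff_left)
  moreover have "adj (S - Q) = S - Q" using assms(1,2) by (simp add: adj_diff pos_selfadj)
  ultimately have "cinner y y = 0" unfolding y_def by (metis cinner.zero_right cinner_adj_left y_def)
  then show "Q \<cdot> x = S \<cdot> x" by (simp add: cinner_self y_def cop.diff_left)
qed

text \<open>\<open>abs_op\<close> is a definite description, so uniqueness is needed as well: any
  other positive root \<open>Q\<close> commutes with its square, hence with the root
  \<open>S\<close> constructed here.\<close>

lemma abs_op_blinfun_of: "\<exists>P. pos P \<and> P * P = adj T * T \<and> abs_op (blinfun_of T) = blinfun_of P"
proof -
  have "cinner ((adj T * T) \<cdot> x) x = complex_of_real ((norm (T \<cdot> x))\<^sup>2)" for x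
    by (simp only: cop_apply_mult cinner_adj_left cinner_self)
  then have "pos (adj T * T)" by (simp add: pos_def)
  then obtain S where S: "pos S" "S * S = adj T * T" and comm: "\<And>A. A * (adj T * T) = adj T * T * A \<Longrightarrow> A * S = S * A"
    using pos_sqrt_exists by blast
  have "abs_op (blinfun_of T) = blinfun_of S"
    unfolding abs_op_def
  proof (rule the_equality)
    show "positive_op (blinfun_of S) \<and> blinfun_of S o\<^sub>L blinfun_of S = hadjoint (blinfun_of T) o\<^sub>L blinfun_of T"
      using S by (simp add: positive_op_blinfun_of hadjoint_blinfun_of flip: times_cop.rep_eq)
    fix P assume P: "positive_op P \<and> P o\<^sub>L P = hadjoint (blinfun_of T) o\<^sub>L blinfun_of T"
    then obtain Q where Q: "P = blinfun_of Q" by (metis Cop_inverse' positive_op_def)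
    have "pos Q" using P Q positive_op_blinfun_of by blast
    moreover have QQ: "Q * Q = adj T * T"
      using P unfolding Q hadjoint_blinfun_of by (simp add: blinfun_of_inject flip: times_cop.rep_eq)
    moreover have "Q * S = S * Q" by (rule comm) (simp add: mult.assoc flip: QQ)
    ultimately show "P = blinfun_of S" using pos_sqrt_unique[of Q S] S Q by simp
  qed
  with S show ?thesis by blast
qed

text \<open>The right and the left inverse are the fixed points of the contractive maps sending
  \<open>R\<close> to \<open>1 + B * R\<close> and to \<open>1 + R * B\<close>; associativity makes
  them equal.\<close>

lemma neumann_inverse:
  fixes B :: "'a::complex_hilbert_space cop"
  assumes "norm B < 1"
  shows "\<exists>R. R * (1 - B) = 1 \<and> (1 - B) * R = 1"
proof -
  have "\<exists>!R. 1 + B * R = R"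
    using assms by (intro banach_fix_type[where c = "norm B"])
      (auto simp: dist_norm norm_mult_ineq simp flip: right_diff_distrib)
  then obtain R where R: "1 + B * R = R" by blast
  have "\<exists>!R. 1 + R * B = R"
    using assms by (intro banach_fix_type[where c = "norm B"])
      (auto simp: dist_norm mult.commute[of "norm B"] norm_mult_ineq simp flip: left_diff_distrib)
  then obtain R' where R': "1 + R' * B = R'" by blast
  have 1: "(1 - B) * R = 1" using R by (simp add: left_diff_distrib) (metis add_diff_cancel_right')
  have 2: "R' * (1 - B) = 1" using R' by (simp add: right_diff_distrib) (metis add_diff_cancel_right')
  have "R' = R" using 1 2 by (metis mult.assoc mult_1 mult_1_right)
  with 1 2 show ?thesis by blast
qed

lemma pos_resolvent:
  assumes "pos P" "0 < \<epsilon>"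
  shows "\<exists>R. R * (P + \<epsilon> *\<^sub>R 1) = 1 \<and> (P + \<epsilon> *\<^sub>R 1) * R = 1"
proof -
  define c where "c = norm P + 1"
  have c: "norm P \<le> c" "0 < c" by (simp_all add: c_def add_nonneg_pos)
  \<comment> \<open>Chosen so that \<open>P + \<epsilon>\<close> equals
    \<open>(c + \<epsilon>) (1 - B)\<close>, with \<open>B\<close> of norm at most
    \<open>c / (c + \<epsilon>) < 1\<close>.\<close>
  define B where "B = (c / (c + \<epsilon>)) *\<^sub>R (1 - (1/c) *\<^sub>R P)"
  have "norm B \<le> c / (c + \<epsilon>)"
    using pos_scaled_complement(2)[OF assms(1) c] c assms(2) by (simp add: B_def mult_left_le divide_right_mono)
  also have "\<dots> < 1" using c assms(2) by simp
  finally obtain R where R: "R * (1 - B) = 1" "(1 - B) * R = 1" using neumann_inverse by blast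
  have "P + \<epsilon> *\<^sub>R 1 = (c + \<epsilon>) *\<^sub>R (1 - B)"
    using c assms(2) by (simp add: B_def scaleR_diff_right scaleR_add_left)
  then have "((1 / (c + \<epsilon>)) *\<^sub>R R) * (P + \<epsilon> *\<^sub>R 1) = 1" "(P + \<epsilon> *\<^sub>R 1) * ((1 / (c + \<epsilon>)) *\<^sub>R R) = 1"
    using R c assms(2) by simp_all
  then show ?thesis by blast
qed

text \<open>The least such \<open>B\<close> is the trace norm of \<open>T\<close>.\<close>

definition nuclear_bound :: "'a::complex_hilbert_space cop \<Rightarrow> real \<Rightarrow> bool" where
  "nuclear_bound T B \<longleftrightarrow> (\<forall>U F. norm U \<le> 1 \<longrightarrow> finite F \<longrightarrow> F \<subseteq> some_onb \<longrightarrow>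
     (\<Sum>e\<in>F. cmod (cinner (U * T \<cdot> e) e)) \<le> B)"

text \<open>The contractions \<open>(T (P + \<epsilon>)\<^sup>-\<^sup>1)\<^sup>*\<close>, where \<open>P\<close> is the absolute value of \<open>T\<close>, replace the
  partial isometry of the polar decomposition.\<close>

lemma trace_class_nuclear_bound:
  assumes nb: "nuclear_bound T B" shows "trace_class (blinfun_of T)"
proof -
  let ?E = "some_onb :: 'a set"
  have onb: "orthonormal_basis ?E" by (rule orthonormal_basis_some_onb)
  have norm_e: "norm e = 1" if "e \<in> ?E" for e
  proof (rule power2_eq_imp_eq)
    show "(norm e)\<^sup>2 = 1\<^sup>2"
      using onb that Re_cinner_self[of e] by (simp add: orthonormal_basis_def)
  qed simp_all
  obtain P where P: "pos P" "P * P = adj T * T" "abs_op (blinfun_of T) = blinfun_of P"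
    using abs_op_blinfun_of by blast
  have *: "(\<Sum>e\<in>F. Re (cinner (P \<cdot> e) e)) \<le> B + \<epsilon> * card F" if F: "finite F" "F \<subseteq> ?E" and "0 < \<epsilon>" for F and \<epsilon> :: real
  proof -
    obtain R where R: "R * (P + \<epsilon> *\<^sub>R 1) = 1" "(P + \<epsilon> *\<^sub>R 1) * R = 1"
      using pos_resolvent[OF P(1) \<open>0 < \<epsilon>\<close>] by blast
    have adjP: "adj (P + \<epsilon> *\<^sub>R 1) = P + \<epsilon> *\<^sub>R 1"
      by (simp add: adj_add adj_scaleR pos_selfadj[OF P(1)])
    have "adj R * (P + \<epsilon> *\<^sub>R 1) = 1"
      by (metis R(2) adjP adj_mult adj_one)
    then have adjR: "adj R = R" by (metis R(2) mult.assoc mult_1 mult_1_right)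
    \<comment> \<open>\<open>T\<close> and \<open>P\<close> have the same norm on every vector, and
      adding \<open>\<epsilon> y\<close> to the image of \<open>y\<close> under \<open>P\<close>
      only lengthens it, since the cross term is nonnegative.\<close>
    have "norm (T * R) \<le> 1"
    proof (rule norm_cop_bound)
      fix x
      define y where "y = R \<cdot> x"
      have x: "x = P \<cdot> y + \<epsilon> *\<^sub>R y"
        using arg_cong[OF R(2), of "\<lambda>A. A \<cdot> x"] by (simp add: y_def cop.add_left cop.scaleR_left)
      have "(norm (T \<cdot> y))\<^sup>2 = Re (cinner (adj T * T \<cdot> y) y)"
        by (simp add: cinner_adj_left Re_cinner_self)
      also have "\<dots> = (norm (P \<cdot> y))\<^sup>2"
        unfolding P(2)[symmetric] by (metis P(1) Re_cinner_self cinner_adj_left cop_apply_mult pos_selfadj)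
      also have "\<dots> \<le> (norm x)\<^sup>2"
        using P(1) \<open>0 < \<epsilon>\<close> by (simp add: x norm_add_sq cinner.scaleR_right pos_def)
      finally have "norm (T \<cdot> y) \<le> norm x" by (rule power2_le_imp_le) simp
      then show "norm (T * R \<cdot> x) \<le> 1 * norm x" by (simp add: y_def)
    qed simp
    then have "norm (adj (T * R)) \<le> 1" by simp
    then have le: "(\<Sum>e\<in>F. cmod (cinner (adj (T * R) * T \<cdot> e) e)) \<le> B"
      using nb F unfolding nuclear_bound_def by blast
    have RP: "R * P = 1 - \<epsilon> *\<^sub>R R" using R(1) by (simp add: algebra_simps)
    \<comment> \<open>The aim is \<open>P - \<epsilon> + \<epsilon>\<^sup>2 R\<close>. Its last term
      is positive, so passing from \<open>P\<close> to this operator lowers each diagonal entry by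
      at most \<open>\<epsilon>\<close>.\<close>
    have "adj (T * R) * T = R * (P * P)" by (simp add: adj_mult adjR P(2) mult.assoc)
    also have "\<dots> = R * P * P" by (simp add: mult.assoc)
    also have "\<dots> = P - \<epsilon> *\<^sub>R (R * P)" unfolding RP by (simp add: left_diff_distrib RP)
    also have "\<dots> = P - \<epsilon> *\<^sub>R 1 + (\<epsilon> * \<epsilon>) *\<^sub>R R" unfolding RP by (simp add: algebra_simps)
    finally have UT: "adj (T * R) * T = P - \<epsilon> *\<^sub>R 1 + (\<epsilon> * \<epsilon>) *\<^sub>R R" .
    have "Re (cinner (P \<cdot> e) e) \<le> cmod (cinner (adj (T * R) * T \<cdot> e) e) + \<epsilon>" if "e \<in> F" for e
    proof -
      define y where "y = R \<cdot> e"
      have e: "e = P \<cdot> y + \<epsilon> *\<^sub>R y"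
        using arg_cong[OF R(2), of "\<lambda>A. A \<cdot> e"] by (simp add: y_def cop.add_left cop.scaleR_left)
      have "Re (cinner (R \<cdot> e) e) = Re (cinner (P \<cdot> y) y) + \<epsilon> * (norm y)\<^sup>2"
        unfolding y_def[symmetric] by (subst e)
          (simp add: cinner.add_right cinner.scaleR_right Re_cinner_self Re_cinner_commute)
      then have "0 \<le> Re (cinner (R \<cdot> e) e)" using P(1) \<open>0 < \<epsilon>\<close> by (simp add: pos_def)
      then have "0 \<le> \<epsilon> * \<epsilon> * Re (cinner (R \<cdot> e) e)" using \<open>0 < \<epsilon>\<close> by simp
      then have "Re (cinner (P \<cdot> e) e) - \<epsilon> \<le> Re (cinner (adj (T * R) * T \<cdot> e) e)"
        unfolding UT using norm_e that F
        by (auto simp: cop.add_left cop.diff_left cop.scaleR_left cinner.add_left cinner.diff_left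
            cinner.scaleR_left Re_cinner_self)
      also have "\<dots> \<le> cmod (cinner (adj (T * R) * T \<cdot> e) e)" by (rule complex_Re_le_cmod)
      finally show ?thesis by simp
    qed
    then have "(\<Sum>e\<in>F. Re (cinner (P \<cdot> e) e)) \<le> (\<Sum>e\<in>F. cmod (cinner (adj (T * R) * T \<cdot> e) e) + \<epsilon>)"
      by (rule sum_mono)
    then show ?thesis using le by (simp add: sum.distrib mult.commute)
  qed
  have "(\<Sum>e\<in>F. Re (cinner (P \<cdot> e) e)) \<le> B" if F: "finite F" "F \<subseteq> ?E" for F
  proof (rule field_le_epsilon)
    fix d :: real assume "0 < d"
    \<comment> \<open>The error grows with \<open>card F\<close>, so \<open>\<epsilon>\<close> is
      chosen after \<open>F\<close>; the \<open>+ 1\<close> covers the empty set.\<close>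
    have "(\<Sum>e\<in>F. Re (cinner (P \<cdot> e) e)) \<le> B + d / (card F + 1) * card F"
      using *[OF F, of "d / (card F + 1)"] \<open>0 < d\<close> by (simp add: add_nonneg_pos)
    also have "\<dots> \<le> B + d" using \<open>0 < d\<close> by (simp add: field_simps)
    finally show "(\<Sum>e\<in>F. Re (cinner (P \<cdot> e) e)) \<le> B + d" .
  qed
  then have "(\<lambda>e. Re (cinner (P \<cdot> e) e)) summable_on ?E"
    using P(1) by (intro nonneg_bounded_partial_sums_imp_summable_on[where C = B])
      (auto simp: pos_def eventually_finite_subsets_at_top intro!: exI[of _ "{}"])
  then have "(\<lambda>e. complex_of_real (Re (cinner (P \<cdot> e) e))) summable_on ?E"
    by (rule summable_on_of_real)
  moreover have "complex_of_real (Re (cinner (P \<cdot> e) e)) = cinner (blinfun_apply (abs_op (blinfun_of T)) e) e" for e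
    using P(1) unfolding P(3) cop_apply.rep_eq[symmetric] by (simp add: pos_def complex_eq_iff)
  ultimately show ?thesis
    unfolding trace_class_def using onb blinfun_of_clinear by auto
qed

text \<open>Subadditivity is immediate for this notion, whereas the absolute value in
  \<open>trace_class\<close> does not respect sums. This is the reason to estimate through
  \<open>nuclear_bound\<close>.\<close>

lemma nuclear_bound_add:
  assumes "nuclear_bound S A" "nuclear_bound T B" shows "nuclear_bound (S + T) (A + B)"
  unfolding nuclear_bound_def
proof (intro allI impI)
  fix U :: "'a cop" and F assume U: "norm U \<le> 1" and F: "finite F" "F \<subseteq> (some_onb :: 'a set)"
  have "(\<Sum>e\<in>F. cmod (cinner (U * (S + T) \<cdot> e) e))
      \<le> (\<Sum>e\<in>F. cmod (cinner (U * S \<cdot> e) e) + cmod (cinner (U * T \<cdot> e) e))"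
    by (intro sum_mono) (simp add: cop.add_left cop.add_right cinner.add_left norm_triangle_ineq)
  also have "\<dots> \<le> A + B"
    unfolding sum.distrib using assms U F by (intro add_mono) (auto simp: nuclear_bound_def)
  finally show "(\<Sum>e\<in>F. cmod (cinner (U * (S + T) \<cdot> e) e)) \<le> A + B" .
qed

lemma nuclear_bound_zero: "nuclear_bound 0 0"
  by (simp add: nuclear_bound_def)

lemma nuclear_bound_sum:
  assumes "\<And>i. i \<in> I \<Longrightarrow> nuclear_bound (T i) (B i)"
  shows "nuclear_bound (\<Sum>i\<in>I. T i) (\<Sum>i\<in>I. B i)"
  using assms by (induction I rule: infinite_finite_induct) (simp_all add: nuclear_bound_zero nuclear_bound_add)

lemma nuclear_bound_mono: "nuclear_bound T A \<Longrightarrow> A \<le> B \<Longrightarrow> nuclear_bound T B"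
  unfolding nuclear_bound_def by (meson order_trans)

lemma nuclear_bound_scaleC:
  assumes "nuclear_bound T B" shows "nuclear_bound (c *\<^sub>C T) (cmod c * B)"
  using assms unfolding nuclear_bound_def
  by (simp add: cinner_scaleC_left norm_mult mult_left_mono flip: sum_distrib_left)

text \<open>Each inequality in \<open>nuclear_bound\<close> concerns a finite sum, which is
  continuous in the operator norm; the trace norm is lower semicontinuous.\<close>

lemma nuclear_bound_lim:
  assumes nb: "\<And>n. nuclear_bound (T n) B" and lim: "T \<longlonglongrightarrow> L"
  shows "nuclear_bound L B"
  unfolding nuclear_bound_def
proof (intro allI impI)
  fix U :: "'a cop" and F assume U: "norm U \<le> 1" and F: "finite F" "F \<subseteq> (some_onb :: 'a set)"
  have "(\<lambda>n. \<Sum>e\<in>F. cmod (cinner (U * T n \<cdot> e) e)) \<longlonglongrightarrow> (\<Sum>e\<in>F. cmod (cinner (U * L \<cdot> e) e))"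
    by (intro tendsto_intros cinner.tendsto cop.tendsto lim)
  then show "(\<Sum>e\<in>F. cmod (cinner (U * L \<cdot> e) e)) \<le> B"
    by (rule LIMSEQ_le_const2) (use nb U F in \<open>auto simp: nuclear_bound_def\<close>)
qed

section \<open>The Hilbert space of Hilbert-Schmidt operators\<close>

lemma finite_sums_bounded_summable:
  fixes f :: "'b \<Rightarrow> real"
  assumes "\<And>x. x \<in> A \<Longrightarrow> 0 \<le> f x" "\<And>F. finite F \<Longrightarrow> F \<subseteq> A \<Longrightarrow> sum f F \<le> C"
  shows "f summable_on A"
  using assms by (intro nonneg_bounded_partial_sums_imp_summable_on[where C = C])
    (auto simp: eventually_finite_subsets_at_top intro!: exI[of _ "{}"])

lemma summable_on_cinner:
  fixes f g :: "'b \<Rightarrow> 'a::complex_hilbert_space"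
  assumes "(\<lambda>e. (norm (f e))\<^sup>2) summable_on E" "(\<lambda>e. (norm (g e))\<^sup>2) summable_on E"
  shows "(\<lambda>e. cinner (f e) (g e)) summable_on E"
proof (rule abs_summable_summable, rule Infinite_Sum.abs_summable_on_comparison_test'[OF summable_on_add[OF assms]])
  fix e
  have "2 * (norm (f e) * norm (g e)) \<le> (norm (f e))\<^sup>2 + (norm (g e))\<^sup>2"
    using sum_squares_bound[of "norm (f e)" "norm (g e)"] by simp
  moreover have "0 \<le> norm (f e) * norm (g e)" by simp
  ultimately show "norm (cinner (f e) (g e)) \<le> (norm (f e))\<^sup>2 + (norm (g e))\<^sup>2"
    using cmod_cinner_le[of "f e" "g e"] by linarith
qed

lemma summable_on_norm_sq_add:
  fixes f g :: "'b \<Rightarrow> 'a::complex_hilbert_space"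
  assumes "(\<lambda>e. (norm (f e))\<^sup>2) summable_on E" "(\<lambda>e. (norm (g e))\<^sup>2) summable_on E"
  shows "(\<lambda>e. (norm (f e + g e))\<^sup>2) summable_on E"
proof -
  have "(\<lambda>e. (norm (f e))\<^sup>2 + 2 * Re (cinner (f e) (g e)) + (norm (g e))\<^sup>2) summable_on E"
    by (intro summable_on_add summable_on_cmult_right summable_on_Re assms summable_on_cinner)
  then show ?thesis by (simp add: norm_add_sq)
qed

definition hs_cond :: "'a::complex_hilbert_space cop \<Rightarrow> bool" where
  "hs_cond X \<longleftrightarrow> (\<lambda>e. (norm (X \<cdot> e))\<^sup>2) summable_on some_onb"

lemma hs_cond_zero: "hs_cond 0"
  by (simp add: hs_cond_def)

lemma hs_cond_add: "hs_cond A \<Longrightarrow> hs_cond B \<Longrightarrow> hs_cond (A + B)"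
  unfolding hs_cond_def cop.add_left by (rule summable_on_norm_sq_add)

lemma hs_cond_scaleC: "hs_cond A \<Longrightarrow> hs_cond (c *\<^sub>C A)"
  unfolding hs_cond_def by (simp add: norm_scaleC power_mult_distrib summable_on_cmult_right)

lemma hs_cond_scaleR: "hs_cond A \<Longrightarrow> hs_cond (r *\<^sub>R A)"
  unfolding hs_cond_def by (simp add: cop.scaleR_left power_mult_distrib summable_on_cmult_right)

lemma hs_cond_uminus: "hs_cond A \<Longrightarrow> hs_cond (- A)"
  unfolding hs_cond_def by (simp add: cop.minus_left)

lemma hs_cond_diff: "hs_cond A \<Longrightarrow> hs_cond B \<Longrightarrow> hs_cond (A - B)"
  using hs_cond_add[of A "- B"] hs_cond_uminus[of B] by simp

text \<open>Once this type is an instance of \<open>complex_hilbert_space\<close>, Cauchy-Schwarz,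
  convexity and the results on families of contractions apply to operators acting on Hilbert-Schmidt
  operators.\<close>

typedef (overloaded) 'a hs = "{X :: 'a::complex_hilbert_space cop. hs_cond X}"
  morphisms hs_op Hs
  using hs_cond_zero by blast

setup_lifting type_definition_hs

lemma hs_op_cond: "hs_cond (hs_op X)"
  using hs_op by blast

lemma hs_summable: "(\<lambda>e. (norm (hs_op X \<cdot> e))\<^sup>2) summable_on some_onb"
  using hs_op_cond by (simp add: hs_cond_def)

lemma hs_summable_cinner: "(\<lambda>e. cinner (hs_op X \<cdot> e) (hs_op Y \<cdot> e)) summable_on some_onb"
  by (intro summable_on_cinner hs_summable)

definition hs_inner :: "'a::complex_hilbert_space hs \<Rightarrow> 'a hs \<Rightarrow> complex" where
  "hs_inner X Y = (\<Sum>\<^sub>\<infinity>e\<in>some_onb. cinner (hs_op X \<cdot> e) (hs_op Y \<cdot> e))"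

lemma hs_inner_commute: "hs_inner X Y = cnj (hs_inner Y X)"
  unfolding hs_inner_def infsum_cnj[symmetric] by (intro infsum_cong cinner_commute)

lemma hs_inner_self: "hs_inner X X = complex_of_real (\<Sum>\<^sub>\<infinity>e\<in>some_onb. (norm (hs_op X \<cdot> e))\<^sup>2)"
  unfolding hs_inner_def cinner_self
  by (intro infsumI has_sum_of_real has_sum_infsum hs_summable)

lemma cop_eq_0I:
  assumes "\<And>e. e \<in> some_onb \<Longrightarrow> A \<cdot> e = 0" shows "A = 0"
proof (rule cop_eqI)
  fix x
  have "((\<lambda>e. A \<cdot> (cinner x e *\<^sub>C e)) has_sum A \<cdot> x) some_onb"
    using has_sum_bounded_linear[OF cop.bounded_linear_right onb_has_sum[OF orthonormal_basis_some_onb, of x], of A]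
    by (simp add: o_def)
  moreover have "((\<lambda>e. A \<cdot> (cinner x e *\<^sub>C e)) has_sum 0) some_onb"
    by (rule has_sum_0) (simp add: assms)
  ultimately show "A \<cdot> x = 0 \<cdot> x" using has_sum_unique by force
qed

text \<open>The real inner product comes first because the triangle inequality for the norm then
  follows from its class; completeness and the complex structure are added afterwards.\<close>

instantiation hs :: (complex_hilbert_space) real_inner
begin

lift_definition zero_hs :: "'a hs" is 0 by (rule hs_cond_zero)
lift_definition plus_hs :: "'a hs \<Rightarrow> 'a hs \<Rightarrow> 'a hs" is "(+)" by (rule hs_cond_add)
lift_definition minus_hs :: "'a hs \<Rightarrow> 'a hs \<Rightarrow> 'a hs" is "(-)" by (rule hs_cond_diff)
lift_definition uminus_hs :: "'a hs \<Rightarrow> 'a hs" is uminus by (rule hs_cond_uminus)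
lift_definition scaleR_hs :: "real \<Rightarrow> 'a hs \<Rightarrow> 'a hs" is "scaleR" by (rule hs_cond_scaleR)

definition inner_hs :: "'a hs \<Rightarrow> 'a hs \<Rightarrow> real" where "inner_hs X Y = Re (hs_inner X Y)"
definition norm_hs :: "'a hs \<Rightarrow> real" where "norm_hs X = sqrt (inner X X)"
definition dist_hs :: "'a hs \<Rightarrow> 'a hs \<Rightarrow> real" where "dist_hs A B = norm (A - B)"
definition sgn_hs :: "'a hs \<Rightarrow> 'a hs" where "sgn_hs A = inverse (norm A) *\<^sub>R A"
definition uniformity_hs :: "('a hs \<times> 'a hs) filter" where
  "uniformity_hs = (INF e\<in>{0<..}. principal {(x, y). dist x y < e})"
definition open_hs :: "'a hs set \<Rightarrow> bool" where
  "open_hs S = (\<forall>x\<in>S. \<forall>\<^sub>F (x', y) in uniformity. x' = x \<longrightarrow> y \<in> S)"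

instance
proof
  fix A B C :: "'a hs" and r s :: real
  show "A + B + C = A + (B + C)" "A + B = B + A" "0 + A = A" "- A + A = 0" "A - B = A + - B"
    by (transfer, simp add: ac_simps)+
  show "r *\<^sub>R (A + B) = r *\<^sub>R A + r *\<^sub>R B" "(r + s) *\<^sub>R A = r *\<^sub>R A + s *\<^sub>R A"
    "r *\<^sub>R s *\<^sub>R A = (r * s) *\<^sub>R A" "1 *\<^sub>R A = A"
    by (transfer, simp add: scaleR_add_right scaleR_add_left)+
  show "inner A B = inner B A"
    unfolding inner_hs_def by (subst hs_inner_commute) simp
  show "inner (A + B) C = inner A C + inner B C"
    unfolding inner_hs_def hs_inner_def plus_hs.rep_eq cop.add_left cinner.add_left
    by (subst infsum_add[OF hs_summable_cinner hs_summable_cinner]) simp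
  show "inner (r *\<^sub>R A) B = r * inner A B"
    unfolding inner_hs_def hs_inner_def scaleR_hs.rep_eq cop.scaleR_left cinner.scaleR_left
    by (subst infsum_scaleR_right) simp
  show "0 \<le> inner A A"
    unfolding inner_hs_def hs_inner_self by (simp add: infsum_nonneg)
  show "(inner A A = 0) = (A = 0)"
  proof
    assume "inner A A = 0"
    then have 0: "(\<Sum>\<^sub>\<infinity>e\<in>some_onb. (norm (hs_op A \<cdot> e))\<^sup>2) = 0"
      unfolding inner_hs_def hs_inner_self by simp
    have "hs_op A \<cdot> e = 0" if "e \<in> some_onb" for e
      using nonneg_infsum_le_0D[OF order.eq_iff[THEN iffD1, OF 0, THEN conjunct1] hs_summable _ that] by simp
    then have "hs_op A = 0" by (rule cop_eq_0I)
    then show "A = 0" by (simp flip: hs_op_inject zero_hs.rep_eq)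
  next
    assume "A = 0"
    then show "inner A A = 0" by (simp add: inner_hs_def hs_inner_self zero_hs.rep_eq)
  qed
  show "norm A = sqrt (inner A A)" by (rule norm_hs_def)
qed (rule dist_hs_def sgn_hs_def uniformity_hs_def open_hs_def)+

end

lemma norm_hs_sq: "(norm X)\<^sup>2 = (\<Sum>\<^sub>\<infinity>e\<in>some_onb. (norm (hs_op X \<cdot> e))\<^sup>2)"
  unfolding power2_norm_eq_inner inner_hs_def hs_inner_self by simp

lemma norm_hs_has_sum: "((\<lambda>e. (norm (hs_op X \<cdot> e))\<^sup>2) has_sum (norm X)\<^sup>2) some_onb"
  unfolding norm_hs_sq by (rule has_sum_infsum[OF hs_summable])

lemma norm_hs_partial:
  assumes "finite F" "F \<subseteq> some_onb"
  shows "(\<Sum>e\<in>F. (norm (hs_op X \<cdot> e))\<^sup>2) \<le> (norm X)\<^sup>2"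
  by (rule finite_sum_le_has_sum[OF norm_hs_has_sum]) (use assms in auto)

lemma norm_hs_le:
  assumes "0 \<le> C" "\<And>F. finite F \<Longrightarrow> F \<subseteq> some_onb \<Longrightarrow> (\<Sum>e\<in>F. (norm (hs_op X \<cdot> e))\<^sup>2) \<le> C\<^sup>2"
  shows "norm X \<le> C"
  by (rule power2_le_imp_le[OF has_sum_le_finite_sums[OF norm_hs_has_sum assms(2)] assms(1)])

lemma sum_mult_le_L2:
  assumes "finite F" "(\<Sum>i\<in>F. (f i)\<^sup>2) \<le> a\<^sup>2" "(\<Sum>i\<in>F. (g i)\<^sup>2) \<le> b\<^sup>2" "0 \<le> a" "0 \<le> b"
  shows "(\<Sum>i\<in>F. \<bar>f i\<bar> * \<bar>g i\<bar>) \<le> a * (b :: real)"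
proof -
  have "L2_set f F \<le> a" "L2_set g F \<le> b"
    unfolding L2_set_def using assms by (auto intro: real_le_lsqrt sum_nonneg)
  then show ?thesis
    using L2_set_mult_ineq[of f g F] assms by (meson L2_set_nonneg mult_mono order_trans)
qed

text \<open>Expansion in the basis and Cauchy-Schwarz. It makes Cauchy sequences of Hilbert-Schmidt
  operators converge in operator norm, which supplies the candidate limit for completeness.\<close>

lemma norm_hs_op_le: "norm (hs_op X) \<le> norm X"
proof (rule norm_cop_bound)
  fix x
  have "((\<lambda>e. hs_op X \<cdot> (cinner x e *\<^sub>C e)) has_sum hs_op X \<cdot> x) some_onb"
    using has_sum_bounded_linear[OF cop.bounded_linear_right onb_has_sum[OF orthonormal_basis_some_onb, of x], of "hs_op X"]
    by (simp add: o_def)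
  then have lim: "((\<lambda>F. norm (\<Sum>e\<in>F. cinner x e *\<^sub>C (hs_op X \<cdot> e))) \<longlongrightarrow> norm (hs_op X \<cdot> x)) (finite_subsets_at_top some_onb)"
    by (intro tendsto_norm) (simp add: has_sum_def)
  show "norm (hs_op X \<cdot> x) \<le> norm X * norm x"
  proof (rule tendsto_upperbound[OF lim])
    show "\<forall>\<^sub>F F in finite_subsets_at_top some_onb. norm (\<Sum>e\<in>F. cinner x e *\<^sub>C (hs_op X \<cdot> e)) \<le> norm X * norm x"
    proof (rule eventually_finite_subsets_at_top_weakI)
      fix F :: "'a set" assume F: "finite F" "F \<subseteq> some_onb"
      have "norm (\<Sum>e\<in>F. cinner x e *\<^sub>C (hs_op X \<cdot> e)) \<le> (\<Sum>e\<in>F. \<bar>cmod (cinner x e)\<bar> * \<bar>norm (hs_op X \<cdot> e)\<bar>)"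
        by (rule sum_norm_le) (simp add: norm_scaleC)
      also have "\<dots> \<le> norm x * norm X"
        using orthonormal_basis_some_onb by (intro sum_mult_le_L2 F bessel[of some_onb] norm_hs_partial)
          (auto simp: orthonormal_basis_alt)
      finally show "norm (\<Sum>e\<in>F. cinner x e *\<^sub>C (hs_op X \<cdot> e)) \<le> norm X * norm x" by (simp add: mult.commute)
    qed
  qed simp
qed simp

instantiation hs :: (complex_hilbert_space) complex_hilbert_space
begin

lift_definition scaleC_hs :: "complex \<Rightarrow> 'a hs \<Rightarrow> 'a hs" is "scaleC" by (rule hs_cond_scaleC)
definition cinner_hs :: "'a hs \<Rightarrow> 'a hs \<Rightarrow> complex" where "cinner_hs = hs_inner"

instance
proof
  fix X :: "nat \<Rightarrow> 'a hs" assume X: "Cauchy X"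
  have "dist (hs_op (X m)) (hs_op (X n)) \<le> dist (X m) (X n)" for m n
    unfolding dist_norm by (metis minus_hs.rep_eq norm_hs_op_le)
  then have "Cauchy (\<lambda>n. hs_op (X n))"
    using X unfolding Cauchy_def by (meson le_less_trans)
  then obtain T where T: "(\<lambda>n. hs_op (X n)) \<longlonglongrightarrow> T"
    using convergent_eq_Cauchy by blast
  \<comment> \<open>A bound over a fixed finite \<open>F\<close> passes to the operator-norm limit
    in \<open>m\<close>; the supremum over \<open>F\<close> is taken only afterwards.\<close>
  have near: "(\<Sum>e\<in>F. (norm ((hs_op (X n) - T) \<cdot> e))\<^sup>2) \<le> d\<^sup>2"
    if "\<And>m. m \<ge> N \<Longrightarrow> norm (X n - X m) \<le> d" "0 \<le> d" "finite F" "F \<subseteq> some_onb" for F n N d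
  proof (rule LIMSEQ_le_const2)
    show "(\<lambda>m. \<Sum>e\<in>F. (norm ((hs_op (X n) - hs_op (X m)) \<cdot> e))\<^sup>2) \<longlonglongrightarrow> (\<Sum>e\<in>F. (norm ((hs_op (X n) - T) \<cdot> e))\<^sup>2)"
      by (intro tendsto_intros cop.tendsto T)
    have "(\<Sum>e\<in>F. (norm ((hs_op (X n) - hs_op (X m)) \<cdot> e))\<^sup>2) \<le> d\<^sup>2" if "m \<ge> N" for m
      using norm_hs_partial[of F "X n - X m"] \<open>finite F\<close> \<open>F \<subseteq> some_onb\<close>
        power_mono[OF \<open>\<And>m. m \<ge> N \<Longrightarrow> norm (X n - X m) \<le> d\<close>[OF that], of 2]
      by (simp add: minus_hs.rep_eq)
    then show "\<exists>N. \<forall>m\<ge>N. (\<Sum>e\<in>F. (norm ((hs_op (X n) - hs_op (X m)) \<cdot> e))\<^sup>2) \<le> d\<^sup>2" by blast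
  qed
  have ev: "\<exists>N. \<forall>n\<ge>N. \<forall>m\<ge>N. norm (X n - X m) \<le> d" if "0 < d" for d
    using X that unfolding Cauchy_def dist_norm by (meson less_imp_le)
  obtain N1 where N1: "\<And>n m. n \<ge> N1 \<Longrightarrow> m \<ge> N1 \<Longrightarrow> norm (X n - X m) \<le> 1"
    using ev[of 1] by auto
  \<comment> \<open>\<open>near\<close> controls only the distance to the limit, so \<open>T\<close>
    itself is recovered as a difference of two Hilbert-Schmidt operators.\<close>
  have "hs_cond (hs_op (X N1) - T)"
    unfolding hs_cond_def
    by (rule finite_sums_bounded_summable[where C = "1\<^sup>2"]) (use near[of N1 N1 1] N1 in auto)
  then have "hs_cond (hs_op (X N1) - (hs_op (X N1) - T))"
    by (rule hs_cond_diff[OF hs_op_cond])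
  then have "hs_cond T" by simp
  then have rep: "hs_op (Hs T) = T" by (simp add: Hs_inverse)
  have "X \<longlonglongrightarrow> Hs T"
  proof (rule LIMSEQ_I)
    fix r :: real assume "0 < r"
    then obtain N where N: "\<And>n m. n \<ge> N \<Longrightarrow> m \<ge> N \<Longrightarrow> norm (X n - X m) \<le> r / 2"
      using ev[of "r / 2"] by auto
    have "norm (X n - Hs T) \<le> r / 2" if "n \<ge> N" for n
      by (rule norm_hs_le) (use near[of N n "r / 2"] N that \<open>0 < r\<close> in \<open>auto simp: minus_hs.rep_eq rep\<close>)
    then have "\<forall>n\<ge>N. norm (X n - Hs T) < r" using \<open>0 < r\<close> by fastforce
    then show "\<exists>N. \<forall>n\<ge>N. norm (X n - Hs T) < r" by blast
  qed
  then show "convergent X" by (rule convergentI)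
next
  fix X Y Z :: "'a hs" and a b :: complex and r :: real
  show "a *\<^sub>C (X + Y) = a *\<^sub>C X + a *\<^sub>C Y" "(a + b) *\<^sub>C X = a *\<^sub>C X + b *\<^sub>C X"
    "a *\<^sub>C b *\<^sub>C X = (a * b) *\<^sub>C X" "r *\<^sub>R X = complex_of_real r *\<^sub>C X"
    by (transfer, rule cop_eqI, simp add: cop.add_left cop.scaleR_left scaleC_add_right scaleC_add_left scaleC_scaleC)+
  show "cinner X Y = cnj (cinner Y X)"
    unfolding cinner_hs_def by (rule hs_inner_commute)
  show "cinner (X + Y) Z = cinner X Z + cinner Y Z"
    unfolding cinner_hs_def hs_inner_def plus_hs.rep_eq cop.add_left cinner.add_left
    by (rule infsum_add[OF hs_summable_cinner hs_summable_cinner])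
  show "cinner (a *\<^sub>C X) Y = a * cinner X Y"
    unfolding cinner_hs_def hs_inner_def scaleC_hs.rep_eq scaleC_cop_apply cinner_scaleC_left
    by (rule infsum_cmult_right')
  show "cinner X X = complex_of_real ((norm X)\<^sup>2)"
    unfolding cinner_hs_def hs_inner_self norm_hs_sq ..
qed

end

lemma cinner_hs_has_sum: "((\<lambda>e. cinner (hs_op X \<cdot> e) (hs_op Y \<cdot> e)) has_sum cinner X Y) some_onb"
  unfolding cinner_hs_def hs_inner_def by (rule has_sum_infsum[OF hs_summable_cinner])

lemma hs_eqI: "hs_op X = hs_op Y \<Longrightarrow> X = Y"
  by (simp add: hs_op_inject)

text \<open>The squared matrix entries, summed over both bases in the two orders, give the column
  norms of \<open>X\<close> and those of its adjoint.\<close>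

lemma has_sum_adj:
  assumes E: "orthonormal_basis E" "orthonormal_basis E'"
    and S: "((\<lambda>e. (norm (X \<cdot> e))\<^sup>2) has_sum S) E"
  shows "((\<lambda>f. (norm (adj X \<cdot> f))\<^sup>2) has_sum S) E'"
proof -
  let ?g = "\<lambda>(e, f). (cmod (cinner (X \<cdot> e) f))\<^sup>2"
  have 1: "((\<lambda>f. ?g (e, f)) has_sum (norm (X \<cdot> e))\<^sup>2) E'" for e
    using parseval[OF E(2)] by simp
  have "?g summable_on E \<times> E'"
    using S by (intro summable_on_SigmaI[OF 1]) (auto dest: has_sum_imp_summable)
  then have "(?g has_sum S) (E \<times> E')"
    by (intro has_sum_SigmaI[OF 1 S])
  then have "((\<lambda>(f, e). (cmod (cinner (X \<cdot> e) f))\<^sup>2) has_sum S) (E' \<times> E)"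
    by (subst has_sum_swap) (simp add: case_prod_unfold)
  moreover have "((\<lambda>e. case (f, e) of (f, e) \<Rightarrow> (cmod (cinner (X \<cdot> e) f))\<^sup>2) has_sum (norm (adj X \<cdot> f))\<^sup>2) E" for f
  proof -
    have "cmod (cinner (X \<cdot> e) f) = cmod (cinner (adj X \<cdot> f) e)" for e
      by (metis cinner_adj_left cinner_commute complex_mod_cnj)
    then show ?thesis using parseval[OF E(1)] by simp
  qed
  ultimately show ?thesis by (rule has_sum_SigmaD)
qed

lemma hs_cond_adj: "hs_cond X \<Longrightarrow> hs_cond (adj X)"
  unfolding hs_cond_def
  using has_sum_adj[OF orthonormal_basis_some_onb orthonormal_basis_some_onb] by (auto simp: summable_on_def)

text \<open>Two passages to the adjoint trade the basis of the definition for
  \<open>some_onb\<close>.\<close>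

lemma hilbert_schmidt_blinfun_of: "hilbert_schmidt (blinfun_of X) \<longleftrightarrow> hs_cond X"
proof
  assume "hilbert_schmidt (blinfun_of X)"
  then obtain E S where E: "orthonormal_basis E" "((\<lambda>e. (norm (X \<cdot> e))\<^sup>2) has_sum S) E"
    unfolding hilbert_schmidt_def cop_apply.rep_eq summable_on_def by blast
  have "hs_cond (adj X)"
    unfolding hs_cond_def using has_sum_adj[OF E(1) orthonormal_basis_some_onb E(2)]
    by (auto simp: summable_on_def)
  from hs_cond_adj[OF this] show "hs_cond X" by simp
next
  assume "hs_cond X"
  then show "hilbert_schmidt (blinfun_of X)"
    unfolding hilbert_schmidt_def hs_cond_def cop_apply.rep_eq
    using orthonormal_basis_some_onb blinfun_of_clinear by blast
qed

lemma hs_norm_hs_op: "hs_norm (blinfun_of (hs_op X)) = norm X"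
  unfolding hs_norm_def by (simp add: norm_hs_sq[symmetric] flip: cop_apply.rep_eq)

lemma hs_cond_mult_left: "hs_cond X \<Longrightarrow> hs_cond (A * X)"
  unfolding hs_cond_def
proof (rule summable_on_comparison_test)
  assume "(\<lambda>e. (norm (X \<cdot> e))\<^sup>2) summable_on some_onb"
  then show "(\<lambda>e. (norm A)\<^sup>2 * (norm (X \<cdot> e))\<^sup>2) summable_on some_onb"
    by (rule summable_on_cmult_right)
qed (simp_all add: norm_cop_apply power_mono flip: power_mult_distrib)

lemma hs_cond_mult_right: "hs_cond X \<Longrightarrow> hs_cond (X * A)"
  using hs_cond_adj[OF hs_cond_mult_left[OF hs_cond_adj, of X "adj A"]] by (simp add: adj_mult)

section \<open>Adjoints of Hilbert-Schmidt operators and their products with bounded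
  operators\<close>

lift_definition hs_adj :: "'a::complex_hilbert_space hs \<Rightarrow> 'a hs" is adj
  by (rule hs_cond_adj)

definition lmul :: "'a::complex_hilbert_space cop \<Rightarrow> 'a hs \<Rightarrow> 'a hs" where
  "lmul A X = Hs (A * hs_op X)"

definition rmul :: "'a::complex_hilbert_space hs \<Rightarrow> 'a cop \<Rightarrow> 'a hs" where
  "rmul X A = Hs (hs_op X * A)"

lemma hs_op_lmul: "hs_op (lmul A X) = A * hs_op X"
  by (simp add: lmul_def Hs_inverse hs_cond_mult_left hs_op_cond)

lemma hs_op_rmul: "hs_op (rmul X A) = hs_op X * A"
  by (simp add: rmul_def Hs_inverse hs_cond_mult_right hs_op_cond)

lemma hs_adj_adj [simp]: "hs_adj (hs_adj X) = X"
  by transfer simp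

lemma norm_hs_adj [simp]: "norm (hs_adj X) = norm X"
proof (rule power2_eq_imp_eq)
  have "((\<lambda>f. (norm (hs_op (hs_adj X) \<cdot> f))\<^sup>2) has_sum (norm X)\<^sup>2) some_onb"
    unfolding hs_adj.rep_eq
    by (rule has_sum_adj[OF orthonormal_basis_some_onb orthonormal_basis_some_onb norm_hs_has_sum])
  then show "(norm (hs_adj X))\<^sup>2 = (norm X)\<^sup>2"
    using norm_hs_has_sum has_sum_unique by blast
qed simp_all

lemma norm_lmul_le: "norm (lmul A X) \<le> norm A * norm X"
proof (rule norm_hs_le)
  fix F :: "'a set" assume F: "finite F" "F \<subseteq> some_onb"
  have "(\<Sum>e\<in>F. (norm (hs_op (lmul A X) \<cdot> e))\<^sup>2) \<le> (\<Sum>e\<in>F. (norm A)\<^sup>2 * (norm (hs_op X \<cdot> e))\<^sup>2)"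
    by (intro sum_mono) (simp add: hs_op_lmul norm_cop_apply power_mono flip: power_mult_distrib)
  also have "\<dots> \<le> (norm A * norm X)\<^sup>2"
    unfolding sum_distrib_left[symmetric] power_mult_distrib
    by (intro mult_left_mono norm_hs_partial F) simp
  finally show "(\<Sum>e\<in>F. (norm (hs_op (lmul A X) \<cdot> e))\<^sup>2) \<le> (norm A * norm X)\<^sup>2" .
qed simp

lemma rmul_eq: "rmul X A = hs_adj (lmul (adj A) (hs_adj X))"
  by (rule hs_eqI) (simp add: hs_op_rmul hs_adj.rep_eq hs_op_lmul adj_mult)

lemma norm_rmul_le: "norm (rmul X A) \<le> norm X * norm A"
  unfolding rmul_eq norm_hs_adj using norm_lmul_le[of "adj A" "hs_adj X"] by (simp add: mult.commute)

lemma norm_contraction_mul: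
  assumes "norm A \<le> 1" shows "norm (lmul A X) \<le> norm X" "norm (rmul X A) \<le> norm X"
  using norm_rmul_le[of X A] norm_lmul_le[of A X] assms
    mult_left_le[of "norm A" "norm X"] mult_left_le_one_le[of "norm X" "norm A"] by auto

lemma bounded_bilinear_lmul: "bounded_bilinear (lmul :: 'a::complex_hilbert_space cop \<Rightarrow> _)"
proof (intro bounded_bilinear.intro exI[of _ 1] allI)
  fix A B :: "'a cop" and X Y :: "'a hs" and r
  show "lmul (A + B) X = lmul A X + lmul B X" "lmul A (X + Y) = lmul A X + lmul A Y"
    "lmul (r *\<^sub>R A) X = r *\<^sub>R lmul A X" "lmul A (r *\<^sub>R X) = r *\<^sub>R lmul A X"
    by (rule hs_eqI, simp add: hs_op_lmul plus_hs.rep_eq scaleR_hs.rep_eq distrib_left distrib_right)+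
  show "norm (lmul A X) \<le> norm A * norm X * 1" by (simp add: norm_lmul_le)
qed

lemma bounded_bilinear_rmul: "bounded_bilinear (rmul :: 'a::complex_hilbert_space hs \<Rightarrow> _)"
proof (intro bounded_bilinear.intro exI[of _ 1] allI)
  fix A B :: "'a cop" and X Y :: "'a hs" and r
  show "rmul (X + Y) A = rmul X A + rmul Y A" "rmul X (A + B) = rmul X A + rmul X B"
    "rmul (r *\<^sub>R X) A = r *\<^sub>R rmul X A" "rmul X (r *\<^sub>R A) = r *\<^sub>R rmul X A"
    by (rule hs_eqI, simp add: hs_op_rmul plus_hs.rep_eq scaleR_hs.rep_eq distrib_left distrib_right)+
  show "norm (rmul X A) \<le> norm X * norm A * 1" by (simp add: norm_rmul_le)
qed

interpretation lmul: bounded_bilinear "lmul :: 'a::complex_hilbert_space cop \<Rightarrow> _"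
  by (rule bounded_bilinear_lmul)

interpretation rmul: bounded_bilinear "rmul :: 'a::complex_hilbert_space hs \<Rightarrow> _"
  by (rule bounded_bilinear_rmul)

lemma lmul_mult: "lmul (A * B) X = lmul A (lmul B X)"
  by (rule hs_eqI) (simp add: hs_op_lmul hs_op_rmul mult.assoc)

lemma rmul_mult: "rmul X (A * B) = rmul (rmul X A) B"
  by (rule hs_eqI) (simp add: hs_op_lmul hs_op_rmul mult.assoc)

lemma lmul_rmul: "lmul A (rmul X B) = rmul (lmul A X) B"
  by (rule hs_eqI) (simp add: hs_op_lmul hs_op_rmul mult.assoc)

lemma lmul_one [simp]: "lmul 1 X = X"
  by (rule hs_eqI) (simp add: hs_op_lmul)

lemma rmul_one [simp]: "rmul X 1 = X"
  by (rule hs_eqI) (simp add: hs_op_rmul)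

lemma lmul_scaleC: "lmul A (c *\<^sub>C X) = c *\<^sub>C lmul A X"
  by (rule hs_eqI, rule cop_eqI) (simp add: hs_op_lmul scaleC_hs.rep_eq)

lemma rmul_scaleC: "rmul (c *\<^sub>C X) A = c *\<^sub>C rmul X A"
  by (rule hs_eqI, rule cop_eqI) (simp add: hs_op_rmul scaleC_hs.rep_eq)

lemma cinner_lmul_adj: "cinner X (lmul (adj A) Y) = cinner (lmul A X) Y"
  unfolding cinner_hs_def hs_inner_def hs_op_lmul cop_apply_mult cinner_adj_right ..

text \<open>The adjoint is isometric and antilinear, so the two imaginary terms of
  \<open>polarization\<close> change places and the inner product gets conjugated. Cyclicity of the
  trace is a consequence.\<close>

lemma cinner_hs_adj: "cinner (hs_adj A) (hs_adj B) = cinner B A"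
proof -
  have op: "hs_op (i *\<^sub>C X) = i *\<^sub>C hs_op X" for i and X :: "'a hs" by (rule scaleC_hs.rep_eq)
  have adjC: "adj (c *\<^sub>C T) = cnj c *\<^sub>C adj T" for c and T :: "'a cop"
    by (rule adj_eqI) (simp add: cinner_scaleC_left cinner_scaleC_right cinner_adj_left)
  have 1: "hs_adj A + hs_adj B = hs_adj (A + B)" "hs_adj A - hs_adj B = hs_adj (A - B)"
    by (transfer, simp add: adj_add adj_diff)+
  have 2: "hs_adj A + \<i> *\<^sub>C hs_adj B = hs_adj (A - \<i> *\<^sub>C B)" "hs_adj A - \<i> *\<^sub>C hs_adj B = hs_adj (A + \<i> *\<^sub>C B)"
    by (rule hs_eqI, rule cop_eqI, simp add: hs_adj.rep_eq plus_hs.rep_eq minus_hs.rep_eq op adj_add adj_diff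
        adjC cop.add_left cop.diff_left scaleC.minus_left)+
  have "cinner (hs_adj A) (hs_adj B) = cnj (cinner A B)"
    unfolding polarization[of "hs_adj A"] polarization[of A] 1 2 norm_hs_adj by (simp add: complex_eq_iff field_simps)
  then show ?thesis by (metis cinner_commute)
qed

section \<open>Traces of products of Hilbert-Schmidt operators\<close>

text \<open>The trace of the product \<open>hs_op X * hs_op Y\<close>, written as an inner product
  so that convergence and continuity come for free.\<close>

definition tr :: "'a::complex_hilbert_space hs \<Rightarrow> 'a hs \<Rightarrow> complex" where
  "tr X Y = cinner X (hs_adj Y)"

lemma tr_has_sum: "((\<lambda>e. cinner (hs_op X * hs_op Y \<cdot> e) e) has_sum tr X Y) some_onb"
proof -
  have "tr X Y = cinner Y (hs_adj X)"
    unfolding tr_def using cinner_hs_adj[of "hs_adj X" Y] by simp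
  then show ?thesis
    using cinner_hs_has_sum[of Y "hs_adj X"] by (simp add: hs_adj.rep_eq cinner_adj_right)
qed

lemma tr_commute: "tr X Y = tr Y X"
  unfolding tr_def using cinner_hs_adj[of "hs_adj Y" X] by simp

lemma tr_rmul: "tr (rmul X A) Y = tr X (lmul A Y)"
  by (rule has_sum_unique[OF tr_has_sum]) (use tr_has_sum[of X "lmul A Y"] in \<open>simp add: hs_op_rmul hs_op_lmul mult.assoc\<close>)

text \<open>Cauchy-Schwarz over the basis, after the product of \<open>U\<close> and
  \<open>X\<close> has been moved to the other side of the inner product.\<close>

lemma nuclear_bound_mult: "nuclear_bound (hs_op X * hs_op Y) (norm X * norm Y)"
  unfolding nuclear_bound_def
proof (intro allI impI)
  fix U :: "'a cop" and F assume U: "norm U \<le> 1" and F: "finite F" "F \<subseteq> (some_onb :: 'a set)"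
  let ?Z = "hs_adj (lmul U X)"
  have "(\<Sum>e\<in>F. cmod (cinner (U * (hs_op X * hs_op Y) \<cdot> e) e))
      \<le> (\<Sum>e\<in>F. \<bar>norm (hs_op Y \<cdot> e)\<bar> * \<bar>norm (hs_op ?Z \<cdot> e)\<bar>)"
  proof (rule sum_mono)
    fix e
    have "cinner (U * (hs_op X * hs_op Y) \<cdot> e) e = cinner (hs_op Y \<cdot> e) (hs_op ?Z \<cdot> e)"
      by (simp add: hs_adj.rep_eq hs_op_lmul cinner_adj_right)
    then show "cmod (cinner (U * (hs_op X * hs_op Y) \<cdot> e) e) \<le> \<bar>norm (hs_op Y \<cdot> e)\<bar> * \<bar>norm (hs_op ?Z \<cdot> e)\<bar>"
      using cmod_cinner_le by simp
  qed
  also have "\<dots> \<le> norm Y * norm ?Z"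
    by (intro sum_mult_le_L2 norm_hs_partial F norm_ge_zero)
  also have "\<dots> \<le> norm Y * norm X"
    using norm_lmul_le[of U X] U mult_right_mono[OF U norm_ge_zero[of X]] by (intro mult_left_mono) auto
  finally show "(\<Sum>e\<in>F. cmod (cinner (U * (hs_op X * hs_op Y) \<cdot> e) e)) \<le> norm X * norm Y"
    by (simp add: mult.commute)
qed

lemma finite_rank_projection:
  assumes F: "finite F" "F \<subseteq> (some_onb :: 'a::complex_hilbert_space set)"
  shows "\<exists>Z :: 'a hs. \<forall>e\<in>some_onb. hs_op Z \<cdot> e = (if e \<in> F then e else 0)"
proof -
  define p where "p x = (\<Sum>f\<in>F. cinner x f *\<^sub>C f)" for x :: 'a
  have bl: "bounded_linear p"
    unfolding p_def by (intro bounded_linear_sum scaleC.bounded_linear_left[THEN bounded_linear_compose]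
        cinner.bounded_linear_left)
  have "clinear_op (Blinfun p)"
    by (simp add: clinear_op_def bounded_linear_Blinfun_apply[OF bl] p_def cinner_scaleC_left scaleC_scaleC
        scaleC.sum_right)
  then have P: "Cop (Blinfun p) \<cdot> x = p x" for x
    by (simp add: cop_apply.rep_eq Cop_inverse' bounded_linear_Blinfun_apply[OF bl])
  have pe: "p e = (if e \<in> F then e else 0)" if "e \<in> some_onb" for e
  proof -
    have "p e = (\<Sum>f\<in>F. if e = f then f else 0)"
      unfolding p_def using F that orthonormal_basis_some_onb
      by (intro sum.cong refl) (auto simp: orthonormal_basis_def subset_iff)
    then show ?thesis using F by simp
  qed
  have "hs_cond (Cop (Blinfun p))"
    unfolding hs_cond_def P by (rule finite_nonzero_values_imp_summable_on, rule finite_subset[OF _ F(1)]) (auto simp: pe split: if_splits)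
  then have "hs_op (Hs (Cop (Blinfun p))) = Cop (Blinfun p)" by (simp add: Hs_inverse)
  then show ?thesis using P pe by metis
qed

text \<open>\<open>Z\<close> projects onto finitely many basis vectors, and the error is a tail of
  the sum defining the norm of \<open>W\<close>. With the adjoint of \<open>V\<close> for
  \<open>W\<close>, this provides the operators whose moments are square summable.\<close>

lemma hs_right_approx:
  assumes "0 < \<delta>"
  shows "\<exists>Z. norm (W - lmul (hs_op W) Z) < \<delta>"
proof -
  have "\<forall>\<^sub>F F in finite_subsets_at_top some_onb. dist (\<Sum>e\<in>F. (norm (hs_op W \<cdot> e))\<^sup>2) ((norm W)\<^sup>2) < (\<delta>/2)\<^sup>2"
    using norm_hs_has_sum[of W] assms unfolding has_sum_def by (auto dest: tendstoD[where e = "(\<delta>/2)\<^sup>2"])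
  then obtain F where F: "finite F" "F \<subseteq> some_onb"
    and near: "dist (\<Sum>e\<in>F. (norm (hs_op W \<cdot> e))\<^sup>2) ((norm W)\<^sup>2) < (\<delta>/2)\<^sup>2"
    unfolding eventually_finite_subsets_at_top by (metis subset_refl)
  obtain Z :: "'a hs" where Z: "\<And>e. e \<in> some_onb \<Longrightarrow> hs_op Z \<cdot> e = (if e \<in> F then e else 0)"
    using finite_rank_projection[OF F] by blast
  have "norm (W - lmul (hs_op W) Z) \<le> \<delta> / 2"
  proof (rule norm_hs_le)
    fix G :: "'a set" assume G: "finite G" "G \<subseteq> some_onb"
    have "(\<Sum>e\<in>G. (norm (hs_op (W - lmul (hs_op W) Z) \<cdot> e))\<^sup>2) = (\<Sum>e\<in>G. if e \<in> F then 0 else (norm (hs_op W \<cdot> e))\<^sup>2)"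
      using G by (intro sum.cong refl) (auto simp: minus_hs.rep_eq hs_op_lmul cop.diff_left Z subset_iff)
    also have "\<dots> = (\<Sum>e\<in>G - F. (norm (hs_op W \<cdot> e))\<^sup>2)"
      using G by (subst sum.If_cases) (auto simp: Diff_eq Collect_neg_eq intro!: sum.cong)
    also have "\<dots> = (\<Sum>e\<in>G \<union> F. (norm (hs_op W \<cdot> e))\<^sup>2) - (\<Sum>e\<in>F. (norm (hs_op W \<cdot> e))\<^sup>2)"
      using G F by (subst sum_diff[symmetric]) (auto intro!: sum.cong)
    also have "\<dots> \<le> (\<delta>/2)\<^sup>2"
      using norm_hs_partial[of "G \<union> F" W] near G F unfolding dist_real_def by auto
    finally show "(\<Sum>e\<in>G. (norm (hs_op (W - lmul (hs_op W) Z) \<cdot> e))\<^sup>2) \<le> (\<delta>/2)\<^sup>2" .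
  qed (use assms in simp)
  then show ?thesis using assms by (intro exI[of _ Z]) linarith
qed

section \<open>Moment sequences of integrable functions on the circle\<close>

text \<open>Only exponents \<open>n \<ge> 0\<close> are tested, so \<open>\<eta>\<close> is
  determined modulo \<open>H1_circle\<close> and \<open>B\<close> bounds the norm in the
  quotient.\<close>

definition circle_rep :: "(nat \<Rightarrow> complex) \<Rightarrow> real \<Rightarrow> bool" where
  "circle_rep c B \<longleftrightarrow> (\<exists>\<eta>\<in>L1_circle. (\<forall>n. circle_integral (\<lambda>z. z ^ n * \<eta> z) = c n) \<and> L1_norm \<eta> \<le> B)"

lemma L1_circle_iff: "f \<in> L1_circle \<longleftrightarrow> integrable (lebesgue_on {0..2*pi}) (\<lambda>t. f (cis t))"
  by (simp add: L1_circle_def set_integrable_def integrable_restrict_space)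

lemma lebesgue_on_integral_eq:
  fixes f :: "real \<Rightarrow> 'b::euclidean_space"
  shows "integrable (lebesgue_on {0..2*pi}) f \<Longrightarrow> integral {0..2*pi} f = integral\<^sup>L (lebesgue_on {0..2*pi}) f"
  by (simp add: lebesgue_integral_eq_integral)

lemma L1_circleI_continuous: "continuous_on {0..2*pi} (\<lambda>t. f (cis t)) \<Longrightarrow> f \<in> L1_circle"
  by (simp add: L1_circle_def absolutely_integrable_continuous_real)

lemma L1_norm_eq: "f \<in> L1_circle \<Longrightarrow> L1_norm f = (\<integral>t. cmod (f (cis t)) \<partial>lebesgue_on {0..2*pi})"
  unfolding L1_norm_def L1_circle_iff by (intro lebesgue_on_integral_eq integrable_norm)

lemma borel_measurable_cis [measurable]: "cis \<in> borel_measurable (lebesgue_on {0..2*pi})"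
  by (intro continuous_imp_measurable_on_sets_lebesgue continuous_intros) simp

lemma integrable_bounded_mult:
  fixes f g :: "'b \<Rightarrow> complex"
  assumes "integrable M f" "g \<in> borel_measurable M" "\<And>t. cmod (g t) \<le> C"
  shows "integrable M (\<lambda>t. g t * f t)"
proof (rule Bochner_Integration.integrable_bound)
  show "integrable M (\<lambda>t. C * cmod (f t))" using assms(1) by simp
  show "(\<lambda>t. g t * f t) \<in> borel_measurable M" using assms by simp
  have "0 \<le> C" using assms(3) order_trans[OF norm_ge_zero] by blast
  then show "AE t in M. norm (g t * f t) \<le> norm (C * cmod (f t))"
    using assms(3) by (simp add: norm_mult mult_right_mono)
qed

text \<open>Completeness of the space of integrable functions: finiteness of the integral of the sum
  of absolute values makes the series converge absolutely almost everywhere, and the integrals can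
  be taken termwise.\<close>

lemma circle_rep_series:
  assumes rep: "\<And>j. circle_rep (d j) (B j)" and B: "summable B" and c: "\<And>n. (\<lambda>j. d j n) sums c n"
  shows "circle_rep c (suminf B)"
proof -
  let ?M = "lebesgue_on {0..2*pi}"
  obtain \<eta> where \<eta>: "\<And>j. \<eta> j \<in> L1_circle" "\<And>j n. circle_integral (\<lambda>z. z ^ n * \<eta> j z) = d j n"
    "\<And>j. L1_norm (\<eta> j) \<le> B j"
    using rep unfolding circle_rep_def by metis
  define f where "f j t = \<eta> j (cis t)" for j t
  have int: "integrable ?M (f j)" for j using \<eta>(1)[of j] by (simp add: L1_circle_iff f_def[abs_def])
  have le: "(\<integral>t. cmod (f j t) \<partial>?M) \<le> B j" for j
    using \<eta>(3)[of j] L1_norm_eq[OF \<eta>(1)[of j]] by (simp add: f_def)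
  have B0: "0 \<le> B j" for j by (rule order_trans[OF _ le[of j]]) simp
  have sumI: "summable (\<lambda>j. \<integral>t. cmod (f j t) \<partial>?M)"
    by (rule summable_comparison_test'[OF B, of 0]) (simp add: le)
  have "(\<integral>\<^sup>+t. (\<Sum>j. ennreal (cmod (f j t))) \<partial>?M) = (\<Sum>j. \<integral>\<^sup>+t. ennreal (cmod (f j t)) \<partial>?M)"
    using int by (intro nn_integral_suminf) (simp add: borel_measurable_integrable)
  also have "\<dots> = (\<Sum>j. ennreal (\<integral>t. cmod (f j t) \<partial>?M))"
    using int by (intro suminf_cong nn_integral_eq_integral) simp_all
  also have "\<dots> \<noteq> \<infinity>"
    using sumI by (simp add: ennreal_suminf_neq_top)
  finally have "AE t in ?M. (\<Sum>j. ennreal (cmod (f j t))) \<noteq> \<infinity>"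
    using int by (intro nn_integral_noteq_infinite) (simp_all add: borel_measurable_integrable)
  then have AE: "AE t in ?M. summable (\<lambda>j. cmod (f j t))"
    by eventually_elim (simp add: summable_suminf_not_top)
  define h where "h z = (\<Sum>j. \<eta> j z)" for z
  have h: "integrable ?M (\<lambda>t. h (cis t))"
    using integrable_suminf[OF int AE sumI] by (simp add: h_def f_def)
  then have hL: "h \<in> L1_circle" by (simp add: L1_circle_iff)
  have "circle_integral (\<lambda>z. z ^ n * h z) = c n" for n
  proof -
    define g where "g t = cis t ^ n * (\<i> * cis t)" for t
    have g: "g \<in> borel_measurable ?M" unfolding g_def by measurable
    have g1: "cmod (g t) \<le> 1" for t by (simp add: g_def norm_mult norm_power)
    have gf: "integrable ?M (\<lambda>t. g t * f j t)" for j
      by (rule integrable_bounded_mult[OF int g g1])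
    have norm_gf: "cmod (g t * f j t) = cmod (f j t)" for t j
      by (simp add: g_def norm_mult norm_power)
    have "(\<lambda>j. \<integral>t. g t * f j t \<partial>?M) sums (\<integral>t. (\<Sum>j. g t * f j t) \<partial>?M)"
      by (rule sums_integral[OF gf]) (simp_all add: norm_gf AE sumI)
    moreover have "(\<integral>t. g t * f j t \<partial>?M) = d j n" for j
      using \<eta>(2)[of n j] unfolding circle_integral_def lebesgue_on_integral_eq[OF gf, symmetric]
      by (simp add: g_def f_def mult_ac)
    moreover have "(\<integral>t. (\<Sum>j. g t * f j t) \<partial>?M) = (\<integral>t. g t * h (cis t) \<partial>?M)"
    proof (rule integral_cong_AE)
      show "AE t in ?M. (\<Sum>j. g t * f j t) = g t * h (cis t)"
        using AE by eventually_elim (simp add: h_def f_def suminf_mult summable_norm_cancel)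
      show "(\<lambda>t. \<Sum>j. g t * f j t) \<in> borel_measurable ?M"
        using gf by (intro borel_measurable_suminf) (simp add: borel_measurable_integrable)
      show "(\<lambda>t. g t * h (cis t)) \<in> borel_measurable ?M" using g h by simp
    qed
    moreover have "circle_integral (\<lambda>z. z ^ n * h z) = (\<integral>t. g t * h (cis t) \<partial>?M)"
      unfolding circle_integral_def lebesgue_on_integral_eq[OF integrable_bounded_mult[OF h g g1], symmetric]
      by (simp add: g_def mult_ac)
    ultimately show ?thesis using c[of n] sums_unique2 by fastforce
  qed
  moreover have "L1_norm h \<le> suminf B"
  proof -
    have "L1_norm h = (\<integral>t. cmod (h (cis t)) \<partial>?M)" by (rule L1_norm_eq[OF hL])
    also have "\<dots> \<le> (\<integral>t. (\<Sum>j. cmod (f j t)) \<partial>?M)"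
    proof (rule integral_mono_AE)
      show "integrable ?M (\<lambda>t. \<Sum>j. cmod (f j t))"
        by (rule integrable_suminf) (use int AE sumI in simp_all)
      show "AE t in ?M. cmod (h (cis t)) \<le> (\<Sum>j. cmod (f j t))"
        using AE by eventually_elim (simp add: h_def f_def summable_norm)
    qed (use h in simp)
    also have "\<dots> = (\<Sum>j. \<integral>t. cmod (f j t) \<partial>?M)"
      by (rule integral_suminf) (use int AE sumI in simp_all)
    also have "\<dots> \<le> suminf B" by (rule suminf_le[OF le sumI B])
    finally show ?thesis .
  qed
  ultimately show ?thesis using hL unfolding circle_rep_def by blast
qed

text \<open>Telescoping: the increments cost \<open>\<delta>/2\<close>, \<open>\<delta>/4\<close>
  and so on. The limit is required only for each \<open>n\<close> separately.\<close>

lemma circle_rep_limit: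
  assumes "circle_rep (d 0) B" and step: "\<And>j. circle_rep (\<lambda>n. d (Suc j) n - d j n) (\<delta> / 2 ^ Suc j)"
    and lim: "\<And>n. (\<lambda>j. d j n) \<longlonglongrightarrow> c n"
  shows "circle_rep c (B + \<delta>)"
proof -
  define e where "e j n = (if j = 0 then d 0 n else d j n - d (j - 1) n)" for j n
  define b where "b j = (if j = 0 then B else \<delta> / 2 ^ j)" for j
  have "(\<lambda>j. \<delta> * (1/2) ^ Suc j) sums (\<delta> * 1)"
    by (intro sums_mult power_half_series)
  then have "(\<lambda>j. b (Suc j)) sums \<delta>" by (simp add: b_def power_one_over field_simps)
  then have b: "b sums (B + \<delta>)"
    using sums_Suc[of b \<delta>] by (simp add: b_def add.commute)
  have "(\<Sum>j<Suc k. e j n) = d k n" for k n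
    by (induction k) (simp_all add: e_def)
  then have "(\<lambda>k. \<Sum>j<Suc k. e j n) \<longlonglongrightarrow> c n" for n using lim by simp
  then have "(\<lambda>j. e j n) sums c n" for n unfolding sums_def by (subst (asm) filterlim_sequentially_Suc)
  moreover have "circle_rep (e j) (b j)" for j
    using assms(1) step[of "j - 1"] by (cases j) (simp_all add: e_def[abs_def] b_def)
  ultimately have "circle_rep c (suminf b)"
    using b by (intro circle_rep_series) (auto simp: sums_iff)
  then show ?thesis using b by (simp add: sums_iff)
qed

lemma circle_rep_cong: "circle_rep c B \<Longrightarrow> (\<And>n. c n = c' n) \<Longrightarrow> B \<le> B' \<Longrightarrow> circle_rep c' B'"
  unfolding circle_rep_def by fastforce

lemma circle_rep_zero: "0 \<le> B \<Longrightarrow> circle_rep (\<lambda>_. 0) B"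
  unfolding circle_rep_def
  by (rule bexI[of _ "\<lambda>_. 0"]) (simp_all add: circle_integral_def L1_norm_def L1_circle_def)

lemma circle_rep_add:
  assumes "circle_rep c A" "circle_rep d B" shows "circle_rep (\<lambda>n. c n + d n) (A + B)"
proof -
  let ?e = "\<lambda>j n. if j = 0 then c n else if j = 1 then d n else (0::complex)"
  let ?b = "\<lambda>j. if j = 0 then A else if j = 1 then B else (0::real)"
  have fin: "f sums (f 0 + f 1)" if "\<And>j. j \<ge> 2 \<Longrightarrow> f j = 0" for f :: "nat \<Rightarrow> 'z::real_normed_vector"
    using sums_finite[of "{0,1}" f] that by (auto simp: not_less_eq_eq numeral_2_eq_2)
  have b: "?b sums (A + B)" using fin[of ?b] by simp
  have "circle_rep (\<lambda>n. c n + d n) (suminf ?b)"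
  proof (rule circle_rep_series[of ?e])
    show "circle_rep (?e j) (?b j)" for j
      using assms circle_rep_zero[of 0] by (cases "j = 0"; cases "j = 1") simp_all
    show "summable ?b" using b by (simp add: sums_iff)
    show "(\<lambda>j. ?e j n) sums (c n + d n)" for n using fin[of "\<lambda>j. ?e j n"] by simp
  qed
  then show ?thesis using b by (simp add: sums_iff)
qed

text \<open>Division by \<open>\<i> * z\<close>, of modulus 1 on the circle, converts integration in
  \<open>t\<close> into integration in \<open>z\<close>.\<close>

lemma circle_rep_continuous:
  assumes cont: "continuous_on {0..2*pi} (\<lambda>t. p (cis t))"
    and c: "\<And>n. integral {0..2*pi} (\<lambda>t. cis t ^ n * p (cis t)) = c n"
    and B: "integral {0..2*pi} (\<lambda>t. cmod (p (cis t))) \<le> B"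
  shows "circle_rep c B"
  unfolding circle_rep_def
proof (intro bexI conjI allI)
  let ?\<eta> = "\<lambda>z. p z / (\<i> * z)"
  show "?\<eta> \<in> L1_circle"
    by (rule L1_circleI_continuous) (intro continuous_intros cont, simp)
  show "circle_integral (\<lambda>z. z ^ n * ?\<eta> z) = c n" for n
    unfolding c[symmetric] circle_integral_def by (rule integral_cong) simp
  show "L1_norm ?\<eta> \<le> B"
    using B unfolding L1_norm_def by (simp add: norm_divide norm_mult)
qed

section \<open>Trigonometric polynomials on the circle\<close>

lemma integral_cis_int:
  "integral {0..2*pi} (\<lambda>t. cis (of_int k * t)) = (if k = 0 then complex_of_real (2*pi) else 0)"
proof (cases "k = 0")
  case False
  have "((\<lambda>t. cis (of_int k * t)) has_integral
      cis (of_int k * (2*pi)) / (\<i> * of_int k) - cis (of_int k * 0) / (\<i> * of_int k)) {0..2*pi}"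
  proof (rule fundamental_theorem_of_calculus)
    fix t :: real
    have "((\<lambda>z. exp (\<i> * of_int k * z) / (\<i> * of_int k)) has_field_derivative
        exp (\<i> * of_int k * of_real t)) (at (of_real t))"
      by (rule derivative_eq_intros refl)+ (use False in \<open>simp_all add: field_simps\<close>)
    then have "((\<lambda>t. exp (\<i> * of_int k * of_real t) / (\<i> * of_int k)) has_vector_derivative
        exp (\<i> * of_int k * of_real t)) (at t within {0..2*pi})"
      by (rule has_vector_derivative_real_field)
    then show "((\<lambda>t. cis (of_int k * t) / (\<i> * of_int k)) has_vector_derivative cis (of_int k * t)) (at t within {0..2*pi})"
      by (simp add: cis_conv_exp mult.assoc)
  qed simp
  moreover have "cis (of_int k * (2*pi)) = 1"
    using cis_multiple_2pi[of "of_int k"] by (simp add: mult.commute mult.left_commute)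
  ultimately show ?thesis using False by (simp add: integral_unique)
qed (simp add: scaleR_conv_of_real)

lemma has_integral_cis_int:
  "((\<lambda>t. cis (of_int k * t)) has_integral (if k = 0 then complex_of_real (2*pi) else 0)) {0..2*pi}"
  unfolding integral_cis_int[symmetric] has_integral_integral[symmetric]
  by (intro integrable_continuous_interval continuous_intros)

definition trig :: "int set \<Rightarrow> (int \<Rightarrow> complex) \<Rightarrow> complex \<Rightarrow> complex" where
  "trig I a z = (\<Sum>k\<in>I. a k * z powi k)"

lemma trig_cis: "trig I a (cis t) = (\<Sum>k\<in>I. a k * cis (of_int k * t))"
  by (simp add: trig_def cis_power_int)

lemma continuous_on_trig: "continuous_on S (\<lambda>t. trig I a (cis t))"
  unfolding trig_cis by (intro continuous_intros)

lemma integral_trig: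
  fixes a :: "int \<Rightarrow> complex"
  assumes "finite I"
  shows "integral {0..2*pi} (\<lambda>t. cis t ^ n * trig I a (cis t)) = (if - int n \<in> I then 2 * pi * a (- int n) else 0)"
proof (rule integral_unique)
  have "((\<lambda>t. \<Sum>k\<in>I. a k * cis (of_int (k + int n) * t)) has_integral
      (\<Sum>k\<in>I. a k * (if k + int n = 0 then complex_of_real (2*pi) else 0))) {0..2*pi}"
    by (intro has_integral_sum assms has_integral_mult_right has_integral_cis_int)
  moreover have "cis t ^ n * trig I a (cis t) = (\<Sum>k\<in>I. a k * cis (of_int (k + int n) * t))" for t
    unfolding trig_cis sum_distrib_left
    by (intro sum.cong refl) (simp add: Complex.DeMoivre cis_mult distrib_right add.commute)
  moreover have "(\<Sum>k\<in>I. a k * (if k + int n = 0 then complex_of_real (2*pi) else 0))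
      = (\<Sum>k\<in>I. if k = - int n then 2 * pi * a k else 0)"
    by (intro sum.cong refl) auto
  ultimately show "((\<lambda>t. cis t ^ n * trig I a (cis t)) has_integral (if - int n \<in> I then 2 * pi * a (- int n) else 0)) {0..2*pi}"
    using assms by simp
qed

lemma integral_trig_sq:
  assumes "finite I"
  shows "integral {0..2*pi} (\<lambda>t. (cmod (trig I a (cis t)))\<^sup>2) = 2 * pi * (\<Sum>k\<in>I. (cmod (a k))\<^sup>2)"
proof -
  have "((\<lambda>t. \<Sum>k\<in>I. \<Sum>l\<in>I. a k * cnj (a l) * cis (of_int (k - l) * t)) has_integral
      (\<Sum>k\<in>I. \<Sum>l\<in>I. a k * cnj (a l) * (if k - l = 0 then complex_of_real (2*pi) else 0))) {0..2*pi}"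
    by (intro has_integral_sum assms has_integral_mult_right has_integral_cis_int)
  moreover have "(\<Sum>k\<in>I. \<Sum>l\<in>I. a k * cnj (a l) * cis (of_int (k - l) * t)) = complex_of_real ((cmod (trig I a (cis t)))\<^sup>2)" for t
    unfolding complex_norm_square trig_cis cnj_sum sum_product
  proof (intro sum.cong refl)
    fix k l
    have "cis (of_int (k - l) * t) = cis (of_int k * t) * cis (- (of_int l * t))"
      by (simp add: cis_mult left_diff_distrib)
    then show "a k * cnj (a l) * cis (of_int (k - l) * t) = a k * cis (of_int k * t) * cnj (a l * cis (of_int l * t))"
      by (simp add: cis_cnj)
  qed
  moreover have "(\<Sum>k\<in>I. \<Sum>l\<in>I. a k * cnj (a l) * (if k - l = 0 then complex_of_real (2*pi) else 0))
      = (\<Sum>k\<in>I. complex_of_real (2 * pi * (cmod (a k))\<^sup>2))"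
  proof (intro sum.cong refl)
    fix k assume "k \<in> I"
    have "(\<Sum>l\<in>I. a k * cnj (a l) * (if k - l = 0 then complex_of_real (2*pi) else 0))
        = (\<Sum>l\<in>I. if k = l then 2 * pi * (a l * cnj (a l)) else 0)"
      by (intro sum.cong refl) auto
    then show "(\<Sum>l\<in>I. a k * cnj (a l) * (if k - l = 0 then complex_of_real (2*pi) else 0))
        = complex_of_real (2 * pi * (cmod (a k))\<^sup>2)"
      using assms \<open>k \<in> I\<close> by (simp flip: complex_norm_square)
  qed
  ultimately have "((\<lambda>t. complex_of_real ((cmod (trig I a (cis t)))\<^sup>2)) has_integral
      complex_of_real (2 * pi * (\<Sum>k\<in>I. (cmod (a k))\<^sup>2))) {0..2*pi}"
    by (simp add: sum_distrib_left)
  from has_integral_Re[OF this] show ?thesis by (intro integral_unique) simp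
qed

text \<open>The coefficient \<open>c n / (2 * pi)\<close> sits at the exponent \<open>- n\<close>,
  which the \<open>n\<close>-th moment selects. Cauchy-Schwarz bounds the integral norm by
  \<open>sqrt (2 * pi)\<close> times the square norm, which is exactly \<open>S\<close>.\<close>

lemma circle_rep_trig:
  "circle_rep (\<lambda>n. if n \<in> {a..<b} then c n else 0) (sqrt (\<Sum>n\<in>{a..<b}. (cmod (c n))\<^sup>2))"
proof -
  let ?I = "(\<lambda>n. - int n) ` {a..<b}"
  let ?a = "\<lambda>k. c (nat (- k)) / (2 * pi)"
  let ?p = "trig ?I ?a"
  define S where "S = sqrt (\<Sum>n\<in>{a..<b}. (cmod (c n))\<^sup>2)"
  have S0: "0 \<le> S" by (simp add: S_def sum_nonneg)
  have "(\<Sum>k\<in>?I. (cmod (?a k))\<^sup>2) = (\<Sum>n\<in>{a..<b}. (cmod (c n))\<^sup>2 / (2*pi)\<^sup>2)"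
    by (subst sum.reindex) (auto simp: inj_on_def norm_divide power_divide norm_mult)
  also have "\<dots> = S\<^sup>2 / (2*pi)\<^sup>2"
    by (simp add: S_def sum_nonneg flip: sum_divide_distrib)
  finally have sq: "integral {0..2*pi} (\<lambda>t. (cmod (?p (cis t)))\<^sup>2) = S\<^sup>2 / (2*pi)"
    by (subst integral_trig_sq) (simp_all add: power2_eq_square)
  have L1: "integral {0..2*pi} (\<lambda>t. cmod (?p (cis t))) \<le> S"
  proof (rule field_le_epsilon)
    fix d :: real assume "0 < d"
    \<comment> \<open>Cauchy-Schwarz is used as an arithmetic mean with parameter \<open>s\<close>;
      the positive \<open>d\<close> is added because \<open>S\<close> may vanish.\<close>
    define s where "s = S + d"
    have s: "0 < s" "S \<le> s" using S0 \<open>0 < d\<close> by (simp_all add: s_def)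
    have "integral {0..2*pi} (\<lambda>t. cmod (?p (cis t)))
        \<le> integral {0..2*pi} (\<lambda>t. s / (4*pi) + (pi / s) * (cmod (?p (cis t)))\<^sup>2)"
    proof (rule integral_le)
      fix t
      have "0 \<le> (s / (2*pi) - cmod (?p (cis t)))\<^sup>2 * (pi / s)" using s by simp
      also have "\<dots> = s / (4*pi) + (pi / s) * (cmod (?p (cis t)))\<^sup>2 - cmod (?p (cis t))"
        using s by (simp add: power2_diff power_divide power2_eq_square field_simps)
      finally show "cmod (?p (cis t)) \<le> s / (4*pi) + (pi / s) * (cmod (?p (cis t)))\<^sup>2" by simp
    qed (intro integrable_continuous_interval continuous_intros continuous_on_trig)+
    also have "\<dots> = s / (4*pi) * (2*pi) + (pi / s) * (S\<^sup>2 / (2*pi))"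
    proof -
      have "((\<lambda>t. (cmod (?p (cis t)))\<^sup>2) has_integral S\<^sup>2 / (2*pi)) {0..2*pi}"
        unfolding sq[symmetric] has_integral_integral[symmetric]
        by (intro integrable_continuous_interval continuous_intros continuous_on_trig)
      then show ?thesis
        by (intro integral_unique has_integral_add has_integral_mult_right)
          (use has_integral_const_real[of "s / (4*pi)" 0 "2*pi"] in \<open>simp_all add: mult.commute\<close>)
    qed
    also have "\<dots> = s / 2 + S\<^sup>2 / (2 * s)" using s by (simp add: field_simps)
    also have "S\<^sup>2 / (2 * s) \<le> s / 2"
      using s S0 power_mono[of S s 2] by (simp add: field_simps power2_eq_square)
    finally show "integral {0..2*pi} (\<lambda>t. cmod (?p (cis t))) \<le> S + d" by (simp add: s_def)
  qed
  have mom: "integral {0..2*pi} (\<lambda>t. cis t ^ n * ?p (cis t)) = (if n \<in> {a..<b} then c n else 0)" for n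
    by (subst integral_trig) auto
  show ?thesis
    by (rule circle_rep_continuous[OF continuous_on_trig mom L1[unfolded S_def]])
qed

text \<open>The sequence is cut into blocks, each represented by a trigonometric polynomial. The
  first block costs at most \<open>B\<close>, the later ones, chosen far enough out,
  \<open>\<delta>\<close> in total.\<close>

lemma circle_rep_l2:
  assumes le: "\<And>K. (\<Sum>n<K. (cmod (c n))\<^sup>2) \<le> B\<^sup>2" and "0 \<le> B" "0 < \<delta>"
  shows "circle_rep c (B + \<delta>)"
proof -
  have "summable (\<lambda>n. (cmod (c n))\<^sup>2)"
    by (rule summableI_nonneg_bounded[OF _ le]) simp
  then have "\<exists>N. \<forall>m\<ge>N. \<forall>n. norm (\<Sum>i\<in>{m..<n}. (cmod (c i))\<^sup>2) < (\<delta> / 2 ^ Suc j)\<^sup>2" for j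
    using \<open>0 < \<delta>\<close> unfolding summable_Cauchy by simp
  then obtain N where N: "\<And>j m n. m \<ge> N j \<Longrightarrow> norm (\<Sum>i\<in>{m..<n}. (cmod (c i))\<^sup>2) < (\<delta> / 2 ^ Suc j)\<^sup>2"
    by metis
  \<comment> \<open>An increasing majorant of \<open>N\<close>; the summand \<open>j\<close> makes
    it unbounded, so every index is eventually covered.\<close>
  define M where "M j = j + (\<Sum>i\<le>j. N i)" for j
  define d where "d j n = (if n \<in> {0..<M j} then c n else 0)" for j n
  have NM: "N j \<le> M j" for j
    using member_le_sum[of j "{..j}" N] by (simp add: M_def)
  show ?thesis
  proof (rule circle_rep_limit[of d])
    show "circle_rep (d 0) B"
      unfolding d_def using le[of "M 0"] \<open>0 \<le> B\<close>
      by (intro circle_rep_cong[OF circle_rep_trig refl]) (simp add: real_le_lsqrt atLeast0LessThan)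
    show "circle_rep (\<lambda>n. d (Suc j) n - d j n) (\<delta> / 2 ^ Suc j)" for j
    proof (rule circle_rep_cong[OF circle_rep_trig])
      show "(if n \<in> {M j..<M (Suc j)} then c n else 0) = d (Suc j) n - d j n" for n
        by (auto simp: d_def M_def)
      show "sqrt (\<Sum>n\<in>{M j..<M (Suc j)}. (cmod (c n))\<^sup>2) \<le> \<delta> / 2 ^ Suc j"
        using N[OF NM, of j "M (Suc j)"] \<open>0 < \<delta>\<close> by (intro real_le_lsqrt) (auto simp: abs_less_iff)
    qed
    show "(\<lambda>j. d j n) \<longlonglongrightarrow> c n" for n
      by (rule tendsto_eventually, rule eventually_sequentiallyI[of "Suc n"]) (simp add: d_def M_def)
  qed
qed

text \<open>\<open>c\<close> is a truncated Abel mean plus a rest of small square norm, to which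
  \<open>circle_rep_l2\<close> applies. The order of choices matters: \<open>K0\<close> from the
  tail of \<open>c\<close>, then \<open>r\<close> near 1 for the indices below \<open>K0\<close>,
  then \<open>K\<close>, since \<open>C r\<close> need not be bounded as \<open>r\<close> tends to
  1. One \<open>\<delta>\<close> pays for the Abel error, two for the rest.\<close>

lemma circle_rep_abel:
  assumes le: "\<And>K. (\<Sum>n<K. (cmod (c n))\<^sup>2) \<le> S\<^sup>2" and "0 \<le> B" "0 < \<epsilon>"
    and abel: "\<And>r K. 0 < r \<Longrightarrow> r < 1 \<Longrightarrow> circle_rep (\<lambda>n. if n < K then r ^ n * c n else 0) (B + C r * r ^ K)"
  shows "circle_rep c (B + \<epsilon>)"
proof -
  define \<delta> where "\<delta> = \<epsilon> / 3"
  have \<delta>: "0 < \<delta>" using \<open>0 < \<epsilon>\<close> by (simp add: \<delta>_def)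
  have "summable (\<lambda>n. (cmod (c n))\<^sup>2)"
    by (rule summableI_nonneg_bounded[OF _ le]) simp
  then obtain K0 where K0: "\<And>m n. m \<ge> K0 \<Longrightarrow> norm (\<Sum>i\<in>{m..<n}. (cmod (c i))\<^sup>2) < \<delta>\<^sup>2 / 2"
    using \<delta> unfolding summable_Cauchy by (metis half_gt_zero zero_less_power)
  have "((\<lambda>r. \<Sum>n<K0. ((1 - r ^ n) * cmod (c n))\<^sup>2) \<longlongrightarrow> (\<Sum>n<K0. ((1 - 1 ^ n) * cmod (c n))\<^sup>2)) (at_left (1::real))"
    by (intro tendsto_intros)
  then have "((\<lambda>r. \<Sum>n<K0. ((1 - r ^ n) * cmod (c n))\<^sup>2) \<longlongrightarrow> 0) (at_left (1::real))"
    by simp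
  then have "\<forall>\<^sub>F r in at_left (1::real). (\<Sum>n<K0. ((1 - r ^ n) * cmod (c n))\<^sup>2) < \<delta>\<^sup>2 / 2"
    by (rule order_tendstoD(2)) (use \<delta> in simp)
  moreover have "\<forall>\<^sub>F r in at_left (1::real). 0 < r \<and> r < 1"
    unfolding eventually_at_left_field by (rule exI[of _ 0]) auto
  ultimately obtain r where r: "0 < r" "r < 1" "(\<Sum>n<K0. ((1 - r ^ n) * cmod (c n))\<^sup>2) < \<delta>\<^sup>2 / 2"
    by (metis (mono_tags, lifting) eventually_conj eventually_happens trivial_limit_at_left_real)
  have "(\<lambda>K. C r * r ^ K) \<longlonglongrightarrow> C r * 0"
    using r by (intro tendsto_intros LIMSEQ_realpow_zero) auto
  then have "\<forall>\<^sub>F K in sequentially. C r * r ^ K < \<delta>"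
    using \<delta> by (intro order_tendstoD(2)) simp_all
  then obtain K where K: "K \<ge> K0" "C r * r ^ K < \<delta>"
    unfolding eventually_sequentially by (meson nat_le_linear)
  define d where "d n = c n - (if n < K then r ^ n * c n else 0)" for n
  have d_eq: "cmod (d n) = (1 - r ^ n) * cmod (c n)" if "n < K" for n
  proof -
    have "d n = complex_of_real (1 - r ^ n) * c n" using that by (simp add: d_def left_diff_distrib)
    then show ?thesis using r power_le_one[of r n] by (simp only: norm_mult norm_of_real) simp
  qed
  have d_le: "cmod (d n) \<le> cmod (c n)" for n
  proof (cases "n < K")
    case True
    then show ?thesis
      using r by (simp add: d_eq mult_left_le_one_le power_le_one)
  qed (simp add: d_def)
  have "(\<Sum>n<m. (cmod (d n))\<^sup>2) \<le> \<delta>\<^sup>2" for m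
  proof -
    have "(\<Sum>n<m. (cmod (d n))\<^sup>2) \<le> (\<Sum>n<max m K0. (cmod (d n))\<^sup>2)"
      by (intro sum_mono2) auto
    also have "\<dots> = (\<Sum>n<K0. (cmod (d n))\<^sup>2) + (\<Sum>n\<in>{K0..<max m K0}. (cmod (d n))\<^sup>2)"
      by (metis lessThan_atLeast0 max.cobounded2 sum.atLeastLessThan_concat zero_le)
    also have "(\<Sum>n<K0. (cmod (d n))\<^sup>2) = (\<Sum>n<K0. ((1 - r ^ n) * cmod (c n))\<^sup>2)"
      using K by (intro sum.cong refl) (simp add: d_eq)
    also have "(\<Sum>n\<in>{K0..<max m K0}. (cmod (d n))\<^sup>2) \<le> (\<Sum>n\<in>{K0..<max m K0}. (cmod (c n))\<^sup>2)"
      by (intro sum_mono power_mono d_le) simp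
    finally show ?thesis using r(3) K0[of K0 "max m K0"] by (simp add: abs_less_iff)
  qed
  then have "circle_rep d (\<delta> + \<delta>)" using \<delta> by (intro circle_rep_l2) auto
  from circle_rep_add[OF abel[OF r(1,2), of K] this]
  show ?thesis by (rule circle_rep_cong) (use K(2) in \<open>auto simp: d_def \<delta>_def\<close>)
qed

section \<open>Averages of moments over a family of contractions\<close>

abbreviation unit_square :: "(real \<times> real) set" where
  "unit_square \<equiv> cbox (0, 0) (1, 1)"

text \<open>The first coordinate is \<open>s\<close>, the second \<open>t\<close>. The weight, that
  of Taylor's integral remainder, is not normalized: see \<open>avg_const\<close>.\<close>

definition avg :: "(real \<times> real \<Rightarrow> 'b::euclidean_space) \<Rightarrow> 'b" where
  "avg f = integral unit_square (\<lambda>p. (1 - fst p) *\<^sub>R f p)"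

lemma avg_integrable:
  fixes f :: "real \<times> real \<Rightarrow> 'b::euclidean_space"
  shows "continuous_on unit_square f \<Longrightarrow> (\<lambda>p. (1 - fst p) *\<^sub>R f p) integrable_on unit_square"
  by (intro integrable_continuous continuous_intros)

lemma avg_add:
  "continuous_on unit_square f \<Longrightarrow> continuous_on unit_square g \<Longrightarrow> avg (\<lambda>p. f p + g p) = avg f + avg g"
  unfolding avg_def scaleR_add_right by (rule Henstock_Kurzweil_Integration.integral_add[OF avg_integrable avg_integrable])

lemma avg_bounded_linear:
  assumes "bounded_linear h" "continuous_on unit_square f"
  shows "avg (\<lambda>p. h (f p)) = h (avg f)"
  unfolding avg_def using integral_linear[OF avg_integrable[OF assms(2)] assms(1)]
  by (simp add: o_def linear_scale[OF bounded_linear.linear[OF assms(1)]])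

lemma avg_sum:
  assumes "finite I" "\<And>i. i \<in> I \<Longrightarrow> continuous_on unit_square (f i)"
  shows "avg (\<lambda>p. \<Sum>i\<in>I. f i p) = (\<Sum>i\<in>I. avg (f i))"
  unfolding avg_def scaleR_sum_right using assms by (intro Henstock_Kurzweil_Integration.integral_sum avg_integrable)

lemma avg_mono:
  fixes f g :: "real \<times> real \<Rightarrow> real"
  assumes "continuous_on unit_square f" "continuous_on unit_square g" "\<And>p. p \<in> unit_square \<Longrightarrow> f p \<le> g p"
  shows "avg f \<le> avg g"
  unfolding avg_def
proof (rule integral_le[OF avg_integrable[OF assms(1)] avg_integrable[OF assms(2)]])
  fix p :: "real \<times> real" assume p: "p \<in> unit_square"
  then have "fst p \<le> 1" by (cases p) simp
  then show "(1 - fst p) *\<^sub>R f p \<le> (1 - fst p) *\<^sub>R g p" using assms(3)[OF p] by (simp add: mult_left_mono)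
qed

lemma avg_const: "avg (\<lambda>_. c) = (1/2) *\<^sub>R c"
proof -
  have "integral unit_square (\<lambda>p::real \<times> real. (1 - fst p)) = integral (cbox 0 1) (\<lambda>s. integral (cbox 0 1) (\<lambda>t::real. (1 - s::real)))"
    by (subst integral_prod_continuous) (auto intro!: continuous_intros)
  also have "\<dots> = integral {0..1} (\<lambda>s::real. 1 - s)" by simp
  also have "\<dots> = 1/2"
  proof (rule integral_unique)
    have "((\<lambda>s::real. 1 - s) has_integral (1 - 1\<^sup>2/2) - (0 - 0\<^sup>2/2)) {0..1}"
      by (rule fundamental_theorem_of_calculus[where f = "\<lambda>s. s - s\<^sup>2/2"])
        (auto intro!: derivative_eq_intros simp: has_real_derivative_iff_has_vector_derivative[symmetric])
    then show "((\<lambda>s::real. 1 - s) has_integral 1/2) {0..1}" by simp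
  qed
  finally show ?thesis
    unfolding avg_def
    using integral_linear[of "\<lambda>p::real \<times> real. 1 - fst p" unit_square "\<lambda>r. r *\<^sub>R c"]
    by (simp add: o_def integrable_continuous continuous_intros bounded_linear_scaleR_left)
qed

lemma avg_Re: "continuous_on unit_square f \<Longrightarrow> avg (\<lambda>p. Re (f p)) = Re (avg f)"
  by (rule avg_bounded_linear[OF bounded_linear_Re])

lemma avg_cmult: "continuous_on unit_square f \<Longrightarrow> avg (\<lambda>p. c * f p) = c * avg f" for c :: complex
  by (rule avg_bounded_linear[OF bounded_linear_mult_right])

lemma integral_le_inverse_sqrt:
  assumes g: "g integrable_on {0..1}" and le: "\<And>t. 0 < t \<Longrightarrow> t \<le> 1 \<Longrightarrow> g t \<le> C / sqrt t"
  shows "integral {0..1} g \<le> (2 * C :: real)"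
proof -
  have "((\<lambda>t. C / sqrt t) has_integral (2 * C * sqrt 1 - 2 * C * sqrt 0)) {0..1}"
  proof (rule fundamental_theorem_of_calculus_interior)
    fix t :: real assume t: "t \<in> {0<..<1}"
    have "((\<lambda>t. 2 * C * sqrt t) has_real_derivative C / sqrt t) (at t)"
      by (rule derivative_eq_intros refl | use t in \<open>simp add: field_simps\<close>)+
    then show "((\<lambda>t. 2 * C * sqrt t) has_vector_derivative C / sqrt t) (at t)"
      by (simp add: has_real_derivative_iff_has_vector_derivative)
  qed (auto intro!: continuous_intros)
  then have "((\<lambda>t. C / sqrt t) has_integral 2 * C) {0..1}" by simp
  \<comment> \<open>\<open>C / sqrt 0\<close> is 0 by the convention for division, so the majorant
    gets the value \<open>g 0\<close> at that point; the integral does not change.\<close>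
  then have "((\<lambda>t. if t = 0 then g 0 else C / sqrt t) has_integral 2 * C) {0..1}"
    by (rule has_integral_spike_finite[of "{0}", rotated 2]) simp_all
  then show ?thesis
    by (rule has_integral_le[OF integrable_integral[OF g]]) (use le in auto)
qed

lemma integral_square_le_inverse_sqrt:
  fixes g :: "real \<times> real \<Rightarrow> real"
  assumes g: "continuous_on unit_square g"
    and le: "\<And>s t. 0 < s \<Longrightarrow> s \<le> 1 \<Longrightarrow> 0 < t \<Longrightarrow> t \<le> 1 \<Longrightarrow> g (s, t) \<le> C / (sqrt s * sqrt t)"
  shows "integral unit_square g \<le> 4 * C"
proof -
  have "integral unit_square g = integral {0..1} (\<lambda>s. integral {0..1} (\<lambda>t. g (s, t)))"
    using integral_prod_continuous[OF g] by simp
  also have "\<dots> \<le> 2 * (2 * C)"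
  proof (rule integral_le_inverse_sqrt)
    show "(\<lambda>s. integral {0..1} (\<lambda>t. g (s, t))) integrable_on {0..1}"
      using integral_integrable_2dim[OF g] by simp
    fix s :: real assume s: "0 < s" "s \<le> 1"
    have "integral {0..1} (\<lambda>t. g (s, t)) \<le> 2 * (C / sqrt s)"
    proof (rule integral_le_inverse_sqrt)
      show "(\<lambda>t. g (s, t)) integrable_on {0..1}"
        by (intro integrable_continuous_interval continuous_on_compose2[OF g] continuous_intros) (use s in auto)
    qed (use le[OF s] in \<open>simp add: divide_divide_eq_left\<close>)
    then show "integral {0..1} (\<lambda>t. g (s, t)) \<le> 2 * C / sqrt s" by simp
  qed
  finally show ?thesis by simp
qed

text \<open>Up to an error of order \<open>r\<^sup>K\<close>, the truncated Poisson kernel of a contraction is positive: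
  the partial sums \<open>u\<^sub>K = (\<Sum>n<K. q\<^sup>n T\<^sup>n x)\<close> satisfy \<open>u\<^sub>K\<^sub>+\<^sub>1 - x = q T u\<^sub>K\<close>, so that
  \<open>\<parallel>u\<^sub>K\<^sub>+\<^sub>1 - x\<parallel> \<le> \<parallel>u\<^sub>K\<parallel>\<close>.\<close>

lemma poisson_partial_sum:
  fixes T :: "'v::complex_hilbert_space \<Rightarrow> 'v"
  assumes add: "\<And>x y. T (x + y) = T x + T y" and scaleC: "\<And>c x. T (c *\<^sub>C x) = c *\<^sub>C T x"
    and contr: "\<And>x. norm (T x) \<le> norm x" and q: "cmod q = r" "r < 1"
  shows "- (2 * r ^ K / (1 - r)) * (norm x)\<^sup>2
     \<le> 2 * Re (\<Sum>n\<le>K. q ^ n * cinner ((T ^^ n) x) x) - (norm x)\<^sup>2"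
proof -
  define u where "u k = (\<Sum>n<k. q ^ n *\<^sub>C (T ^^ n) x)" for k
  have r0: "0 \<le> r" using q by auto
  have zero: "T 0 = 0" using scaleC[of 0 0] by simp
  have Tu: "T (u k) = (\<Sum>n<k. q ^ n *\<^sub>C (T ^^ Suc n) x)" for k
    by (induction k) (simp_all add: u_def zero add scaleC)
  have uS: "u (Suc k) = x + q *\<^sub>C T (u k)" for k
    unfolding Tu by (simp add: u_def sum.lessThan_Suc_shift scaleC.sum_right scaleC_scaleC del: sum.lessThan_Suc)
  have pow: "norm ((T ^^ n) x) \<le> norm x" for n
    by (induction n) (auto intro: order_trans[OF contr])
  have diff: "norm (u (Suc K) - u K) \<le> r ^ K * norm x"
    using pow[of K] r0 by (simp add: u_def norm_scaleC norm_power q mult_left_mono)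
  have bound: "norm (u k) \<le> norm x / (1 - r)" for k
  proof -
    have "norm (u k) \<le> (\<Sum>n<k. r ^ n * norm x)"
      unfolding u_def by (rule sum_norm_le) (use pow r0 in \<open>simp add: norm_scaleC norm_power q mult_left_mono\<close>)
    also have "\<dots> = (\<Sum>n<k. r ^ n) * norm x" by (simp add: sum_distrib_right)
    also have "\<dots> \<le> (1 / (1 - r)) * norm x"
    proof (rule mult_right_mono)
      have "(\<Sum>n<k. r ^ n) \<le> (\<Sum>n. r ^ n)" using q r0 by (intro sum_le_suminf summable_geometric) auto
      then show "(\<Sum>n<k. r ^ n) \<le> 1 / (1 - r)" using q r0 by (simp add: suminf_geometric)
    qed simp
    finally show ?thesis by simp
  qed
  have "norm (u (Suc K) - x) \<le> norm (u K)"
    using contr[of "u K"] q r0 mult_le_one[of r] order_trans[OF mult_left_le_one_le[of "norm (T (u K))" r] contr[of "u K"]]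
    by (simp add: uS norm_scaleC)
  then have "(norm (u (Suc K) - x))\<^sup>2 \<le> (norm (u K))\<^sup>2" by (rule power_mono) simp
  \<comment> \<open>Expanding the square produces the Poisson sum; what remains is a difference of
    consecutive squared norms, which factors and is of order \<open>r ^ K\<close>.\<close>
  then have 1: "(norm (u (Suc K)))\<^sup>2 - (norm (u K))\<^sup>2 \<le> 2 * Re (cinner (u (Suc K)) x) - (norm x)\<^sup>2"
    by (simp add: norm_diff_sq)
  have "(norm (u K))\<^sup>2 - (norm (u (Suc K)))\<^sup>2 = (norm (u K) - norm (u (Suc K))) * (norm (u K) + norm (u (Suc K)))"
    by (simp add: power2_eq_square algebra_simps)
  also have "\<dots> \<le> (r ^ K * norm x) * (norm x / (1 - r) + norm x / (1 - r))"
  proof (rule mult_mono)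
    show "norm (u K) - norm (u (Suc K)) \<le> r ^ K * norm x"
      using diff norm_triangle_ineq2[of "u K" "u (Suc K)"] by (simp add: norm_minus_commute)
  qed (use bound[of K] bound[of "Suc K"] r0 in auto)
  also have "\<dots> = 2 * r ^ K / (1 - r) * (norm x)\<^sup>2" by (simp add: power2_eq_square)
  finally have "- (2 * r ^ K / (1 - r)) * (norm x)\<^sup>2 \<le> (norm (u (Suc K)))\<^sup>2 - (norm (u K))\<^sup>2"
    by simp
  moreover have "cinner (u (Suc K)) x = (\<Sum>n\<le>K. q ^ n * cinner ((T ^^ n) x) x)"
    unfolding u_def lessThan_Suc_atMost cinner.sum_left cinner_scaleC_left ..
  ultimately show ?thesis using 1 by simp
qed

text \<open>Everything is required on the unit square only, and continuity in the parameter is asked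
  of the powers at each vector, as the averages need it.\<close>

locale contraction_family =
  fixes M :: "real \<times> real \<Rightarrow> 'v::complex_hilbert_space \<Rightarrow> 'v"
  assumes M_add: "p \<in> unit_square \<Longrightarrow> M p (x + y) = M p x + M p y"
    and M_scaleC: "p \<in> unit_square \<Longrightarrow> M p (c *\<^sub>C x) = c *\<^sub>C M p x"
    and M_contr: "p \<in> unit_square \<Longrightarrow> norm (M p x) \<le> norm x"
    and M_cont: "continuous_on unit_square (\<lambda>p. (M p ^^ n) x)"
begin

lemma pow_add: "p \<in> unit_square \<Longrightarrow> (M p ^^ n) (x + y) = (M p ^^ n) x + (M p ^^ n) y"
  by (induction n) (simp_all add: M_add)

lemma pow_scaleC: "p \<in> unit_square \<Longrightarrow> (M p ^^ n) (c *\<^sub>C x) = c *\<^sub>C (M p ^^ n) x"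
  by (induction n) (simp_all add: M_scaleC)

lemma pow_contr: "p \<in> unit_square \<Longrightarrow> norm ((M p ^^ n) x) \<le> norm x"
  by (induction n) (auto intro: order_trans[OF M_contr])

definition mom :: "'v \<Rightarrow> 'v \<Rightarrow> nat \<Rightarrow> complex" where
  "mom X Y n = avg (\<lambda>p. cinner ((M p ^^ n) X) Y)"

lemma cont_moment: "continuous_on unit_square (\<lambda>p. cinner ((M p ^^ n) X) Y)"
  by (intro cinner.continuous_on M_cont continuous_on_const)

lemma avg_cong: "(\<And>p. p \<in> unit_square \<Longrightarrow> f p = g p) \<Longrightarrow> avg f = avg g"
  unfolding avg_def by (rule integral_cong) simp

lemma mom_add_left: "mom (X + X') Y n = mom X Y n + mom X' Y n"
  unfolding mom_def by (subst avg_add[OF cont_moment cont_moment, symmetric])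
    (rule avg_cong, simp add: pow_add cinner.add_left)

lemma mom_add_right: "mom X (Y + Y') n = mom X Y n + mom X Y' n"
  unfolding mom_def cinner.add_right by (rule avg_add[OF cont_moment cont_moment])

lemma mom_scaleC_left: "mom (c *\<^sub>C X) Y n = c * mom X Y n"
  unfolding mom_def by (subst avg_cmult[OF cont_moment, symmetric])
    (rule avg_cong, simp add: pow_scaleC cinner_scaleC_left)

lemma mom_scaleC_right: "mom X (c *\<^sub>C Y) n = cnj c * mom X Y n"
  unfolding mom_def cinner_scaleC_right by (rule avg_cmult[OF cont_moment])

lemma mom_0: "mom X Y 0 = cinner X Y / 2"
  by (simp add: mom_def avg_const scaleR_conv_of_real)

text \<open>The factor 1/2 is given away: the estimate serves only for limits in \<open>Y\<close>
  and for the vanishing of moments.\<close>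

lemma cmod_mom_le: "cmod (mom X Y n) \<le> norm X * norm Y"
proof -
  have "cmod (mom X Y n) \<le> integral unit_square (\<lambda>p. (1 - fst p) *\<^sub>R (norm X * norm Y))"
    unfolding mom_def avg_def
  proof (rule integral_norm_bound_integral[OF avg_integrable[OF cont_moment] avg_integrable[OF continuous_on_const]])
    fix p :: "real \<times> real" assume p: "p \<in> unit_square"
    then have "0 \<le> 1 - fst p" by (cases p) simp
    moreover have "cmod (cinner ((M p ^^ n) X) Y) \<le> norm X * norm Y"
      by (rule order_trans[OF cmod_cinner_le]) (use pow_contr[OF p] in \<open>simp add: mult_right_mono\<close>)
    ultimately show "norm ((1 - fst p) *\<^sub>R cinner ((M p ^^ n) X) Y) \<le> (1 - fst p) *\<^sub>R (norm X * norm Y)"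
      by (simp add: mult_left_mono)
  qed
  also have "\<dots> = avg (\<lambda>_. norm X * norm Y)" by (simp add: avg_def)
  also have "\<dots> \<le> norm X * norm Y" by (simp add: avg_const)
  finally show ?thesis .
qed

lemma mom_diff_right: "mom X (Y - Y') n = mom X Y n - mom X Y' n"
  using mom_add_right[of X "Y - Y'" Y' n] by simp

lemma mom_poisson:
  assumes "cmod q = r" "r < 1"
  shows "- (r ^ K / (1 - r)) * (norm X)\<^sup>2 \<le> 2 * Re (\<Sum>n\<le>K. q ^ n * mom X X n) - (norm X)\<^sup>2 / 2"
proof -
  let ?f = "\<lambda>p. \<Sum>n\<le>K. q ^ n * cinner ((M p ^^ n) X) X"
  have cont: "continuous_on unit_square ?f"
    by (intro continuous_intros cont_moment)
  have "avg (\<lambda>_. - (2 * r ^ K / (1 - r)) * (norm X)\<^sup>2) \<le> avg (\<lambda>p. 2 * Re (?f p) + - (norm X)\<^sup>2)"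
  proof (rule avg_mono)
    fix p assume p: "p \<in> unit_square"
    show "- (2 * r ^ K / (1 - r)) * (norm X)\<^sup>2 \<le> 2 * Re (?f p) + - (norm X)\<^sup>2"
      using poisson_partial_sum[OF M_add[OF p] M_scaleC[OF p] M_contr[OF p] assms, of K X] by simp
  qed (intro continuous_intros cont)+
  also have "\<dots> = avg (\<lambda>p. 2 * Re (?f p)) + avg (\<lambda>p. - (norm X)\<^sup>2)"
    by (rule avg_add) (intro continuous_intros cont)+
  also have "avg (\<lambda>p. 2 * Re (?f p)) = 2 * Re (avg ?f)"
    using avg_bounded_linear[OF bounded_linear_compose[OF bounded_linear_mult_right[of 2] bounded_linear_Re] cont] .
  also have "avg ?f = (\<Sum>n\<le>K. avg (\<lambda>p. q ^ n * cinner ((M p ^^ n) X) X))"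
    by (rule avg_sum) (intro continuous_intros cont_moment | simp)+
  also have "\<dots> = (\<Sum>n\<le>K. q ^ n * mom X X n)"
    unfolding mom_def by (intro sum.cong refl avg_cmult cont_moment)
  finally show ?thesis by (simp add: avg_const)
qed

text \<open>Only the coefficients at \<open>k \<le> 0\<close> enter the represented moments. Those
  at \<open>k > 0\<close>, averages of \<open>cinner X ((M p ^^ k) Y)\<close>, complete the kernel
  to a hermitian one that is positive up to an error of order \<open>r ^ K\<close>.\<close>

definition coef :: "real \<Rightarrow> 'v \<Rightarrow> 'v \<Rightarrow> int \<Rightarrow> complex" where
  "coef r X Y k = (if k \<le> 0 then of_real r ^ nat (- k) * mom X Y (nat (- k))
     else of_real r ^ nat k * cnj (mom Y X (nat k))) / (2 * pi)"

abbreviation kern :: "nat \<Rightarrow> real \<Rightarrow> 'v \<Rightarrow> 'v \<Rightarrow> complex \<Rightarrow> complex" where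
  "kern K r X Y \<equiv> trig {- int K..int K} (coef r X Y)"

text \<open>The conjugated sum brings in the index 0 a second time, hence the subtracted term; the
  two zeroth moments agree by hermitian symmetry.\<close>

lemma kern_eq:
  assumes "cmod z = 1"
  shows "kern K r X Y z = ((\<Sum>n\<le>K. (of_real r * cnj z) ^ n * mom X Y n)
     + cnj (\<Sum>n\<le>K. (of_real r * cnj z) ^ n * mom Y X n) - mom X Y 0) / (2 * pi)"
proof -
  have zi: "inverse z = cnj z" using assms
    by (metis complex_cnj_zero_iff complex_norm_square inverse_unique norm_one norm_zero of_real_1 one_power2 zero_neq_one)
  have split: "{- int K..int K} = (\<lambda>n. - int n) ` {..K} \<union> int ` {1..K}"
  proof (intro equalityI subsetI)
    fix k assume "k \<in> {- int K..int K}"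
    then show "k \<in> (\<lambda>n. - int n) ` {..K} \<union> int ` {1..K}"
      by (cases "k \<le> 0") (force intro: image_eqI[of _ _ "nat (- k)"] image_eqI[of _ _ "nat k"])+
  qed auto
  have neg: "(\<Sum>k\<in>(\<lambda>n. - int n) ` {..K}. coef r X Y k * z powi k)
      = (\<Sum>n\<le>K. (of_real r * cnj z) ^ n * mom X Y n) / (2 * pi)"
    by (subst sum.reindex) (auto simp: inj_on_def coef_def power_int_minus power_inverse[symmetric] zi power_mult_distrib
        sum_divide_distrib mult_ac intro!: sum.cong)
  have posi: "(\<Sum>k\<in>int ` {1..K}. coef r X Y k * z powi k)
      = (\<Sum>n\<in>{1..K}. cnj ((of_real r * cnj z) ^ n * mom Y X n)) / (2 * pi)"
    by (subst sum.reindex) (auto simp: inj_on_def coef_def power_mult_distrib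
        sum_divide_distrib mult_ac intro!: sum.cong)
  have "mom X Y 0 = cnj (mom Y X 0)"
    unfolding mom_0 using cinner_commute[of X Y] by simp
  then have tail: "cnj (\<Sum>n\<le>K. (of_real r * cnj z) ^ n * mom Y X n) - mom X Y 0
      = (\<Sum>n\<in>{1..K}. cnj ((of_real r * cnj z) ^ n * mom Y X n))"
    unfolding atMost_atLeast0 by (subst sum.atLeast_Suc_atMost) simp_all
  have "((\<Sum>n\<le>K. (of_real r * cnj z) ^ n * mom X Y n)
     + cnj (\<Sum>n\<le>K. (of_real r * cnj z) ^ n * mom Y X n) - mom X Y 0) / (2 * pi)
     = (\<Sum>n\<le>K. (of_real r * cnj z) ^ n * mom X Y n) / (2 * pi)
     + (\<Sum>n\<in>{1..K}. cnj ((of_real r * cnj z) ^ n * mom Y X n)) / (2 * pi)"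
    by (simp only: add_diff_eq[symmetric] tail add_divide_distrib)
  then show ?thesis
    unfolding trig_def split neg[symmetric] posi[symmetric]
    by (subst sum.union_disjoint) auto
qed

lemma kern_hermitian: "cmod z = 1 \<Longrightarrow> kern K r Y X z = cnj (kern K r X Y z)"
  using cinner_commute[of X Y] by (simp add: kern_eq mom_0)

lemma kern_add_left: "kern K r (X + X') Y z = kern K r X Y z + kern K r X' Y z"
  unfolding trig_def sum.distrib[symmetric]
  by (intro sum.cong refl) (simp add: coef_def mom_add_left mom_add_right distrib_left distrib_right add_divide_distrib)

lemma kern_scaleC_left: "kern K r (c *\<^sub>C X) Y z = c * kern K r X Y z"
  unfolding trig_def sum_distrib_left
  by (intro sum.cong refl) (simp add: coef_def mom_scaleC_left mom_scaleC_right)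

lemma kern_pos:
  assumes "cmod z = 1" "0 < r" "r < 1"
  shows "- (r ^ K / (1 - r)) * (norm X)\<^sup>2 / (2 * pi) \<le> Re (kern K r X X z)"
proof -
  let ?S = "\<Sum>n\<le>K. (of_real r * cnj z) ^ n * mom X X n"
  have "kern K r X X z = complex_of_real ((2 * Re ?S - (norm X)\<^sup>2 / 2) / (2 * pi))"
    unfolding kern_eq[OF assms(1)] complex_add_cnj mom_0 cinner_self by simp
  then have Re: "Re (kern K r X X z) = (2 * Re ?S - (norm X)\<^sup>2 / 2) / (2 * pi)"
    by (simp only: Re_complex_of_real)
  have "- (r ^ K / (1 - r)) * (norm X)\<^sup>2 \<le> 2 * Re ?S - (norm X)\<^sup>2 / 2"
    by (rule mom_poisson) (use assms in \<open>simp_all add: norm_mult\<close>)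
  then show ?thesis unfolding Re by (rule divide_right_mono) simp
qed

text \<open>Cauchy-Schwarz for an almost positive hermitian kernel: positivity at \<open>Z\<close>,
  with \<open>w\<close> rotating \<open>?k X Y\<close> to minus its modulus, bounds the modulus by
  the diagonal. The arithmetic mean is kept because its integral is known from the zeroth
  moments.\<close>

lemma kern_le:
  assumes z: "cmod z = 1" and r: "0 < r" "r < 1"
  shows "cmod (kern K r X Y z) \<le> (Re (kern K r X X z) + Re (kern K r Y Y z)) / 2
     + (r ^ K / (1 - r)) * (norm X + norm Y)\<^sup>2"
proof -
  let ?k = "\<lambda>X Y. kern K r X Y z"
  define w where "w = (if ?k X Y = 0 then 1 else - (cmod (?k X Y) / ?k X Y))"
  have w: "cmod w = 1" "w * ?k X Y = - of_real (cmod (?k X Y))"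
    by (auto simp: w_def norm_divide)
  define Z where "Z = w *\<^sub>C X + Y"
  have right: "?k A (w *\<^sub>C B + C) = cnj w * ?k A B + ?k A C" for A B C
    unfolding kern_hermitian[OF z, of _ _ _ A, symmetric]
    by (metis complex_cnj_add complex_cnj_mult kern_add_left kern_hermitian[OF z] kern_scaleC_left)
  have "?k Z Z = w * (cnj w * ?k X X + ?k X Y) + (cnj w * ?k Y X + ?k Y Y)"
    unfolding Z_def right kern_add_left kern_scaleC_left ..
  also have "\<dots> = (w * cnj w) * ?k X X + w * ?k X Y + cnj (w * ?k X Y) + ?k Y Y"
    unfolding kern_hermitian[OF z, of _ _ Y X] by (simp add: algebra_simps)
  also have "w * cnj w = 1" using w(1) by (simp flip: complex_norm_square)
  finally have "Re (?k Z Z) = Re (?k X X) - 2 * cmod (?k X Y) + Re (?k Y Y)"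
    unfolding w(2) by simp
  moreover have "- ((r ^ K / (1 - r)) * (norm Z)\<^sup>2 / (2 * pi)) \<le> Re (?k Z Z)"
    using kern_pos[OF z r, of K Z] by simp
  moreover have "(r ^ K / (1 - r)) * (norm Z)\<^sup>2 / (2 * pi) \<le> (r ^ K / (1 - r)) * (norm X + norm Y)\<^sup>2"
  proof -
    have "norm Z \<le> norm X + norm Y"
      unfolding Z_def by (rule order_trans[OF norm_triangle_ineq]) (simp add: norm_scaleC w)
    then have "(norm Z)\<^sup>2 \<le> (norm X + norm Y)\<^sup>2" by (rule power_mono) simp
    moreover have "(norm Z)\<^sup>2 / (2 * pi) \<le> (norm Z)\<^sup>2"
      using pi_gt3 by (simp add: divide_le_eq mult_le_cancel_left1)
    ultimately have "(norm Z)\<^sup>2 / (2 * pi) \<le> (norm X + norm Y)\<^sup>2" by linarith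
    then have "(r ^ K / (1 - r)) * ((norm Z)\<^sup>2 / (2 * pi)) \<le> (r ^ K / (1 - r)) * (norm X + norm Y)\<^sup>2"
      using r by (intro mult_left_mono) simp_all
    then show ?thesis by simp
  qed
  moreover have "0 \<le> (r ^ K / (1 - r)) * (norm X + norm Y)\<^sup>2" using r by simp
  ultimately show ?thesis by argo
qed

text \<open>Integrating \<open>kern_le\<close> loses nothing on the diagonal: there the integral of
  the kernel is the zeroth moment \<open>(norm X)\<^sup>2 / 2\<close>.\<close>

lemma mom_abel_aux:
  assumes r: "0 < r" "r < 1"
  shows "circle_rep (\<lambda>n. if n < Suc K then of_real r ^ n * mom X Y n else 0)
     (((norm X)\<^sup>2 + (norm Y)\<^sup>2) / 4 + 2 * pi * (norm X + norm Y)\<^sup>2 / (1 - r) * r ^ K)"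
proof (rule circle_rep_continuous[OF continuous_on_trig])
  fix n
  show "integral {0..2*pi} (\<lambda>t. cis t ^ n * kern K r X Y (cis t)) = (if n < Suc K then of_real r ^ n * mom X Y n else 0)"
    by (subst integral_trig) (auto simp: coef_def)
next
  let ?k = "\<lambda>X Y t. kern K r X Y (cis t)"
  let ?e = "(r ^ K / (1 - r)) * (norm X + norm Y)\<^sup>2"
  have cont: "continuous_on {0..2*pi} (?k X Y)" for X Y by (rule continuous_on_trig)
  have I: "integral {0..2*pi} (?k X X) = complex_of_real ((norm X)\<^sup>2 / 2)" for X
    using integral_trig[of "{- int K..int K}" 0 "coef r X X"] by (simp add: coef_def mom_0 cinner_self)
  have "((\<lambda>t. ?k X X t) has_integral complex_of_real ((norm X)\<^sup>2 / 2)) {0..2*pi}" for X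
    unfolding I[symmetric] by (rule integrable_integral[OF integrable_continuous_interval[OF cont]])
  from has_integral_Re[OF this]
  have Re: "((\<lambda>t. Re (?k X X t)) has_integral (norm X)\<^sup>2 / 2) {0..2*pi}" for X by simp
  have const: "((\<lambda>t. ?e) has_integral (2*pi - 0) *\<^sub>R ?e) {0..2*pi}"
    using has_integral_const_real[of ?e 0 "2*pi"] by simp
  have "((\<lambda>t. (Re (?k X X t) + Re (?k Y Y t)) * (1/2) + ?e) has_integral
      ((norm X)\<^sup>2 / 2 + (norm Y)\<^sup>2 / 2) * (1/2) + (2*pi - 0) *\<^sub>R ?e) {0..2*pi}"
    by (intro has_integral_add has_integral_mult_left Re const)
  moreover have "cmod (?k X Y t) \<le> (Re (?k X X t) + Re (?k Y Y t)) * (1/2) + ?e" for t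
    using kern_le[of "cis t" r K X Y] r by simp
  ultimately have "integral {0..2*pi} (\<lambda>t. cmod (?k X Y t)) \<le> ((norm X)\<^sup>2 / 2 + (norm Y)\<^sup>2 / 2) * (1/2) + (2*pi - 0) *\<^sub>R ?e"
    by (intro has_integral_le[OF integrable_integral[OF integrable_continuous_interval]])
      (auto intro!: continuous_intros cont)
  then show "integral {0..2*pi} (\<lambda>t. cmod (?k X Y t))
      \<le> ((norm X)\<^sup>2 + (norm Y)\<^sup>2) / 4 + 2 * pi * (norm X + norm Y)\<^sup>2 / (1 - r) * r ^ K"
    by (simp add: field_simps)
qed

text \<open>Rescaling \<open>X\<close> and \<open>Y\<close> to equal norms turns the arithmetic mean into the geometric one.\<close>

lemma mom_abel:
  "\<exists>C. \<forall>r K. 0 < r \<longrightarrow> r < 1 \<longrightarrow>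
     circle_rep (\<lambda>n. if n < K then of_real r ^ n * mom X Y n else 0) (norm X * norm Y / 2 + C r * r ^ K)"
proof (cases "X = 0 \<or> Y = 0")
  case True
  then have "mom X Y n = 0" for n using cmod_mom_le[of X Y n] by auto
  then show ?thesis using True
    by (intro exI[of _ "\<lambda>_. 0"] allI impI circle_rep_cong[OF circle_rep_zero[of 0]]) auto
next
  case False
  define a where "a = sqrt (norm Y / norm X)"
  have a: "0 < a" using False by (simp add: a_def)
  define X' Y' where "X' = complex_of_real a *\<^sub>C X" and "Y' = complex_of_real (1/a) *\<^sub>C Y"
  have mom: "mom X' Y' n = mom X Y n" for n
    unfolding X'_def Y'_def mom_scaleC_left mom_scaleC_right using a by simp
  have a2: "a\<^sup>2 = norm Y / norm X" using False by (simp add: a_def)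
  have nX: "(norm X')\<^sup>2 = norm X * norm Y"
  proof -
    have "(norm X')\<^sup>2 = a\<^sup>2 * (norm X)\<^sup>2"
      by (simp add: X'_def power_mult_distrib)
    then show ?thesis unfolding a2 using False by (simp add: power2_eq_square)
  qed
  have nY: "(norm Y')\<^sup>2 = norm X * norm Y"
  proof -
    have "(norm Y')\<^sup>2 = (norm Y)\<^sup>2 / a\<^sup>2"
      by (simp add: Y'_def norm_scaleC norm_divide power_mult_distrib power_divide)
    then show ?thesis unfolding a2 using False by (simp add: power2_eq_square)
  qed
  \<comment> \<open>The kernel of order \<open>k\<close> has an error of order \<open>r ^ k\<close>
    and represents the moments below \<open>Suc k\<close>; dividing by \<open>r\<close> adjusts the
    exponent.\<close>
  define C where "C r = (2 * pi * (norm X' + norm Y')\<^sup>2 / (1 - r)) / r" for r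
  have "circle_rep (\<lambda>n. if n < K then of_real r ^ n * mom X Y n else 0) (norm X * norm Y / 2 + C r * r ^ K)"
    if r: "0 < r" "r < 1" for r K
  proof (cases K)
    case 0
    have "0 \<le> C r" using r by (simp add: C_def)
    then show ?thesis using 0 by (simp add: circle_rep_zero)
  next
    case (Suc k)
    show ?thesis
      unfolding Suc by (rule circle_rep_cong[OF mom_abel_aux[OF r, of k X' Y']])
        (use r in \<open>simp_all add: mom nX nY C_def\<close>)
  qed
  then show ?thesis by blast
qed

text \<open>Minkowski's inequality: the square norm of an averaged sequence is at most the average
  of the square norms, as pairing the sequence with itself shows. Passing to the norm is essential,
  since \<open>1 / (s * t)\<close> is not integrable over the square while its root is, with
  integral 4.\<close>

lemma mom_l2:
  assumes "0 \<le> C"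
    and le: "\<And>s t. 0 < s \<Longrightarrow> s \<le> 1 \<Longrightarrow> 0 < t \<Longrightarrow> t \<le> 1 \<Longrightarrow>
      (1 - s)\<^sup>2 * (\<Sum>n<K. (cmod (cinner ((M (s, t) ^^ n) X) Y))\<^sup>2) \<le> C\<^sup>2 / (s * t)"
  shows "(\<Sum>n<K. (cmod (mom X Y n))\<^sup>2) \<le> (4 * C)\<^sup>2"
proof -
  let ?f = "\<lambda>n p. cinner ((M p ^^ n) X) Y"
  define S where "S = sqrt (\<Sum>n<K. (cmod (mom X Y n))\<^sup>2)"
  have S: "S\<^sup>2 = (\<Sum>n<K. (cmod (mom X Y n))\<^sup>2)" "0 \<le> S" by (simp_all add: S_def sum_nonneg)
  let ?h = "\<lambda>p. sqrt (\<Sum>n<K. (cmod (?f n p))\<^sup>2)"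
  have cont_h: "continuous_on unit_square ?h" by (intro continuous_intros cont_moment)
  have cont_s: "continuous_on unit_square (\<lambda>p. \<Sum>n<K. cnj (mom X Y n) * ?f n p)"
    by (intro continuous_intros cont_moment)
  have "complex_of_real (S\<^sup>2) = (\<Sum>n<K. cnj (mom X Y n) * mom X Y n)"
    unfolding S by (simp add: mult.commute[of "cnj _"] flip: complex_norm_square)
  also have "\<dots> = (\<Sum>n<K. avg (\<lambda>p. cnj (mom X Y n) * ?f n p))"
    by (intro sum.cong refl) (simp add: avg_cmult[OF cont_moment] mom_def)
  also have "\<dots> = avg (\<lambda>p. \<Sum>n<K. cnj (mom X Y n) * ?f n p)"
    by (rule avg_sum[symmetric]) (intro continuous_intros cont_moment | simp)+
  finally have "S\<^sup>2 = avg (\<lambda>p. Re (\<Sum>n<K. cnj (mom X Y n) * ?f n p))"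
    by (metis Re_complex_of_real avg_Re[OF cont_s])
  also have "\<dots> \<le> avg (\<lambda>p. S * ?h p)"
  proof (rule avg_mono)
    fix p
    have "Re (\<Sum>n<K. cnj (mom X Y n) * ?f n p) \<le> cmod (\<Sum>n<K. cnj (mom X Y n) * ?f n p)"
      by (rule complex_Re_le_cmod)
    also have "\<dots> \<le> (\<Sum>n<K. \<bar>cmod (mom X Y n)\<bar> * \<bar>cmod (?f n p)\<bar>)"
      by (rule sum_norm_le) (simp add: norm_mult)
    also have "\<dots> \<le> S * ?h p"
      by (rule sum_mult_le_L2) (simp_all add: S sum_nonneg)
    finally show "Re (\<Sum>n<K. cnj (mom X Y n) * ?f n p) \<le> S * ?h p" .
  qed (intro continuous_intros cont_moment)+
  also have "\<dots> = S * avg ?h"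
    by (rule avg_bounded_linear[OF bounded_linear_mult_right cont_h])
  also have "\<dots> \<le> S * (4 * C)"
    unfolding avg_def
  proof (rule mult_left_mono[OF integral_square_le_inverse_sqrt S(2)])
    show "continuous_on unit_square (\<lambda>p. (1 - fst p) *\<^sub>R ?h p)"
      by (intro continuous_intros cont_moment)
    fix s t :: real assume st: "0 < s" "s \<le> 1" "0 < t" "t \<le> 1"
    have "sqrt ((1 - s)\<^sup>2 * (\<Sum>n<K. (cmod (?f n (s, t)))\<^sup>2)) \<le> sqrt (C\<^sup>2 / (s * t))"
      using le[OF st] by (rule real_sqrt_le_mono)
    then show "(1 - fst (s, t)) *\<^sub>R ?h (s, t) \<le> C / (sqrt s * sqrt t)"
      using st \<open>0 \<le> C\<close> by (simp add: real_sqrt_mult real_sqrt_divide)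
  qed
  finally have "S\<^sup>2 \<le> (4 * C) * S" by (simp add: mult.commute)
  then have "S \<le> 4 * C" by (rule le_of_power2_le_mult) (use \<open>0 \<le> C\<close> in simp)
  then show ?thesis unfolding S(1)[symmetric] using S(2) by (rule power_mono)
qed

text \<open>\<open>C\<close> enters only qualitatively: square summability permits \<open>r\<close>
  to tend to 1, and the norm bound is that of the Abel means.\<close>

lemma mom_circle_rep:
  assumes "0 \<le> C" "0 < \<epsilon>"
    and le: "\<And>s t K. 0 < s \<Longrightarrow> s \<le> 1 \<Longrightarrow> 0 < t \<Longrightarrow> t \<le> 1 \<Longrightarrow>
      (1 - s)\<^sup>2 * (\<Sum>n<K. (cmod (cinner ((M (s, t) ^^ n) X) Y))\<^sup>2) \<le> C\<^sup>2 / (s * t)"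
  shows "circle_rep (mom X Y) (norm X * norm Y / 2 + \<epsilon>)"
proof -
  obtain D where D: "\<And>r K. 0 < r \<Longrightarrow> r < 1 \<Longrightarrow>
     circle_rep (\<lambda>n. if n < K then of_real r ^ n * mom X Y n else 0) (norm X * norm Y / 2 + D r * r ^ K)"
    using mom_abel[of X Y] by blast
  show ?thesis
    using assms(2) D by (intro circle_rep_abel[OF mom_l2[OF assms(1) le]]) simp_all
qed

end

section \<open>Interpolation between two contractions\<close>

text \<open>An identity rather than an inequality: the last term is the exact gain from strict
  convexity.\<close>

lemma norm_convex_sq:
  fixes A B :: "'a::complex_hilbert_space"
  shows "(norm ((1 - s) *\<^sub>R A + s *\<^sub>R B))\<^sup>2
    = (1 - s) * (norm A)\<^sup>2 + s * (norm B)\<^sup>2 - s * (1 - s) * (norm (B - A))\<^sup>2"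
proof -
  have 1: "(norm ((1 - s) *\<^sub>R A + s *\<^sub>R B))\<^sup>2
      = (1 - s)\<^sup>2 * (norm A)\<^sup>2 + 2 * ((1 - s) * (s * Re (cinner A B))) + s\<^sup>2 * (norm B)\<^sup>2"
    by (simp add: norm_add_sq cinner.scaleR_left cinner.scaleR_right power_mult_distrib)
  have 2: "(norm (B - A))\<^sup>2 = (norm B)\<^sup>2 - 2 * Re (cinner A B) + (norm A)\<^sup>2"
    by (simp add: norm_diff_sq Re_cinner_commute)
  show ?thesis unfolding 1 2 by (simp add: power2_eq_square algebra_simps)
qed

lemma norm_convex_sq_le:
  fixes A B :: "'a::complex_hilbert_space"
  assumes "0 \<le> t" "t \<le> 1"
  shows "(norm ((1 - t) *\<^sub>R A + t *\<^sub>R B))\<^sup>2 \<le> (1 - t) * (norm A)\<^sup>2 + t * (norm B)\<^sup>2"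
  unfolding norm_convex_sq using assms by simp

text \<open>Integrate the derivative of \<open>t ^ Suc k * (1 - t) ^ Suc m\<close>, which vanishes
  at both ends, and compare the ratio with that of the binomial coefficients.\<close>

lemma beta_integral_step:
  assumes "k < n"
  shows "integral {0..1::real} (\<lambda>t. real (n choose Suc k) * (t ^ Suc k * (1 - t) ^ (n - Suc k)))
    = integral {0..1} (\<lambda>t. real (n choose k) * (t ^ k * (1 - t) ^ (n - k)))"
proof -
  define m where "m = n - Suc k"
  have n: "n = Suc (k + m)" using assms by (simp add: m_def)
  let ?I = "\<lambda>i j. integral {0..1::real} (\<lambda>t. t ^ i * (1 - t) ^ j)"
  have int: "(\<lambda>t::real. t ^ i * (1 - t) ^ j) integrable_on {0..1}" for i j
    by (intro integrable_continuous_interval continuous_intros)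
  have "((\<lambda>t::real. real (Suc k) * (t ^ k * (1 - t) ^ Suc m) - real (Suc m) * (t ^ Suc k * (1 - t) ^ m))
      has_integral (1 ^ Suc k * (1 - 1) ^ Suc m - 0 ^ Suc k * (1 - 0) ^ Suc m)) {0..1}"
  proof (rule fundamental_theorem_of_calculus)
    fix t :: real
    have "((\<lambda>t. t ^ Suc k * (1 - t) ^ Suc m) has_real_derivative
        real (Suc k) * (t ^ k * (1 - t) ^ Suc m) - real (Suc m) * (t ^ Suc k * (1 - t) ^ m)) (at t within {0..1})"
      by (rule derivative_eq_intros refl)+ (simp add: algebra_simps)
    then show "((\<lambda>t. t ^ Suc k * (1 - t) ^ Suc m) has_vector_derivative
        real (Suc k) * (t ^ k * (1 - t) ^ Suc m) - real (Suc m) * (t ^ Suc k * (1 - t) ^ m)) (at t within {0..1})"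
      by (simp add: has_real_derivative_iff_has_vector_derivative)
  qed simp
  then have "integral {0..1::real} (\<lambda>t. real (Suc k) * (t ^ k * (1 - t) ^ Suc m) - real (Suc m) * (t ^ Suc k * (1 - t) ^ m)) = 0"
    by (simp add: integral_unique)
  moreover have "integral {0..1::real} (\<lambda>t. real (Suc k) * (t ^ k * (1 - t) ^ Suc m) - real (Suc m) * (t ^ Suc k * (1 - t) ^ m))
      = real (Suc k) * ?I k (Suc m) - real (Suc m) * ?I (Suc k) m"
    by (subst Henstock_Kurzweil_Integration.integral_diff)
      (auto intro!: integrable_continuous_interval continuous_intros simp del: power_Suc of_nat_Suc)
  ultimately have eq: "real (Suc k) * ?I k (Suc m) = real (Suc m) * ?I (Suc k) m" by simp
  have "Suc k * (n choose Suc k) = Suc m * (n choose k)"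
    using binomial_absorption[of k n] binomial_absorb_comp[of n k] n
    by (simp add: Suc_diff_le)
  then have ch: "real (Suc k) * real (n choose Suc k) = real (Suc m) * real (n choose k)"
    by (metis of_nat_mult)
  have "real (Suc k) * (real (n choose Suc k) * ?I (Suc k) m) = real (n choose k) * (real (Suc m) * ?I (Suc k) m)"
    unfolding mult.assoc[symmetric] ch by (simp only: mult_ac)
  also have "\<dots> = real (Suc k) * (real (n choose k) * ?I k (Suc m))"
    unfolding eq[symmetric] by (simp add: mult.left_commute)
  finally have "real (n choose Suc k) * ?I (Suc k) m = real (n choose k) * ?I k (Suc m)"
    by (simp del: of_nat_Suc)
  moreover have "n - k = Suc m" "n - Suc k = m" by (simp_all add: n)
  ultimately show ?thesis by simp
qed

text \<open>The preceding step makes the value independent of \<open>k\<close>, and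
  \<open>k = n\<close> is elementary. Averaging over \<open>t\<close> therefore gives all terms of
  \<open>M_power\<close> the same weight.\<close>

lemma beta_integral:
  assumes "k \<le> n"
  shows "integral {0..1::real} (\<lambda>t. real (n choose k) * (t ^ k * (1 - t) ^ (n - k))) = 1 / real (n + 1)"
  using assms
proof (induction rule: inc_induct)
  case base
  have "((\<lambda>t::real. t ^ n) has_integral (1 ^ Suc n / real (Suc n) - 0 ^ Suc n / real (Suc n))) {0..1}"
  proof (rule fundamental_theorem_of_calculus)
    fix t :: real
    have "((\<lambda>t. t ^ Suc n / real (Suc n)) has_real_derivative t ^ n) (at t within {0..1})"
      by (rule derivative_eq_intros refl)+ (simp_all del: of_nat_Suc)
    then show "((\<lambda>t. t ^ Suc n / real (Suc n)) has_vector_derivative t ^ n) (at t within {0..1})"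
      by (simp add: has_real_derivative_iff_has_vector_derivative)
  qed simp
  then show ?case by (simp add: integral_unique)
next
  case (step k)
  then show ?case using beta_integral_step[of k n] by simp
qed

locale contraction_pair =
  fixes N0 N :: "'h::complex_hilbert_space cop" and V :: "'h hs"
  assumes N0: "norm N0 \<le> 1" and N: "norm N \<le> 1" and V: "hs_op V = N - N0"
begin

definition Ns :: "real \<Rightarrow> 'h cop" where
  "Ns s = N0 + s *\<^sub>R hs_op V"

lemma Ns_convex: "Ns s = (1 - s) *\<^sub>R N0 + s *\<^sub>R N"
  by (simp add: Ns_def V algebra_simps)

lemma Ns_0: "Ns 0 = N0" and Ns_1: "Ns 1 = N"
  by (simp_all add: Ns_convex)

lemma norm_Ns:
  assumes "0 \<le> s" "s \<le> 1" shows "norm (Ns s) \<le> 1"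
proof -
  have "norm (Ns s) \<le> (1 - s) * norm N0 + s * norm N"
    unfolding Ns_convex using assms by (intro order_trans[OF norm_triangle_ineq]) simp
  also have "\<dots> \<le> (1 - s) * 1 + s * 1"
    using assms N0 N by (intro add_mono mult_left_mono) auto
  finally show ?thesis by simp
qed

definition M :: "real \<times> real \<Rightarrow> 'h hs \<Rightarrow> 'h hs" where
  "M p X = (1 - snd p) *\<^sub>R rmul X (Ns (fst p)) + snd p *\<^sub>R lmul (Ns (fst p)) X"

text \<open>The binomial theorem for the commuting left and right multiplications by
  \<open>Ns s\<close>.\<close>

lemma M_power:
  "(M (s, t) ^^ n) X = (\<Sum>k\<le>n. (real (n choose k) * (t ^ k * (1 - t) ^ (n - k))) *\<^sub>R rmul (lmul (Ns s ^ k) X) (Ns s ^ (n - k)))"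
proof (induction n)
  case (Suc n)
  let ?g = "\<lambda>k m. rmul (lmul (Ns s ^ k) X) (Ns s ^ m)"
  let ?c = "\<lambda>n k m. real (n choose k) * (t ^ k * (1 - t) ^ m)"
  have L: "lmul (Ns s) (?g k m) = ?g (Suc k) m" for k m
    by (simp add: lmul_rmul lmul_mult)
  have R: "rmul (?g k m) (Ns s) = ?g k (Suc m)" for k m
    by (simp add: power_Suc2 rmul_mult del: power_Suc)
  have split: "(\<Sum>k\<le>Suc n. ?c (Suc n) k (Suc n - k) *\<^sub>R ?g k (Suc n - k))
      = (\<Sum>k\<le>n. (t * ?c n k (n - k)) *\<^sub>R ?g (Suc k) (n - k)) + (\<Sum>k\<le>n. ((1 - t) * ?c n k (n - k)) *\<^sub>R ?g k (Suc (n - k)))"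
  proof -
    have "(\<Sum>k\<le>Suc n. ?c (Suc n) k (Suc n - k) *\<^sub>R ?g k (Suc n - k))
        = ?c (Suc n) 0 (Suc n) *\<^sub>R ?g 0 (Suc n) + (\<Sum>k\<le>n. ?c (Suc n) (Suc k) (n - k) *\<^sub>R ?g (Suc k) (n - k))"
      by (subst sum.atMost_Suc_shift) simp
    also have "(\<Sum>k\<le>n. ?c (Suc n) (Suc k) (n - k) *\<^sub>R ?g (Suc k) (n - k))
        = (\<Sum>k\<le>n. (t * ?c n k (n - k)) *\<^sub>R ?g (Suc k) (n - k))
        + (\<Sum>k\<le>n. (real (n choose Suc k) * (t ^ Suc k * (1 - t) ^ (n - k))) *\<^sub>R ?g (Suc k) (n - k))"
      unfolding sum.distrib[symmetric] by (intro sum.cong refl) (simp add: algebra_simps)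
    \<comment> \<open>The term \<open>k = n\<close> drops out because
      \<open>n choose Suc n = 0\<close>.\<close>
    also have "(\<Sum>k\<le>n. (real (n choose Suc k) * (t ^ Suc k * (1 - t) ^ (n - k))) *\<^sub>R ?g (Suc k) (n - k))
        = (\<Sum>k<n. (real (n choose Suc k) * (t ^ Suc k * (1 - t) ^ (n - k))) *\<^sub>R ?g (Suc k) (n - k))"
      by (simp add: lessThan_Suc_atMost[symmetric])
    also have "\<dots> = (\<Sum>k<n. ((1 - t) * ?c n (Suc k) (n - Suc k)) *\<^sub>R ?g (Suc k) (Suc (n - Suc k)))"
      by (intro sum.cong refl) (simp add: Suc_diff_Suc[symmetric] mult_ac)
    finally show ?thesis
      by (subst (2) sum.atMost_shift) (simp add: algebra_simps)
  qed
  show ?case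
    unfolding funpow.simps o_apply Suc.IH split
    by (simp add: M_def lmul.sum_right rmul.sum_left lmul.scaleR_right rmul.scaleR_left L R scaleR_sum_right
        del: power_Suc)
qed (simp add: M_def)

sublocale contraction_family M
proof
  fix p :: "real \<times> real" and x y :: "'h hs" and c :: complex and n :: nat
  show "M p (x + y) = M p x + M p y"
    by (simp add: M_def lmul.add_right rmul.add_left scaleR_add_right)
  show "M p (c *\<^sub>C x) = c *\<^sub>C M p x"
    by (simp add: M_def lmul_scaleC rmul_scaleC scaleC.scaleR_right scaleC_add_right)
  show "norm (M p x) \<le> norm x" if "p \<in> unit_square"
  proof -
    obtain s t where p: "p = (s, t)" and st: "0 \<le> s" "s \<le> 1" "0 \<le> t" "t \<le> 1"
      using \<open>p \<in> unit_square\<close> by (cases p) auto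
    have "(1 - t) * norm (rmul x (Ns s)) + t * norm (lmul (Ns s) x) \<le> (1 - t) * norm x + t * norm x"
      using st by (intro add_mono mult_left_mono norm_contraction_mul norm_Ns) auto
    moreover have "norm (M p x) \<le> (1 - t) * norm (rmul x (Ns s)) + t * norm (lmul (Ns s) x)"
      unfolding M_def p using st by (intro order_trans[OF norm_triangle_ineq]) simp
    ultimately show ?thesis by (simp add: algebra_simps)
  qed
  show "continuous_on unit_square (\<lambda>p. (M p ^^ n) x)"
  proof (induction n)
    case (Suc n)
    then show ?case
      unfolding funpow.simps o_apply M_def[of _ "_ _"] Ns_def
      by (intro continuous_intros lmul.continuous_on rmul.continuous_on)
  qed simp
qed

text \<open>Strict convexity of the Hilbert space norm: \<open>N\<^sub>s\<close> strictly decreases the norm of every vector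
  on which \<open>V\<close> does not vanish.\<close>

lemma M_defect:
  assumes "0 \<le> s" "s \<le> 1" "0 \<le> t" "t \<le> 1"
  shows "t * s * (1 - s) * (norm (lmul (hs_op V) X))\<^sup>2 \<le> (norm X)\<^sup>2 - (norm (M (s, t) X))\<^sup>2"
proof -
  have le: "(norm (lmul A X))\<^sup>2 \<le> (norm X)\<^sup>2" "(norm (rmul X A))\<^sup>2 \<le> (norm X)\<^sup>2" if "norm A \<le> 1" for A
    using norm_contraction_mul[OF that] by (auto intro!: power_mono)
  have "lmul (Ns s) X = (1 - s) *\<^sub>R lmul N0 X + s *\<^sub>R lmul N X"
    unfolding Ns_convex by (simp add: lmul.add_left lmul.scaleR_left)
  moreover have "lmul (hs_op V) X = lmul N X - lmul N0 X" by (simp add: V lmul.diff_left)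
  ultimately have "(norm (lmul (Ns s) X))\<^sup>2
      = (1 - s) * (norm (lmul N0 X))\<^sup>2 + s * (norm (lmul N X))\<^sup>2 - s * (1 - s) * (norm (lmul (hs_op V) X))\<^sup>2"
    by (simp only: norm_convex_sq)
  also have "\<dots> \<le> (1 - s) * (norm X)\<^sup>2 + s * (norm X)\<^sup>2 - s * (1 - s) * (norm (lmul (hs_op V) X))\<^sup>2"
    using assms le[OF N0] le[OF N] by (intro diff_mono add_mono mult_left_mono) auto
  finally have L: "(norm (lmul (Ns s) X))\<^sup>2 \<le> (norm X)\<^sup>2 - s * (1 - s) * (norm (lmul (hs_op V) X))\<^sup>2"
    by (simp add: algebra_simps)
  \<comment> \<open>The gain comes from left multiplication alone, hence the factor
    \<open>t\<close>; right multiplication is used merely as a contraction.\<close>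
  have "(norm (M (s, t) X))\<^sup>2 \<le> (1 - t) * (norm (rmul X (Ns s)))\<^sup>2 + t * (norm (lmul (Ns s) X))\<^sup>2"
    unfolding M_def fst_conv snd_conv by (rule norm_convex_sq_le[OF assms(3,4)])
  also have "\<dots> \<le> (1 - t) * (norm X)\<^sup>2 + t * ((norm X)\<^sup>2 - s * (1 - s) * (norm (lmul (hs_op V) X))\<^sup>2)"
    using assms L le[OF norm_Ns[OF assms(1,2)]] by (intro add_mono mult_left_mono) auto
  finally show ?thesis by (simp add: algebra_simps)
qed

text \<open>The defects along the orbit of \<open>X\<close> telescope to at most
  \<open>(norm X)\<^sup>2\<close>, and \<open>cinner_lmul_adj\<close> moves the factor
  \<open>V\<close> from the second argument onto the orbit, where the defect controls it.\<close>

lemma M_l2: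
  assumes st: "0 < s" "s \<le> 1" "0 < t" "t \<le> 1"
  shows "(1 - s)\<^sup>2 * (\<Sum>n<K. (cmod (cinner ((M (s, t) ^^ n) X) (lmul (hs_op (hs_adj V)) Z)))\<^sup>2)
    \<le> (norm X * norm Z)\<^sup>2 / (s * t)"
proof -
  let ?A = "\<Sum>n<K. (norm (lmul (hs_op V) ((M (s, t) ^^ n) X)))\<^sup>2"
  have A0: "0 \<le> ?A" by (simp add: sum_nonneg)
  have "t * s * (1 - s) * ?A \<le> (\<Sum>n<K. (norm ((M (s, t) ^^ n) X))\<^sup>2 - (norm ((M (s, t) ^^ Suc n) X))\<^sup>2)"
    unfolding sum_distrib_left using st by (intro sum_mono) (simp add: M_defect)
  also have "\<dots> = (norm X)\<^sup>2 - (norm ((M (s, t) ^^ K) X))\<^sup>2"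
    by (induction K) simp_all
  also have "\<dots> \<le> (norm X)\<^sup>2" by simp
  finally have "t * s * (1 - s) * ?A \<le> (norm X)\<^sup>2" .
  \<comment> \<open>One of the two factors \<open>1 - s\<close> cancels the degeneracy of the defect
    at \<open>s = 1\<close>, the other is bounded by 1; only \<open>1 / (s * t)\<close>
    remains.\<close>
  then have "(1 - s) * (t * s * (1 - s) * ?A) \<le> (1 - s) * (norm X)\<^sup>2"
    using st by (intro mult_left_mono) auto
  also have "\<dots> \<le> (norm X)\<^sup>2" using st by (intro mult_left_le_one_le) auto
  finally have A: "(1 - s)\<^sup>2 * ?A \<le> (norm X)\<^sup>2 / (s * t)"
    using st by (simp add: field_simps power2_eq_square)
  have "(\<Sum>n<K. (cmod (cinner ((M (s, t) ^^ n) X) (lmul (hs_op (hs_adj V)) Z)))\<^sup>2)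
      \<le> (\<Sum>n<K. (norm (lmul (hs_op V) ((M (s, t) ^^ n) X)))\<^sup>2 * (norm Z)\<^sup>2)"
    unfolding hs_adj.rep_eq cinner_lmul_adj power_mult_distrib[symmetric]
    by (intro sum_mono power_mono cmod_cinner_le) simp
  also have "\<dots> = ?A * (norm Z)\<^sup>2" by (simp add: sum_distrib_right)
  finally have "(1 - s)\<^sup>2 * (\<Sum>n<K. (cmod (cinner ((M (s, t) ^^ n) X) (lmul (hs_op (hs_adj V)) Z)))\<^sup>2)
      \<le> (1 - s)\<^sup>2 * (?A * (norm Z)\<^sup>2)" by (rule mult_left_mono) simp
  also have "\<dots> \<le> (norm X)\<^sup>2 / (s * t) * (norm Z)\<^sup>2"
    unfolding mult.assoc[symmetric] by (rule mult_right_mono[OF A]) simp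
  finally show ?thesis by (simp add: power_mult_distrib)
qed

lemma circle_rep_mom_mult:
  "0 < \<epsilon> \<Longrightarrow> circle_rep (mom V (lmul (hs_op (hs_adj V)) Z)) (norm V * norm (lmul (hs_op (hs_adj V)) Z) / 2 + \<epsilon>)"
  by (rule mom_circle_rep[OF _ _ M_l2]) simp_all

lemma circle_rep_mom:
  assumes "0 < \<epsilon>" shows "circle_rep (mom V (hs_adj V)) ((norm V)\<^sup>2 / 2 + \<epsilon>)"
proof -
  let ?W = "hs_adj V"
  \<comment> \<open>The losses below amount to \<open>3/2 (norm V + 1) \<delta>\<close>, while this
    choice makes \<open>2 (norm V + 1) \<delta>\<close> equal to \<open>\<epsilon>\<close>.\<close>
  define \<delta> where "\<delta> = \<epsilon> / (2 * (norm V + 1))"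
  have V1: "0 < norm V + 1" by (simp add: add_nonneg_pos)
  have \<delta>: "0 < \<delta>" "2 * ((norm V + 1) * \<delta>) = \<epsilon>"
    using assms V1 nonzero_mult_div_cancel_left[of "2 * (norm V + 1)" \<epsilon>] by (simp_all add: \<delta>_def mult.assoc del: distrib_left_numeral)
  have "\<exists>Z. norm (?W - lmul (hs_op ?W) Z) < \<delta> / 2 ^ Suc j" for j
    by (rule hs_right_approx) (use \<delta> in simp)
  then obtain Z where Z: "\<And>j. norm (?W - lmul (hs_op ?W) (Z j)) < \<delta> / 2 ^ Suc j" by metis
  define Y where "Y j = lmul (hs_op ?W) (Z j)" for j
  have Y: "norm (?W - Y j) \<le> \<delta> / 2 ^ Suc j" for j using Z[of j] by (simp add: Y_def)
  have "circle_rep (mom V ?W) (norm V * (norm V + \<delta>) / 2 + \<delta> / 2 + (norm V + 1) * \<delta>)"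
  proof (rule circle_rep_limit[of "\<lambda>j. mom V (Y j)"])
    have "norm (Y 0) \<le> norm V + \<delta>"
      using Y[of 0] norm_triangle_ineq4[of ?W "?W - Y 0"] \<delta> by simp
    then have "norm V * norm (Y 0) / 2 \<le> norm V * (norm V + \<delta>) / 2"
      by (intro divide_right_mono mult_left_mono) auto
    then show "circle_rep (mom V (Y 0)) (norm V * (norm V + \<delta>) / 2 + \<delta> / 2)"
      using \<delta> by - (rule circle_rep_cong[OF circle_rep_mom_mult[of "\<delta> / 2" "Z 0", folded Y_def]], simp_all)
    show "circle_rep (\<lambda>n. mom V (Y (Suc j)) n - mom V (Y j) n) ((norm V + 1) * \<delta> / 2 ^ Suc j)" for j
    proof -
      \<comment> \<open>Increments have the same form as the approximants, so the same
        representation applies to them, with a tolerance that shrinks geometrically.\<close>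
      have Yd: "Y (Suc j) - Y j = lmul (hs_op ?W) (Z (Suc j) - Z j)" by (simp add: Y_def lmul.diff_right)
      have "norm (Y (Suc j) - Y j) \<le> norm (?W - Y j) + norm (?W - Y (Suc j))"
        using norm_triangle_ineq4[of "?W - Y j" "?W - Y (Suc j)"] by simp
      also have "\<dots> \<le> \<delta> / 2 ^ Suc j + \<delta> / 2 ^ Suc (Suc j)" using Y[of j] Y[of "Suc j"] by linarith
      also have "\<dots> \<le> 2 * (\<delta> / 2 ^ Suc j)" using \<delta> by (simp add: field_simps)
      finally have "norm V * norm (Y (Suc j) - Y j) \<le> norm V * (2 * (\<delta> / 2 ^ Suc j))"
        by (rule mult_left_mono) simp
      moreover have rep: "circle_rep (mom V (Y (Suc j) - Y j)) (norm V * norm (Y (Suc j) - Y j) / 2 + \<delta> / 2 ^ Suc j)"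
        unfolding Yd by (rule circle_rep_mom_mult) (use \<delta> in simp)
      ultimately show ?thesis
        by - (rule circle_rep_cong[OF rep], simp_all add: mom_diff_right add_divide_distrib distrib_right)
    qed
    show "(\<lambda>j. mom V (Y j) n) \<longlonglongrightarrow> mom V ?W n" for n
    proof (rule Lim_null_comparison[THEN LIM_zero_cancel])
      have "cmod (mom V (Y j) n - mom V ?W n) \<le> norm V * (\<delta> / 2 ^ Suc j)" for j
      proof -
        have "cmod (mom V (Y j - ?W) n) \<le> norm V * norm (Y j - ?W)" by (rule cmod_mom_le)
        also have "\<dots> \<le> norm V * (\<delta> / 2 ^ Suc j)"
          using Y[of j] by (intro mult_left_mono) (simp_all add: norm_minus_commute)
        finally show ?thesis by (simp add: mom_diff_right)
      qed
      then show "\<forall>\<^sub>F j in sequentially. norm (mom V (Y j) n - mom V ?W n) \<le> norm V * (\<delta> / 2 ^ Suc j)"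
        by (intro always_eventually allI)
      have "(\<lambda>j. norm V * \<delta> * (1/2) ^ Suc j) \<longlonglongrightarrow> norm V * \<delta> * 0"
        by (intro tendsto_intros LIMSEQ_Suc LIMSEQ_realpow_zero) simp_all
      moreover have "norm V * (\<delta> / 2 ^ Suc j) = norm V * \<delta> * (1/2) ^ Suc j" for j
        by (simp add: power_one_over)
      ultimately show "(\<lambda>j. norm V * (\<delta> / 2 ^ Suc j)) \<longlonglongrightarrow> 0" by (simp only: mult_zero_right)
    qed
  qed
  then show ?thesis
  proof (rule circle_rep_cong)
    have "0 \<le> norm V * \<delta>" using \<delta> by simp
    moreover have "norm V * (norm V + \<delta>) / 2 + \<delta> / 2 + (norm V + 1) * \<delta>
        = norm V * norm V / 2 + 3/2 * (norm V * \<delta>) + 3/2 * \<delta>"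
      by (simp add: field_simps)
    moreover have "(norm V)\<^sup>2 / 2 + \<epsilon> = norm V * norm V / 2 + 2 * (norm V * \<delta>) + 2 * \<delta>"
      unfolding \<delta>(2)[symmetric] by (simp add: power2_eq_square field_simps)
    ultimately show "norm V * (norm V + \<delta>) / 2 + \<delta> / 2 + (norm V + 1) * \<delta> \<le> (norm V)\<^sup>2 / 2 + \<epsilon>"
      using \<delta>(1) by linarith
  qed simp
qed

text \<open>The trace of \<open>Ns s ^ k * hs_op V * Ns s ^ m * hs_op V\<close>.\<close>

definition tau :: "real \<Rightarrow> nat \<Rightarrow> nat \<Rightarrow> complex" where
  "tau s k m = tr (lmul (Ns s ^ k) V) (lmul (Ns s ^ m) V)"

lemma tau_commute: "tau s k m = tau s m k"
  unfolding tau_def by (rule tr_commute)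

text \<open>\<open>M_power\<close> expands the matrix coefficient, \<open>tr_rmul\<close> moves the
  right factor under the trace to form \<open>tau\<close>, and \<open>beta_integral\<close> weights
  every term with \<open>1 / (n + 1)\<close>.\<close>

lemma mom_eq_integral:
  "of_nat (n + 1) * mom V (hs_adj V) n = integral {0..1} (\<lambda>s. (1 - s) *\<^sub>R (\<Sum>k\<le>n. tau s k (n - k)))"
proof -
  have tau: "cinner ((M (s, t) ^^ n) V) (hs_adj V)
      = (\<Sum>k\<le>n. (real (n choose k) * (t ^ k * (1 - t) ^ (n - k))) *\<^sub>R tau s k (n - k))" for s t
    unfolding M_power cinner.sum_left cinner.scaleR_left tau_def tr_rmul[symmetric] unfolding tr_def ..
  have inner: "integral {0..1} (\<lambda>t. (1 - s) *\<^sub>R cinner ((M (s, t) ^^ n) V) (hs_adj V))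
      = (1 / real (n + 1)) *\<^sub>R ((1 - s) *\<^sub>R (\<Sum>k\<le>n. tau s k (n - k)))" for s
  proof -
    have "((\<lambda>t. \<Sum>k\<le>n. (real (n choose k) * (t ^ k * (1 - t) ^ (n - k))) *\<^sub>R tau s k (n - k)) has_integral
        (\<Sum>k\<le>n. (1 / real (n + 1)) *\<^sub>R tau s k (n - k))) {0..1}"
    proof (rule has_integral_sum)
      fix k assume "k \<in> {..n}"
      have "((\<lambda>t. real (n choose k) * (t ^ k * (1 - t) ^ (n - k))) has_integral 1 / real (n + 1)) {0..1}"
        using beta_integral[of k n] \<open>k \<in> {..n}\<close>
        by (auto simp: has_integral_iff intro!: integrable_continuous_interval continuous_intros)
      then show "((\<lambda>t. (real (n choose k) * (t ^ k * (1 - t) ^ (n - k))) *\<^sub>R tau s k (n - k)) has_integral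
          (1 / real (n + 1)) *\<^sub>R tau s k (n - k)) {0..1}"
        using has_integral_linear[OF _ bounded_linear_scaleR_left] by (simp add: o_def)
    qed simp
    from has_integral_cmul[OF this, of "1 - s"]
    show ?thesis unfolding tau by (simp add: integral_unique scaleR_sum_right mult.commute)
  qed
  have "mom V (hs_adj V) n = integral {0..1} (\<lambda>s. integral {0..1} (\<lambda>t. (1 - s) *\<^sub>R cinner ((M (s, t) ^^ n) V) (hs_adj V)))"
    unfolding mom_def avg_def
    by (subst integral_prod_continuous) (auto intro!: continuous_intros cont_moment)
  also have "\<dots> = (1 / real (n + 1)) *\<^sub>R integral {0..1} (\<lambda>s. (1 - s) *\<^sub>R (\<Sum>k\<le>n. tau s k (n - k)))"
    unfolding inner by (rule integral_cmul)
  finally have "mom V (hs_adj V) n = \<dots>" .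
  moreover have "complex_of_nat (n + 1) \<noteq> 0" by (simp only: of_nat_eq_0_iff)
  ultimately show ?thesis by (simp add: scaleR_conv_of_real)
qed

end

section \<open>The trace of the Taylor remainder of a power\<close>

lemma hs_adj_add: "hs_adj (X + Y) = hs_adj X + hs_adj Y"
  by (rule hs_eqI) (simp add: hs_adj.rep_eq plus_hs.rep_eq adj_add)

lemma tr_add_right: "tr X (Y + Z) = tr X Y + tr X Z"
  by (simp add: tr_def hs_adj_add cinner.add_right)

lemma tr_sum_right: "tr X (\<Sum>i\<in>I. f i) = (\<Sum>i\<in>I. tr X (f i))"
proof (induction I rule: infinite_finite_induct)
  case empty
  then show ?case using tr_add_right[of X 0 0] by simp
next
  case (infinite I)
  then show ?case using tr_add_right[of X 0 0] by simp
qed (simp add: tr_add_right)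

lemma hs_op_sum: "hs_op (\<Sum>i\<in>I. f i) = (\<Sum>i\<in>I. hs_op (f i))"
  by (induction I rule: infinite_finite_induct) (simp_all add: zero_hs.rep_eq plus_hs.rep_eq)

lemma has_sum_finite_sum:
  fixes f :: "'i \<Rightarrow> 'b \<Rightarrow> 'c::topological_comm_monoid_add"
  shows "(\<And>i. i \<in> I \<Longrightarrow> (f i has_sum s i) A) \<Longrightarrow> ((\<lambda>x. \<Sum>i\<in>I. f i x) has_sum (\<Sum>i\<in>I. s i)) A"
  by (induction I rule: infinite_finite_induct) (simp_all add: has_sum_add)

lemma power_diff_telescope:
  fixes A B :: "'a::complex_hilbert_space cop"
  shows "A ^ n - B ^ n = (\<Sum>j<n. A ^ j * (A - B) * B ^ (n - Suc j))"
proof (induction n)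
  case (Suc n)
  have "(\<Sum>j<Suc n. A ^ j * (A - B) * B ^ (Suc n - Suc j))
      = (\<Sum>j<n. A ^ j * (A - B) * B ^ (n - Suc j)) * B + A ^ n * (A - B)"
    by (simp add: sum_distrib_right mult.assoc Suc_diff_Suc[symmetric] power_Suc2 del: power_Suc)
  also have "\<dots> = A ^ Suc n - B ^ Suc n"
    unfolding Suc.IH[symmetric] power_Suc2 by (simp add: algebra_simps)
  finally show ?case ..
qed simp

lemma nuclear_summable:
  assumes "nuclear_bound T B"
  shows "(\<lambda>e. cmod (cinner (T \<cdot> e) e)) summable_on some_onb"
proof (rule finite_sums_bounded_summable)
  fix F assume "finite F" "F \<subseteq> (some_onb :: 'a set)"
  then show "(\<Sum>e\<in>F. cmod (cinner (T \<cdot> e) e)) \<le> B"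
    using assms norm_cop_one_le unfolding nuclear_bound_def by (metis mult_1)
qed simp

lemma nuclear_bound_partial:
  assumes "nuclear_bound T B" "finite F" "F \<subseteq> some_onb"
  shows "cmod (\<Sum>e\<in>F. cinner (T \<cdot> e) e) \<le> B"
proof -
  have "(\<Sum>e\<in>F. cmod (cinner (T \<cdot> e) e)) \<le> B"
    using assms norm_cop_one_le unfolding nuclear_bound_def by (metis mult_1)
  then show ?thesis by (rule order_trans[OF norm_sum])
qed

text \<open>Dominated convergence is about sequences, while infinite sums run along the net of
  finite subsets; countability supplies a cofinal sequence.\<close>

lemma countable_exhaustion:
  assumes "countable A"
  shows "\<exists>F :: nat \<Rightarrow> 'a set. (\<forall>k. finite (F k) \<and> F k \<subseteq> A) \<and> filterlim F (finite_subsets_at_top A) sequentially"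
proof (intro exI conjI allI)
  let ?F = "\<lambda>k. {a \<in> A. to_nat_on A a < k}"
  show "finite (?F k)" for k
  proof (rule finite_imageD)
    show "finite (to_nat_on A ` ?F k)" by (rule finite_subset[of _ "{..<k}"]) auto
    show "inj_on (to_nat_on A) (?F k)" using assms by (auto intro: inj_on_subset[OF inj_on_to_nat_on])
  qed
  show "?F k \<subseteq> A" for k by auto
  show "filterlim ?F (finite_subsets_at_top A) sequentially"
    unfolding filterlim_finite_subsets_at_top
  proof (intro allI impI)
    fix X assume X: "finite X \<and> X \<subseteq> A"
    show "\<forall>\<^sub>F k in sequentially. finite (?F k) \<and> X \<subseteq> ?F k \<and> ?F k \<subseteq> A"
    proof (rule eventually_sequentiallyI[of "Suc (Max (to_nat_on A ` X))"], intro conjI)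
      fix k assume k: "Suc (Max (to_nat_on A ` X)) \<le> k"
      show "finite (?F k)" by fact
      show "X \<subseteq> ?F k"
      proof
        fix x assume "x \<in> X"
        then have "to_nat_on A x \<le> Max (to_nat_on A ` X)" using X by (intro Max_ge) auto
        then have "to_nat_on A x < k" using k by linarith
        then show "x \<in> ?F k" using X \<open>x \<in> X\<close> by auto
      qed
    qed auto
  qed
qed

context contraction_pair
begin

definition dpow :: "real \<Rightarrow> nat \<Rightarrow> 'h cop" where
  "dpow s n = (\<Sum>j<n. Ns s ^ j * hs_op V * Ns s ^ (n - Suc j))"

definition ddpow :: "real \<Rightarrow> nat \<Rightarrow> 'h cop" where
  "ddpow s n = (\<Sum>j<n. Ns s ^ j * hs_op V * dpow s (n - Suc j) + dpow s j * hs_op V * Ns s ^ (n - Suc j))"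

definition dpow_hs :: "real \<Rightarrow> nat \<Rightarrow> 'h hs" where
  "dpow_hs s n = (\<Sum>j<n. rmul (lmul (Ns s ^ j) V) (Ns s ^ (n - Suc j)))"

definition rem :: "nat \<Rightarrow> 'h cop" where
  "rem n = N ^ n - N0 ^ n - dpow 0 n"

lemma hs_op_dpow_hs: "hs_op (dpow_hs s n) = dpow s n"
  by (simp add: dpow_hs_def dpow_def hs_op_sum hs_op_lmul hs_op_rmul)

lemma norm_dpow_hs:
  assumes "0 \<le> s" "s \<le> 1" shows "norm (dpow_hs s n) \<le> real n * norm V"
proof -
  have "norm (dpow_hs s n) \<le> (\<Sum>j<n. norm V)"
    unfolding dpow_hs_def
    by (rule sum_norm_le) (intro order_trans[OF norm_contraction_mul(2) norm_contraction_mul(1)]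
        contraction_power norm_Ns assms)
  then show ?thesis by simp
qed

lemma rem_eq: "rem n = (\<Sum>j<n. (N ^ j - N0 ^ j) * (N - N0) * N0 ^ (n - Suc j))"
  unfolding rem_def dpow_def power_diff_telescope[of N n N0] V Ns_0 sum_subtractf[symmetric]
  by (intro sum.cong refl) (simp add: algebra_simps)

text \<open>With the first-order term removed, each summand of \<open>rem_eq\<close> is a product of
  two Hilbert-Schmidt operators. The quadratic growth in \<open>n\<close> matches the weight in
  \<open>F2_plus\<close>.\<close>

lemma nuclear_bound_rem: "nuclear_bound (rem n) ((real n * norm V)\<^sup>2)"
proof -
  define D where "D j = (\<Sum>i<j. rmul (lmul (N ^ i) V) (N0 ^ (j - Suc i)))" for j
  have D: "hs_op (D j) = N ^ j - N0 ^ j" for j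
    unfolding power_diff_telescope[of N j N0] by (simp add: D_def hs_op_sum hs_op_lmul hs_op_rmul V)
  have nD: "norm (D j) \<le> real j * norm V" for j
  proof -
    have "norm (D j) \<le> (\<Sum>i<j. norm V)"
      unfolding D_def
      by (rule sum_norm_le) (intro order_trans[OF norm_contraction_mul(2) norm_contraction_mul(1)]
          contraction_power N N0)
    then show ?thesis by simp
  qed
  have "rem n = (\<Sum>j<n. hs_op (D j) * hs_op (rmul V (N0 ^ (n - Suc j))))"
    unfolding rem_eq by (intro sum.cong refl) (simp add: D hs_op_rmul V mult.assoc)
  moreover have "nuclear_bound (\<Sum>j<n. hs_op (D j) * hs_op (rmul V (N0 ^ (n - Suc j))))
      (\<Sum>j<n. norm (D j) * norm (rmul V (N0 ^ (n - Suc j))))"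
    by (rule nuclear_bound_sum) (rule nuclear_bound_mult)
  moreover have "(\<Sum>j<n. norm (D j) * norm (rmul V (N0 ^ (n - Suc j)))) \<le> (\<Sum>j<n. real n * norm V * norm V)"
  proof (intro sum_mono mult_mono)
    fix j assume "j \<in> {..<n}"
    then have "real j * norm V \<le> real n * norm V" by (simp add: mult_right_mono)
    then show "norm (D j) \<le> real n * norm V" using nD[of j] by linarith
    show "norm (rmul V (N0 ^ (n - Suc j))) \<le> norm V"
      by (intro norm_contraction_mul contraction_power N0)
  qed simp_all
  ultimately show ?thesis
    using nuclear_bound_mono by (fastforce simp: power2_eq_square mult_ac)
qed

section \<open>Taylor's formula for the powers and the trace of the second derivative\<close>

lemma Ns_deriv: "(Ns has_vector_derivative hs_op V) (at s within S)"
  unfolding Ns_def[abs_def] by (auto intro!: derivative_eq_intros)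

lemma Ns_power_deriv: "((\<lambda>s. Ns s ^ n) has_vector_derivative dpow s n) (at s within S)"
proof (induction n)
  case (Suc n)
  have "dpow s (Suc n) = Ns s * dpow s n + hs_op V * Ns s ^ n"
    unfolding dpow_def by (subst sum.lessThan_Suc_shift) (simp add: sum_distrib_left mult.assoc add.commute)
  then show ?case
    using has_vector_derivative_mult[OF Ns_deriv[of s S] Suc] by simp
qed (simp add: dpow_def)

lemma dpow_deriv: "((\<lambda>s. dpow s n) has_vector_derivative ddpow s n) (at s within S)"
  unfolding dpow_def[of _ n] ddpow_def
proof (rule has_vector_derivative_sum)
  fix j
  have "((\<lambda>s. Ns s ^ j * hs_op V) has_vector_derivative dpow s j * hs_op V) (at s within S)"
    using has_vector_derivative_mult[OF Ns_power_deriv has_vector_derivative_const] by simp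
  from has_vector_derivative_mult[OF this Ns_power_deriv]
  show "((\<lambda>s. Ns s ^ j * hs_op V * Ns s ^ (n - Suc j)) has_vector_derivative
      Ns s ^ j * hs_op V * dpow s (n - Suc j) + dpow s j * hs_op V * Ns s ^ (n - Suc j)) (at s within S)" .
qed

text \<open>Integrate the derivative of \<open>(1 - s) *\<^sub>R dpow s n + Ns s ^ n\<close>, in
  which the terms with \<open>dpow\<close> cancel.\<close>

lemma taylor_integral: "((\<lambda>s. (1 - s) *\<^sub>R ddpow s n) has_integral rem n) {0..1}"
proof -
  have "((\<lambda>s. (1 - s) *\<^sub>R ddpow s n) has_integral
      ((1 - 1) *\<^sub>R dpow 1 n + Ns 1 ^ n) - ((1 - 0) *\<^sub>R dpow 0 n + Ns 0 ^ n)) {0..1}"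
  proof (rule fundamental_theorem_of_calculus)
    fix s :: real
    have "((\<lambda>s::real. 1 - s) has_real_derivative -1) (at s within {0..1})"
      by (auto intro!: derivative_eq_intros)
    from has_vector_derivative_add[OF has_vector_derivative_scaleR[OF this dpow_deriv[where n = n]] Ns_power_deriv[where n = n]]
    show "((\<lambda>s. (1 - s) *\<^sub>R dpow s n + Ns s ^ n) has_vector_derivative (1 - s) *\<^sub>R ddpow s n) (at s within {0..1})"
      by simp
  qed simp
  then show ?thesis by (simp add: rem_def Ns_0 Ns_1 algebra_simps)
qed

definition ddpow_trace :: "real \<Rightarrow> nat \<Rightarrow> complex" where
  "ddpow_trace s n = (\<Sum>j<n. tr (lmul (Ns s ^ j) V) (dpow_hs s (n - Suc j)) + tr (dpow_hs s j) (rmul V (Ns s ^ (n - Suc j))))"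

lemma ddpow_eq:
  "ddpow s n = (\<Sum>j<n. hs_op (lmul (Ns s ^ j) V) * hs_op (dpow_hs s (n - Suc j)) + hs_op (dpow_hs s j) * hs_op (rmul V (Ns s ^ (n - Suc j))))"
  by (simp add: ddpow_def hs_op_dpow_hs hs_op_lmul hs_op_rmul mult.assoc)

lemma ddpow_has_sum: "((\<lambda>e. cinner (ddpow s n \<cdot> e) e) has_sum ddpow_trace s n) some_onb"
proof -
  have "cinner (ddpow s n \<cdot> e) e = (\<Sum>j<n. cinner ((hs_op (lmul (Ns s ^ j) V) * hs_op (dpow_hs s (n - Suc j))) \<cdot> e) e
      + cinner ((hs_op (dpow_hs s j) * hs_op (rmul V (Ns s ^ (n - Suc j)))) \<cdot> e) e)" for e
    unfolding ddpow_eq cop.sum_left cinner.sum_left cop.add_left cinner.add_left ..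
  then show ?thesis
    unfolding ddpow_trace_def by (simp only:) (intro has_sum_finite_sum has_sum_add tr_has_sum)
qed

text \<open>Uniform in \<open>s\<close>, so that it can dominate the partial traces under the
  integral.\<close>

lemma nuclear_bound_ddpow:
  assumes s: "0 \<le> s" "s \<le> 1"
  shows "nuclear_bound (ddpow s n) (2 * (real n * norm V)\<^sup>2)"
proof -
  have "nuclear_bound (ddpow s n) (\<Sum>j<n. norm (lmul (Ns s ^ j) V) * norm (dpow_hs s (n - Suc j)) + norm (dpow_hs s j) * norm (rmul V (Ns s ^ (n - Suc j))))"
    unfolding ddpow_eq by (intro nuclear_bound_sum nuclear_bound_add nuclear_bound_mult)
  moreover have "(\<Sum>j<n. norm (lmul (Ns s ^ j) V) * norm (dpow_hs s (n - Suc j)) + norm (dpow_hs s j) * norm (rmul V (Ns s ^ (n - Suc j))))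
      \<le> (\<Sum>j<n. norm V * (real n * norm V) + (real n * norm V) * norm V)"
  proof (intro sum_mono add_mono mult_mono)
    fix j assume j: "j \<in> {..<n}"
    have "real m * norm V \<le> real n * norm V" if "m \<le> n" for m using that by (simp add: mult_right_mono)
    then show "norm (dpow_hs s (n - Suc j)) \<le> real n * norm V" "norm (dpow_hs s j) \<le> real n * norm V"
      using norm_dpow_hs[OF s] j order_trans by (metis diff_le_self, metis lessThan_iff less_imp_le)
    show "norm (lmul (Ns s ^ j) V) \<le> norm V" "norm (rmul V (Ns s ^ (n - Suc j))) \<le> norm V"
      by (intro norm_contraction_mul contraction_power norm_Ns s)+
  qed simp_all
  ultimately show ?thesis
    by (rule nuclear_bound_mono[THEN nuclear_bound_mono]) (simp add: power2_eq_square mult_ac)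
qed

lemma sum_triangle:
  fixes g :: "nat \<Rightarrow> complex"
  shows "(\<Sum>j<Suc m. \<Sum>i<j. g i) = (\<Sum>i<m. of_nat (m - i) * g i)"
proof (induction m)
  case (Suc m)
  have "(\<Sum>i<Suc m. of_nat (Suc m - i) * g i) = (\<Sum>i<Suc m. of_nat (m - i) * g i + g i)"
    by (intro sum.cong refl) (simp add: Suc_diff_le distrib_right)
  then show ?case using Suc by (simp add: sum.distrib)
qed simp

text \<open>By cyclicity every trace that occurs is some \<open>tau s i (n - i)\<close>; it remains
  to count how often each \<open>i\<close> appears.\<close>

lemma ddpow_trace_eq: "ddpow_trace s (Suc (Suc n)) = of_nat (n + 2) * (\<Sum>k\<le>n. tau s k (n - k))"
proof -
  let ?m = "Suc n"
  define g where "g i = tau s i (n - i)" for i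
  have A: "tr (lmul (Ns s ^ j) V) (dpow_hs s (Suc ?m - Suc j)) = (\<Sum>i<?m - j. g i)" if "j < Suc ?m" for j
  proof -
    have "tr (lmul (Ns s ^ j) V) (rmul (lmul (Ns s ^ i) V) (Ns s ^ (?m - j - Suc i))) = g i" if "i < ?m - j" for i
    proof -
      have e: "(?m - j - Suc i) + j = n - i" using that by simp
      have "tr (lmul (Ns s ^ j) V) (rmul (lmul (Ns s ^ i) V) (Ns s ^ (?m - j - Suc i)))
          = tr (rmul (lmul (Ns s ^ i) V) (Ns s ^ (?m - j - Suc i))) (lmul (Ns s ^ j) V)"
        by (rule tr_commute)
      also have "\<dots> = tr (lmul (Ns s ^ i) V) (lmul (Ns s ^ (n - i)) V)"
        unfolding tr_rmul lmul_mult[symmetric] power_add[symmetric] e ..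
      finally show ?thesis by (simp add: g_def tau_def)
    qed
    then show ?thesis unfolding dpow_hs_def tr_sum_right by (intro sum.cong) auto
  qed
  have B: "tr (dpow_hs s j) (rmul V (Ns s ^ (Suc ?m - Suc j))) = (\<Sum>i<j. g (j - Suc i))" if j: "j < Suc ?m" for j
  proof -
    have "tr (rmul (lmul (Ns s ^ i) V) (Ns s ^ (j - Suc i))) (rmul V (Ns s ^ (?m - j))) = g (j - Suc i)" if "i < j" for i
    proof -
      have e: "(?m - j) + i = n - (j - Suc i)" using that j by simp
      have "tr (rmul (lmul (Ns s ^ i) V) (Ns s ^ (j - Suc i))) (rmul V (Ns s ^ (?m - j)))
          = tr (lmul (Ns s ^ i) V) (rmul (lmul (Ns s ^ (j - Suc i)) V) (Ns s ^ (?m - j)))"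
        unfolding tr_rmul lmul_rmul ..
      also have "\<dots> = tr (rmul (lmul (Ns s ^ (j - Suc i)) V) (Ns s ^ (?m - j))) (lmul (Ns s ^ i) V)"
        by (rule tr_commute)
      also have "\<dots> = tr (lmul (Ns s ^ (j - Suc i)) V) (lmul (Ns s ^ (n - (j - Suc i))) V)"
        unfolding tr_rmul lmul_mult[symmetric] power_add[symmetric] e ..
      finally show ?thesis by (simp add: g_def tau_def)
    qed
    then have "(\<Sum>i<j. tr (rmul (lmul (Ns s ^ i) V) (Ns s ^ (j - Suc i))) (rmul V (Ns s ^ (?m - j)))) = (\<Sum>i<j. g (j - Suc i))"
      by (intro sum.cong) auto
    moreover have "tr (dpow_hs s j) Y = (\<Sum>i<j. tr (rmul (lmul (Ns s ^ i) V) (Ns s ^ (j - Suc i))) Y)" for Y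
    proof -
      have "tr (dpow_hs s j) Y = tr Y (dpow_hs s j)" by (rule tr_commute)
      also have "\<dots> = (\<Sum>i<j. tr Y (rmul (lmul (Ns s ^ i) V) (Ns s ^ (j - Suc i))))"
        unfolding dpow_hs_def by (rule tr_sum_right)
      also have "\<dots> = (\<Sum>i<j. tr (rmul (lmul (Ns s ^ i) V) (Ns s ^ (j - Suc i))) Y)"
        by (intro sum.cong refl tr_commute)
      finally show ?thesis .
    qed
    ultimately show ?thesis by simp
  qed
  have "ddpow_trace s (Suc ?m) = (\<Sum>j<Suc ?m. (\<Sum>i<Suc ?m - Suc j. g i) + (\<Sum>i<j. g i))"
    unfolding ddpow_trace_def
  proof (intro sum.cong refl arg_cong2[where f = "(+)"])
    fix j assume "j \<in> {..<Suc ?m}"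
    then show "tr (lmul (Ns s ^ j) V) (dpow_hs s (Suc ?m - Suc j)) = (\<Sum>i<Suc ?m - Suc j. g i)"
      using A[of j] by simp
    show "tr (dpow_hs s j) (rmul V (Ns s ^ (Suc ?m - Suc j))) = (\<Sum>i<j. g i)"
      using B[of j] \<open>j \<in> {..<Suc ?m}\<close> by (simp only: lessThan_iff sum.nat_diff_reindex)
  qed
  also have "\<dots> = 2 * (\<Sum>j<Suc ?m. \<Sum>i<j. g i)"
    unfolding sum.distrib sum.nat_diff_reindex[of "\<lambda>j. \<Sum>i<j. g i" "Suc ?m"] by simp
  \<comment> \<open>Both halves count \<open>i\<close> with multiplicity \<open>?m - i\<close>. One
    is reversed, so that by \<open>tau_commute\<close> the total becomes
    \<open>(?m - i) + (i + 1) = n + 2\<close>, independent of \<open>i\<close>.\<close>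
  also have "\<dots> = (\<Sum>i<?m. of_nat (?m - i) * g i) + (\<Sum>i<?m. of_nat (?m - (?m - Suc i)) * g (?m - Suc i))"
    unfolding sum_triangle sum.nat_diff_reindex[of "\<lambda>i. of_nat (?m - i) * g i" ?m] by simp
  also have "\<dots> = (\<Sum>i<?m. of_nat (n + 2) * g i)"
    unfolding sum.distrib[symmetric]
  proof (intro sum.cong refl)
    fix i assume "i \<in> {..<?m}"
    then have i: "i \<le> n" by simp
    have "g (?m - Suc i) = g i" using i tau_commute[of s "n - i" i] by (simp add: g_def)
    moreover have "(?m - i) + (?m - (?m - Suc i)) = n + 2" using i by simp
    then have "of_nat (?m - i) + of_nat (?m - (?m - Suc i)) = (of_nat (n + 2) :: complex)"
      by (simp only: of_nat_add[symmetric])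
    ultimately show "of_nat (?m - i) * g i + of_nat (?m - (?m - Suc i)) * g (?m - Suc i) = of_nat (n + 2) * g i"
      by (simp only: distrib_right[symmetric])
  qed
  finally show ?thesis by (simp add: g_def sum_distrib_left lessThan_Suc_atMost)
qed

text \<open>Finite partial traces commute with the integral; dominated convergence along an
  exhaustion of the basis passes to the full trace.\<close>

lemma trace_rem_integral:
  assumes count: "countable (some_onb :: 'h set)"
  shows "(\<Sum>\<^sub>\<infinity>e\<in>some_onb. cinner (rem n \<cdot> e) e) = integral {0..1} (\<lambda>s. (1 - s) *\<^sub>R ddpow_trace s n)"
proof -
  obtain F :: "nat \<Rightarrow> 'h set" where F: "\<And>k. finite (F k)" "\<And>k. F k \<subseteq> some_onb"
    and lim: "filterlim F (finite_subsets_at_top some_onb) sequentially"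
    using countable_exhaustion[OF count] by blast
  let ?f = "\<lambda>k s. (1 - s) *\<^sub>R (\<Sum>e\<in>F k. cinner (ddpow s n \<cdot> e) e)"
  have f: "(?f k has_integral (\<Sum>e\<in>F k. cinner (rem n \<cdot> e) e)) {0..1}" for k
    unfolding scaleR_sum_right
  proof (intro has_integral_sum F)
    fix e :: 'h
    have "bounded_linear (\<lambda>A. cinner (A \<cdot> e) e)"
      by (rule bounded_linear_compose[OF cinner.bounded_linear_left cop.bounded_linear_left])
    from has_integral_linear[OF taylor_integral this]
    show "((\<lambda>s. (1 - s) *\<^sub>R cinner (ddpow s n \<cdot> e) e) has_integral cinner (rem n \<cdot> e) e) {0..1}"
      by (simp add: o_def cop.scaleR_left cinner.scaleR_left)
  qed
  have lim1: "(\<lambda>k. integral {0..1} (?f k)) \<longlonglongrightarrow> integral {0..1} (\<lambda>s. (1 - s) *\<^sub>R ddpow_trace s n)"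
  proof (rule dominated_convergence(2))
    show "?f k integrable_on {0..1}" for k using f by blast
    show "(\<lambda>_. 2 * (real n * norm V)\<^sup>2) integrable_on {0..1::real}" by (rule integrable_const_ivl)
    show "norm (?f k s) \<le> 2 * (real n * norm V)\<^sup>2" if "s \<in> {0..1}" for k s
    proof -
      have "cmod (\<Sum>e\<in>F k. cinner (ddpow s n \<cdot> e) e) \<le> 2 * (real n * norm V)\<^sup>2"
        using that by (intro nuclear_bound_partial[OF nuclear_bound_ddpow] F) auto
      moreover have "norm (?f k s) \<le> cmod (\<Sum>e\<in>F k. cinner (ddpow s n \<cdot> e) e)"
        using that by (simp add: mult_left_le_one_le)
      ultimately show ?thesis by linarith
    qed
    show "(\<lambda>k. ?f k s) \<longlonglongrightarrow> (1 - s) *\<^sub>R ddpow_trace s n" for s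
      using ddpow_has_sum[of s n] unfolding has_sum_def
      by (intro tendsto_scaleR tendsto_const) (rule filterlim_compose[OF _ lim])
  qed
  have lim2: "(\<lambda>k. \<Sum>e\<in>F k. cinner (rem n \<cdot> e) e) \<longlonglongrightarrow> (\<Sum>\<^sub>\<infinity>e\<in>some_onb. cinner (rem n \<cdot> e) e)"
    using abs_summable_summable[OF nuclear_summable[OF nuclear_bound_rem]]
    by (intro filterlim_compose[OF infsum_tendsto lim])
  show ?thesis
    by (rule LIMSEQ_unique[OF lim2 lim1[unfolded integral_unique[OF f]]])
qed

lemma trace_rem:
  assumes "countable (some_onb :: 'h set)"
  shows "(\<Sum>\<^sub>\<infinity>e\<in>some_onb. cinner (rem n \<cdot> e) e) = of_nat (n * (n - 1)) * mom V (hs_adj V) (n - 2)"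
proof (cases "n < 2")
  case True
  then have "rem n = 0" by (cases "n = 0") (simp_all add: rem_eq less_2_cases_iff)
  then show ?thesis using True by (cases "n = 0") (simp_all add: less_2_cases_iff)
next
  case False
  then obtain m where n: "n = Suc (Suc m)" by (metis add_2_eq_Suc le_add_diff_inverse not_less)
  have "(\<Sum>\<^sub>\<infinity>e\<in>some_onb. cinner (rem n \<cdot> e) e)
      = integral {0..1} (\<lambda>s. of_nat (m + 2) * ((1 - s) *\<^sub>R (\<Sum>k\<le>m. tau s k (m - k))))"
    unfolding trace_rem_integral[OF assms] n ddpow_trace_eq by (simp add: mult_scaleR_right)
  also have "\<dots> = of_nat (m + 2) * integral {0..1} (\<lambda>s. (1 - s) *\<^sub>R (\<Sum>k\<le>m. tau s k (m - k)))"
    by (rule integral_mult_right)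
  also have "\<dots> = of_nat (m + 2) * (of_nat (m + 1) * mom V (hs_adj V) m)"
    unfolding mom_eq_integral ..
  also have "\<dots> = of_nat (n * (n - 1)) * mom V (hs_adj V) (n - 2)"
    unfolding n mult.assoc[symmetric] of_nat_mult[symmetric] by simp
  finally show ?thesis .
qed

end

section \<open>Functional calculus\<close>

text \<open>Distinct basis vectors have distance \<open>sqrt 2\<close>, so points of a countable
  dense set chosen within \<open>1/2\<close> of them are distinct.\<close>

lemma countable_some_onb:
  assumes "separable_space (euclidean :: 'a::complex_hilbert_space topology)"
  shows "countable (some_onb :: 'a set)"
proof -
  obtain C :: "'a set" where C: "countable C" "closure C = UNIV"
    using assms unfolding separable_space_def by auto
  have "\<exists>c\<in>C. dist c e < 1/2" for e :: 'a
    using closure_approachable[of e C] unfolding C(2) by (meson UNIV_I half_gt_zero zero_less_one)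
  then obtain c where c: "\<And>e. c e \<in> C" "\<And>e::'a. dist (c e) e < 1/2" by metis
  have "inj_on c some_onb"
  proof (rule inj_onI, rule ccontr)
    fix e f :: 'a assume ef: "e \<in> some_onb" "f \<in> some_onb" "c e = c f" "e \<noteq> f"
    have "cinner e e = 1" "cinner f f = 1" "cinner e f = 0"
      using orthonormal_basis_some_onb ef by (auto simp: orthonormal_basis_def)
    then have "(norm (e - f))\<^sup>2 = 2"
      using Re_cinner_self[of e] Re_cinner_self[of f] by (simp add: norm_diff_sq)
    moreover have "dist e f \<le> dist (c e) e + dist (c f) f"
      using ef(3) by (metis dist_commute dist_triangle)
    then have "norm (e - f) < 1" using c(2)[of e] c(2)[of f] by (simp add: dist_norm)
    then have "(norm (e - f))\<^sup>2 < 1\<^sup>2" by (intro power_strict_mono) auto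
    ultimately show False by simp
  qed
  moreover have "countable (c ` some_onb)" by (rule countable_subset[OF _ C(1)]) (use c in auto)
  ultimately show ?thesis using countable_image_inj_on by blast
qed

lemma norm_scaleC_cop: "norm (c *\<^sub>C A :: 'a::complex_hilbert_space cop) \<le> cmod c * norm A"
  by (rule norm_cop_bound) (simp_all add: norm_scaleC mult.assoc mult_left_mono norm_cop_apply)

lemma scaleC_cop_diff: "c *\<^sub>C (A - B :: 'a::complex_hilbert_space cop) = c *\<^sub>C A - c *\<^sub>C B"
  by (rule cop_eqI) (simp add: cop.diff_left scaleC.diff_right)

lemma scaleC_cop_scaleR: "c *\<^sub>C (r *\<^sub>R A :: 'a::complex_hilbert_space cop) = r *\<^sub>R (c *\<^sub>C A)"
  by (rule cop_eqI) (simp add: cop.scaleR_left scaleC.scaleR_right)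

lemma op_power_blinfun_of: "op_power (blinfun_of T) k = blinfun_of (T ^ k)"
  by (induction k) (simp_all add: op_power_def one_cop.rep_eq times_cop.rep_eq)

text \<open>Subtracting the linearization at \<open>B\<close> from the telescoped difference leaves
  the extra factor \<open>A ^ j - B ^ j\<close>, again of first order. Serves the derivative at
  \<open>s = 0\<close> as well as the convergence of the series of remainders.\<close>

lemma contraction_power_diff:
  fixes A B :: "'a::complex_hilbert_space cop"
  assumes A: "norm A \<le> 1" and B: "norm B \<le> 1"
  shows "norm (A ^ n - B ^ n - (\<Sum>j<n. B ^ j * (A - B) * B ^ (n - Suc j))) \<le> (real n)\<^sup>2 * (norm (A - B))\<^sup>2"
proof -
  have tri: "norm (C * D * E) \<le> norm C * norm D" if "norm E \<le> 1" for C D E :: "'a cop"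
    by (rule order_trans[OF norm_mult_contraction(2)[OF that] norm_mult_ineq])
  have 1: "norm (A ^ m - B ^ m) \<le> real m * norm (A - B)" for m
  proof -
    have "norm (A ^ m - B ^ m) \<le> (\<Sum>j<m. norm (A - B))"
      unfolding power_diff_telescope
    proof (rule sum_norm_le)
      fix j
      show "norm (A ^ j * (A - B) * B ^ (m - Suc j)) \<le> norm (A - B)"
        by (rule order_trans[OF norm_mult_contraction(2) norm_mult_contraction(1)]) (intro contraction_power A B)+
    qed
    then show ?thesis by simp
  qed
  have "A ^ n - B ^ n - (\<Sum>j<n. B ^ j * (A - B) * B ^ (n - Suc j))
      = (\<Sum>j<n. (A ^ j - B ^ j) * (A - B) * B ^ (n - Suc j))"
    unfolding power_diff_telescope[of A n B] sum_subtractf[symmetric]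
    by (intro sum.cong refl) (simp add: algebra_simps)
  also have "norm \<dots> \<le> (\<Sum>j<n. real n * norm (A - B) * norm (A - B))"
  proof (rule sum_norm_le)
    fix j assume "j \<in> {..<n}"
    have "norm ((A ^ j - B ^ j) * (A - B) * B ^ (n - Suc j)) \<le> norm (A ^ j - B ^ j) * norm (A - B)"
      by (rule tri) (intro contraction_power B)
    also have "\<dots> \<le> real n * norm (A - B) * norm (A - B)"
      using 1[of j] \<open>j \<in> {..<n}\<close> mult_right_mono[of "real j" "real n" "norm (A - B)"]
      by (intro mult_right_mono) auto
    finally show "norm ((A ^ j - B ^ j) * (A - B) * B ^ (n - Suc j)) \<le> real n * norm (A - B) * norm (A - B)" .
  qed
  also have "\<dots> = (real n)\<^sup>2 * (norm (A - B))\<^sup>2" by (simp add: power2_eq_square)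
  finally show "norm (A ^ n - B ^ n - (\<Sum>j<n. B ^ j * (A - B) * B ^ (n - Suc j))) \<le> (real n)\<^sup>2 * (norm (A - B))\<^sup>2" .
qed

text \<open>The index 0 is exempt because the weight vanishes there while the constant term of a
  series need not.\<close>

lemma summable_weight_le:
  fixes f :: "nat \<Rightarrow> 'b::banach"
  assumes "summable (\<lambda>k. (real k)\<^sup>2 * cmod (a k))" "\<And>k. 1 \<le> k \<Longrightarrow> norm (f k) \<le> C * ((real k)\<^sup>2 * cmod (a k))"
  shows "summable (\<lambda>k. norm (f k))"
  by (rule summable_comparison_test'[of "\<lambda>k. C * ((real k)\<^sup>2 * cmod (a k))" 1])
    (use assms in \<open>auto intro: summable_mult\<close>)

context contraction_pair
begin

text \<open>The series can be differentiated term by term, since the errors of the powers are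
  quadratic in \<open>s\<close> with coefficients dominated by the summable weights.\<close>

lemma fun_calc_taylor:
  assumes a: "summable (\<lambda>k. (real k)\<^sup>2 * cmod (fourier_coeff \<Phi> (int k)))"
  defines "D \<equiv> (\<Sum>k. fourier_coeff \<Phi> (int k) *\<^sub>C dpow 0 k)"
  shows "((\<lambda>s. fun_calc \<Phi> (blinfun_of N0 + s *\<^sub>R blinfun_of (hs_op V))) has_vector_derivative blinfun_of D) (at 0 within {0..1})"
    and "(\<lambda>k. fourier_coeff \<Phi> (int k) *\<^sub>C rem k) sums L \<Longrightarrow> taylor_remainder \<Phi> (blinfun_of N0) (blinfun_of (hs_op V)) = blinfun_of L"
proof -
  let ?a = "\<lambda>k. fourier_coeff \<Phi> (int k)"
  let ?v = "norm (hs_op V)"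
  let ?F = "\<lambda>s. fun_calc \<Phi> (blinfun_of N0 + s *\<^sub>R blinfun_of (hs_op V))"
  have sq: "1 \<le> (real k)\<^sup>2" if "1 \<le> k" for k using that by simp
  have sum_FC: "summable (\<lambda>k. ?a k *\<^sub>C T ^ k)" if "norm T \<le> 1" for T :: "'h cop"
  proof (rule summable_norm_cancel, rule summable_weight_le[OF a, of _ 1])
    fix k :: nat assume "1 \<le> k"
    have "norm (?a k *\<^sub>C T ^ k) \<le> cmod (?a k) * norm (T ^ k)" by (rule norm_scaleC_cop)
    also have "\<dots> \<le> cmod (?a k) * 1" by (intro mult_left_mono contraction_power that) simp
    also have "\<dots> \<le> (real k)\<^sup>2 * cmod (?a k)"
      using mult_right_mono[OF sq[OF \<open>1 \<le> k\<close>], of "cmod (?a k)"] by simp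
    finally show "norm (?a k *\<^sub>C T ^ k) \<le> 1 * ((real k)\<^sup>2 * cmod (?a k))" by simp
  qed
  define FC where "FC T = (\<Sum>k. ?a k *\<^sub>C T ^ k)" for T :: "'h cop"
  have FC: "fun_calc \<Phi> (blinfun_of T) = blinfun_of (FC T)" if "norm T \<le> 1" for T :: "'h cop"
    unfolding fun_calc_def FC_def bounded_linear.suminf[OF bounded_linear_blinfun_of sum_FC[OF that]]
    by (simp add: op_power_blinfun_of scaleC_cop.rep_eq)
  \<comment> \<open>The operator series is controlled only for contractions, hence the restriction
    to \<open>s\<close> in the unit interval and the one-sided derivative.\<close>
  have FC': "?F s = blinfun_of (FC (Ns s))" if "s \<in> {0..1}" for s
    using that FC[of "Ns s"] norm_Ns[of s] by (simp add: Ns_def plus_cop.rep_eq scaleR_cop.rep_eq)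
  have dpow_le: "norm (dpow 0 k) \<le> real k * ?v" for k
  proof -
    have "norm (dpow 0 k) \<le> (\<Sum>j<k. ?v)"
      unfolding dpow_def Ns_0
      by (rule sum_norm_le, rule order_trans[OF norm_mult_contraction(2) norm_mult_contraction(1)])
        (intro contraction_power N0)+
    then show ?thesis by simp
  qed
  have sum_D: "summable (\<lambda>k. ?a k *\<^sub>C dpow 0 k)"
  proof (rule summable_norm_cancel, rule summable_weight_le[OF a, of _ "?v"])
    fix k :: nat assume "1 \<le> k"
    then have kk: "real k \<le> (real k)\<^sup>2" by (simp add: power2_eq_square)
    have "norm (?a k *\<^sub>C dpow 0 k) \<le> cmod (?a k) * norm (dpow 0 k)" by (rule norm_scaleC_cop)
    also have "\<dots> \<le> cmod (?a k) * ((real k)\<^sup>2 * ?v)"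
      using dpow_le[of k] mult_right_mono[OF kk norm_ge_zero[of "hs_op V"]] by (intro mult_left_mono) auto
    finally show "norm (?a k *\<^sub>C dpow 0 k) \<le> ?v * ((real k)\<^sup>2 * cmod (?a k))" by (simp add: mult_ac)
  qed
  have taylor_le: "norm (FC (Ns s) - FC N0 - s *\<^sub>R D) \<le> (\<Sum>k. (real k)\<^sup>2 * cmod (?a k)) * (s * ?v)\<^sup>2" if s: "s \<in> {0..1}" for s
  proof -
    have nNs: "norm (Ns s) \<le> 1" using s norm_Ns by simp
    have "(\<lambda>k. ?a k *\<^sub>C Ns s ^ k - ?a k *\<^sub>C N0 ^ k - s *\<^sub>R (?a k *\<^sub>C dpow 0 k)) sums (FC (Ns s) - FC N0 - s *\<^sub>R D)"
      unfolding FC_def D_def by (intro sums_diff sums_scaleR_right summable_sums sum_FC nNs N0 sum_D)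
    moreover have "?a k *\<^sub>C Ns s ^ k - ?a k *\<^sub>C N0 ^ k - s *\<^sub>R (?a k *\<^sub>C dpow 0 k)
        = ?a k *\<^sub>C (Ns s ^ k - N0 ^ k - s *\<^sub>R dpow 0 k)" for k
      by (simp add: scaleC_cop_diff scaleC_cop_scaleR)
    ultimately have sums: "(\<lambda>k. ?a k *\<^sub>C (Ns s ^ k - N0 ^ k - s *\<^sub>R dpow 0 k)) sums (FC (Ns s) - FC N0 - s *\<^sub>R D)"
      by simp
    have le: "norm (?a k *\<^sub>C (Ns s ^ k - N0 ^ k - s *\<^sub>R dpow 0 k)) \<le> ((real k)\<^sup>2 * cmod (?a k)) * (s * ?v)\<^sup>2" for k
    proof -
      have d: "Ns s - N0 = s *\<^sub>R hs_op V" by (simp add: Ns_def)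
      have "s *\<^sub>R dpow 0 k = (\<Sum>j<k. N0 ^ j * (Ns s - N0) * N0 ^ (k - Suc j))"
        unfolding dpow_def Ns_0 d scaleR_sum_right by simp
      then have "norm (Ns s ^ k - N0 ^ k - s *\<^sub>R dpow 0 k) \<le> (real k)\<^sup>2 * (s * ?v)\<^sup>2"
        using contraction_power_diff[OF nNs N0, of k] s by (simp add: d power_mult_distrib)
      then have "cmod (?a k) * norm (Ns s ^ k - N0 ^ k - s *\<^sub>R dpow 0 k) \<le> cmod (?a k) * ((real k)\<^sup>2 * (s * ?v)\<^sup>2)"
        by (rule mult_left_mono) simp
      then show ?thesis
        using norm_scaleC_cop[of "?a k" "Ns s ^ k - N0 ^ k - s *\<^sub>R dpow 0 k"] by (simp add: mult_ac)
    qed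
    show ?thesis
      unfolding sums_unique[OF sums] suminf_mult2[OF a]
      by (rule norm_suminf_le[OF le summable_mult2[OF a]])
  qed
  define S where "S = (\<Sum>k. (real k)\<^sup>2 * cmod (?a k)) * ?v\<^sup>2"
  have S0: "0 \<le> S" unfolding S_def by (intro mult_nonneg_nonneg suminf_nonneg a) simp_all
  have taylor_le': "norm (FC (Ns s) - FC N0 - s *\<^sub>R D) \<le> S * s\<^sup>2" if "s \<in> {0..1}" for s
    using taylor_le[OF that] by (simp add: S_def power_mult_distrib mult_ac)
  show deriv: "(?F has_vector_derivative blinfun_of D) (at 0 within {0..1})"
    unfolding has_vector_derivative_def has_derivative_within_alt
  proof (intro conjI allI impI)
    show "bounded_linear (\<lambda>x. x *\<^sub>R blinfun_of D)" by (rule bounded_linear_scaleR_left)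
    fix e :: real assume "0 < e"
    show "\<exists>d>0. \<forall>y\<in>{0..1}. norm (y - 0) < d \<longrightarrow>
        norm (?F y - ?F 0
          - (y - 0) *\<^sub>R blinfun_of D) \<le> e * norm (y - 0)"
    \<comment> \<open>The error is at most \<open>S * y\<^sup>2\<close>; the \<open>+ 1\<close>
      covers the case \<open>S = 0\<close>.\<close>
    proof (intro exI[of _ "e / (S + 1)"] conjI ballI impI)
      show "0 < e / (S + 1)" using \<open>0 < e\<close> S0 by simp
      fix y :: real assume y: "y \<in> {0..1}" "norm (y - 0) < e / (S + 1)"
      have "norm (?F y - ?F 0
          - (y - 0) *\<^sub>R blinfun_of D) = norm (FC (Ns y) - FC N0 - y *\<^sub>R D)"
        using y(1) by (simp only: FC') (simp add: FC[OF N0] norm_cop.rep_eq minus_cop.rep_eq scaleR_cop.rep_eq)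
      also have "\<dots> \<le> (S * y) * y" using taylor_le'[OF y(1)] by (simp add: power2_eq_square mult.assoc)
      also have "\<dots> \<le> e * y"
      proof (rule mult_right_mono)
        have "S * y \<le> (S + 1) * y" using y by (simp add: distrib_right)
        also have "\<dots> \<le> e" using y S0 by (simp add: field_simps)
        finally show "S * y \<le> e" .
      qed (use y in simp)
      finally show "norm (?F y - ?F 0
          - (y - 0) *\<^sub>R blinfun_of D) \<le> e * norm (y - 0)" using y by simp
    qed
  qed
  assume L: "(\<lambda>k. ?a k *\<^sub>C rem k) sums L"
  have "(\<lambda>k. ?a k *\<^sub>C N ^ k - ?a k *\<^sub>C N0 ^ k - ?a k *\<^sub>C dpow 0 k) sums (FC N - FC N0 - D)"
    unfolding FC_def D_def by (intro sums_diff summable_sums sum_FC N N0 sum_D)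
  then have "(\<lambda>k. ?a k *\<^sub>C rem k) sums (FC N - FC N0 - D)"
    by (simp add: rem_def scaleC_cop_diff)
  then have "L = FC N - FC N0 - D" using L sums_unique2 by blast
  \<comment> \<open>The endpoint 0 is a limit point of the interval, so the one-sided derivative is
    unique.\<close>
  moreover have "vector_derivative ?F (at 0 within {0..1}) = blinfun_of D"
    using vector_derivative_within_cbox[of 0 1 0] deriv by (simp add: box_real)
  ultimately show "taylor_remainder \<Phi> (blinfun_of N0) (blinfun_of (hs_op V)) = blinfun_of L"
    unfolding taylor_remainder_def using FC'[of 1] FC[OF N0] by (simp add: Ns_1 minus_cop.rep_eq)
qed

text \<open>The double series over \<open>k\<close> and the basis is summed in both orders: over the
  basis first it gives the moments, over \<open>k\<close> first the diagonal of the limit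
  \<open>L\<close>.\<close>

lemma taylor_remainder_trace:
  assumes a: "summable (\<lambda>k. (real k)\<^sup>2 * cmod (fourier_coeff \<Phi> (int k)))"
    and count: "countable (some_onb :: 'h set)"
  shows "trace_class (taylor_remainder \<Phi> (blinfun_of N0) (blinfun_of (hs_op V)))"
    and "(\<lambda>k. fourier_coeff \<Phi> (int k) * (of_nat (k * (k - 1)) * mom V (hs_adj V) (k - 2)))
      sums op_trace (taylor_remainder \<Phi> (blinfun_of N0) (blinfun_of (hs_op V)))"
proof -
  let ?a = "\<lambda>k. fourier_coeff \<Phi> (int k)"
  let ?v = "norm V"
  let ?E = "some_onb :: 'h set"
  let ?t = "\<lambda>k. ?a k * (of_nat (k * (k - 1)) * mom V (hs_adj V) (k - 2))"
  let ?b = "\<lambda>k. ?v\<^sup>2 * ((real k)\<^sup>2 * cmod (?a k))"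
  let ?D = "taylor_remainder \<Phi> (blinfun_of N0) (blinfun_of (hs_op V))"
  have nb: "nuclear_bound (?a k *\<^sub>C rem k) (?b k)" for k
    using nuclear_bound_scaleC[OF nuclear_bound_rem, of "?a k" k] by (simp add: power_mult_distrib mult_ac)
  have rem_le: "norm (rem k) \<le> (real k)\<^sup>2 * (norm (hs_op V))\<^sup>2" for k
    using contraction_power_diff[OF N N0, of k] by (simp add: rem_def dpow_def Ns_0 V)
  have "summable (\<lambda>k. norm (?a k *\<^sub>C rem k))"
  proof (rule summable_weight_le[OF a])
    fix k
    show "norm (?a k *\<^sub>C rem k) \<le> (norm (hs_op V))\<^sup>2 * ((real k)\<^sup>2 * cmod (?a k))"
      using order_trans[OF norm_scaleC_cop mult_left_mono[OF rem_le norm_ge_zero], of "?a k" k] by (simp add: mult_ac)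
  qed
  from summable_sums[OF summable_norm_cancel[OF this]]
  obtain L where L: "(\<lambda>k. ?a k *\<^sub>C rem k) sums L" by (rule that)
  have TL: "?D = blinfun_of L"
    by (rule fun_calc_taylor(2)[OF a L])
  have "nuclear_bound L (\<Sum>k. ?b k)"
  proof (rule nuclear_bound_lim)
    show "(\<lambda>n. \<Sum>k<n. ?a k *\<^sub>C rem k) \<longlonglongrightarrow> L" using L by (simp add: sums_def)
    show "nuclear_bound (\<Sum>k<n. ?a k *\<^sub>C rem k) (\<Sum>k. ?b k)" for n
      by (rule nuclear_bound_mono[OF nuclear_bound_sum[OF nb]], rule sum_le_suminf) (auto intro: summable_mult a)
  qed
  then show "trace_class (?D)"
    unfolding TL by (rule trace_class_nuclear_bound)
  let ?f = "\<lambda>(k, e). ?a k * cinner (rem k \<cdot> e) e"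
  have abs_k: "(\<lambda>e. cmod (?f (k, e))) summable_on ?E" for k
    using nuclear_summable[OF nb[of k]] by (simp add: cinner_scaleC_left)
  have col: "((\<lambda>e. ?f (k, e)) has_sum ?t k) ?E" for k
  proof -
    have "((\<lambda>e. cinner (rem k \<cdot> e) e) has_sum of_nat (k * (k - 1)) * mom V (hs_adj V) (k - 2)) ?E"
      unfolding trace_rem[OF count, symmetric]
      by (rule has_sum_infsum[OF abs_summable_summable[OF nuclear_summable[OF nuclear_bound_rem]]])
    then show ?thesis by (simp add: has_sum_cmult_right)
  qed
  \<comment> \<open>Absolute summability comes from the nuclear bounds of the terms, whose sum over
    \<open>k\<close> is finite by hypothesis \<open>a\<close>.\<close>
  have "(\<lambda>p. cmod (?f p)) summable_on UNIV \<times> ?E"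
  proof (rule summable_on_SigmaI)
    show "((\<lambda>e. cmod (?f (k, e))) has_sum (\<Sum>\<^sub>\<infinity>e\<in>?E. cmod (?f (k, e)))) ?E" for k
      by (rule has_sum_infsum[OF abs_k])
    have "(\<Sum>\<^sub>\<infinity>e\<in>?E. cmod (?f (k, e))) \<le> ?b k" for k
    proof (rule infsum_le_finite_sums[OF abs_k])
      fix F assume F: "finite F" "F \<subseteq> ?E"
      have "(\<Sum>e\<in>F. cmod (cinner ((1 * (?a k *\<^sub>C rem k)) \<cdot> e) e)) \<le> ?b k"
        using nb[of k] F norm_cop_one_le unfolding nuclear_bound_def by blast
      then show "(\<Sum>e\<in>F. cmod (?f (k, e))) \<le> ?b k"
        by (simp add: cinner_scaleC_left)
    qed
    moreover have "0 \<le> (\<Sum>\<^sub>\<infinity>e\<in>?E. cmod (?f (k, e)))" for k by (rule infsum_nonneg) simp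
    ultimately have "summable (\<lambda>k. norm (\<Sum>\<^sub>\<infinity>e\<in>?E. cmod (?f (k, e))))"
      by (intro summable_weight_le[OF a, of _ "?v\<^sup>2"]) (simp add: abs_of_nonneg)
    then show "(\<lambda>k. \<Sum>\<^sub>\<infinity>e\<in>?E. cmod (?f (k, e))) summable_on UNIV"
      by (rule norm_summable_imp_summable_on)
  qed simp
  then have "?f summable_on UNIV \<times> ?E" by (rule abs_summable_summable)
  then obtain S where S: "(?f has_sum S) (UNIV \<times> ?E)" by (auto simp: summable_on_def)
  from has_sum_SigmaD[OF S col]
  have sums: "?t sums S"
    by (rule has_sum_imp_sums)
  have "((\<lambda>(e, k). ?f (k, e)) has_sum S) (?E \<times> UNIV)"
    using S by (subst has_sum_swap) (simp add: case_prod_unfold)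
  then have "((\<lambda>e. cinner (L \<cdot> e) e) has_sum S) ?E"
  proof (rule has_sum_SigmaD)
    fix e assume "e \<in> ?E"
    have bl: "bounded_linear (\<lambda>A. cinner (A \<cdot> e) e)"
      by (rule bounded_linear_compose[OF cinner.bounded_linear_left cop.bounded_linear_left])
    have 1: "(\<lambda>k. ?a k * cinner (rem k \<cdot> e) e) sums cinner (L \<cdot> e) e"
      using bounded_linear.sums[OF bl L] by (simp add: cinner_scaleC_left)
    have "summable (\<lambda>k. norm (?a k * cinner (rem k \<cdot> e) e))"
    proof (rule summable_weight_le[OF a])
      fix k
      have "(\<Sum>e\<in>{e}. cmod (cinner ((1 * (?a k *\<^sub>C rem k)) \<cdot> e) e)) \<le> ?b k"
        using nb[of k] \<open>e \<in> ?E\<close> norm_cop_one_le unfolding nuclear_bound_def by blast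
      then show "norm (?a k * cinner (rem k \<cdot> e) e) \<le> ?b k"
        by (simp add: cinner_scaleC_left)
    qed
    from norm_summable_imp_has_sum[OF this 1]
    show "((\<lambda>k. case (e, k) of (e, k) \<Rightarrow> ?f (k, e)) has_sum cinner (L \<cdot> e) e) UNIV" by simp
  qed
  then have "op_trace (blinfun_of L) = S"
    unfolding op_trace_def by (simp add: infsumI flip: cop_apply.rep_eq)
  with sums show "?t
      sums op_trace (?D)"
    unfolding TL by simp
qed

end

section \<open>The trace formula\<close>

text \<open>The integral norm of the \<open>k\<close>-th term is \<open>cmod (b k)\<close> times
  that of \<open>\<eta>\<close>, which permits termwise integration.\<close>

lemma circle_integral_series:
  assumes \<eta>: "\<eta> \<in> L1_circle" and b: "summable (\<lambda>k. cmod (b k))"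
  shows "(\<lambda>k. b k * circle_integral (\<lambda>z. z ^ m k * \<eta> z)) sums circle_integral (\<lambda>z. (\<Sum>k. b k * z ^ m k) * \<eta> z)"
proof -
  let ?M = "lebesgue_on {0..2*pi}"
  have int: "integrable ?M (\<lambda>t. \<eta> (cis t))" using \<eta> by (simp add: L1_circle_iff)
  define g where "g k t = b k * (cis t ^ m k * (\<i> * cis t))" for k t
  have g: "g k \<in> borel_measurable ?M" for k unfolding g_def[abs_def] by measurable
  have ng: "cmod (g k t) = cmod (b k)" for k t by (simp add: g_def norm_mult norm_power)
  have gf: "integrable ?M (\<lambda>t. g k t * \<eta> (cis t))" for k
    by (rule integrable_bounded_mult[OF int g, where C = "cmod (b k)"]) (simp add: ng)
  have sg: "summable (\<lambda>k. g k t)" for t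
    by (rule summable_norm_cancel) (simp add: ng b)
  have "(\<lambda>k. \<integral>t. g k t * \<eta> (cis t) \<partial>?M) sums (\<integral>t. (\<Sum>k. g k t * \<eta> (cis t)) \<partial>?M)"
  proof (rule sums_integral[OF gf])
    show "AE t in ?M. summable (\<lambda>k. norm (g k t * \<eta> (cis t)))"
      by (simp add: norm_mult ng summable_mult2 b)
    show "summable (\<lambda>k. \<integral>t. norm (g k t * \<eta> (cis t)) \<partial>?M)"
      by (simp add: norm_mult ng summable_mult2 b)
  qed
  moreover have "(\<integral>t. g k t * \<eta> (cis t) \<partial>?M) = b k * circle_integral (\<lambda>z. z ^ m k * \<eta> z)" for k
  proof -
    have "integral {0..2*pi} (\<lambda>t. g k t * \<eta> (cis t)) = integral {0..2*pi} (\<lambda>t. b k * ((cis t ^ m k * \<eta> (cis t)) * (\<i> * cis t)))"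
      by (rule integral_cong) (simp add: g_def mult_ac)
    then show ?thesis
      unfolding lebesgue_on_integral_eq[OF gf] circle_integral_def by simp
  qed
  moreover have "(\<integral>t. (\<Sum>k. g k t * \<eta> (cis t)) \<partial>?M) = circle_integral (\<lambda>z. (\<Sum>k. b k * z ^ m k) * \<eta> z)"
  proof -
    have "summable (\<lambda>k. b k * cis t ^ m k)" for t
      by (rule summable_norm_cancel) (simp add: norm_mult norm_power b)
    then have eq: "(\<Sum>k. g k t * \<eta> (cis t)) = (\<Sum>k. b k * cis t ^ m k) * \<eta> (cis t) * (\<i> * cis t)" for t
      using suminf_mult2[OF sg[of t], of "\<eta> (cis t)"]
        suminf_mult2[of "\<lambda>k. b k * cis t ^ m k" "\<i> * cis t"] by (simp add: g_def mult_ac)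
    have "integrable ?M (\<lambda>t. (\<Sum>k. g k t) * \<eta> (cis t))"
      by (rule integrable_bounded_mult[OF int, where C = "\<Sum>k. cmod (b k)"])
        (use g summable_norm[of "\<lambda>k. g k _"] in \<open>auto intro: borel_measurable_suminf simp: ng b\<close>)
    then have "integrable ?M (\<lambda>t. \<Sum>k. g k t * \<eta> (cis t))"
      by (simp add: suminf_mult2[OF sg])
    from lebesgue_on_integral_eq[OF this] show ?thesis
      unfolding circle_integral_def eq by simp
  qed
  ultimately show ?thesis by simp
qed

section \<open>Monomials as test functions\<close>

lemma fourier_coeff_power: "fourier_coeff (\<lambda>z. z ^ m) k = (if k = int m then 1 else 0)"
proof -
  have "cis t ^ m * cis (- (of_int k * t)) = cis (of_int (int m - k) * t)" for t
    by (simp add: Complex.DeMoivre cis_mult left_diff_distrib)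
  then show ?thesis
    unfolding fourier_coeff_def by (simp only: integral_cis_int) auto
qed

text \<open>Supplies the test functions for uniqueness: on monomials the trace formula fixes every
  moment of \<open>\<eta>\<close> with nonnegative index.\<close>

lemma power_in_F2_plus: "(\<lambda>z. z ^ m) \<in> F2_plus"
proof -
  have deriv: "((\<lambda>t. c * cis (real m * t)) has_vector_derivative (c * (\<i> * m)) * cis (real m * t)) (at t)" for c t
  proof -
    have "((\<lambda>z. c * exp (\<i> * m * z)) has_field_derivative (c * (\<i> * m)) * exp (\<i> * m * of_real t)) (at (of_real t))"
      by (rule derivative_eq_intros refl)+ (simp add: mult_ac)
    from has_vector_derivative_real_field[OF this, of UNIV]
    show ?thesis by (simp add: cis_conv_exp mult.assoc)
  qed
  have "(\<lambda>z. z ^ m) \<in> C2_circle"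
    unfolding C2_circle_def
  proof (intro CollectI exI conjI allI)
    show "((\<lambda>t. cis t ^ m) has_vector_derivative (1 * (\<i> * m)) * cis (real m * t)) (at t)" for t
      using deriv[of 1 t] by (simp add: Complex.DeMoivre)
    show "((\<lambda>t. (1 * (\<i> * m)) * cis (real m * t)) has_vector_derivative ((1 * (\<i> * m)) * (\<i> * m)) * cis (real m * t)) (at t)" for t
      by (rule deriv)
    show "continuous_on UNIV (\<lambda>t. ((1 * (\<i> * m)) * (\<i> * m)) * cis (real m * t))"
      by (intro continuous_intros)
  qed
  moreover have "(\<lambda>k. fourier_coeff (\<lambda>z. z ^ m) (int k) * z ^ k) sums z ^ m" for z
    using sums_single[of m "\<lambda>k. z ^ k"] by (simp add: fourier_coeff_power if_distrib[of "\<lambda>x. x * _"] cong: if_cong)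
  moreover have "summable (\<lambda>k. (real k)\<^sup>2 * cmod (fourier_coeff (\<lambda>z. z ^ m) (int k)))"
    by (rule summable_finite[of "{m}"]) (auto simp: fourier_coeff_power)
  ultimately show ?thesis by (simp add: F2_plus_def)
qed

lemma second_deriv_power: "second_deriv (\<lambda>z. z ^ m) z = of_nat (m * (m - 1)) * z ^ (m - 2)"
proof -
  have "(\<lambda>k. of_nat (k * (k - 1)) * fourier_coeff (\<lambda>z. z ^ m) (int k) * z ^ (k - 2))
      = (\<lambda>k. if k = m then of_nat (k * (k - 1)) * z ^ (k - 2) else 0)"
    by (auto simp: fourier_coeff_power fun_eq_iff)
  then show ?thesis
    unfolding second_deriv_def using sums_single[of m "\<lambda>k. of_nat (k * (k - 1)) * z ^ (k - 2)"]
    by (simp add: sums_iff)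
qed

lemma circle_integral_cmult: "circle_integral (\<lambda>z. c * f z) = c * circle_integral f"
  unfolding circle_integral_def by (simp add: mult.assoc)

theorem theorem5p3:
  fixes N N0 V :: "'h::complex_hilbert_space \<Rightarrow>\<^sub>L 'h"
  assumes "infinite_dimensional TYPE('h)"
    and "separable_space (euclidean :: 'h topology)"
    and "contraction N"
    and "contraction N0" and "normal_op N0"
    and "V = N - N0" and "hilbert_schmidt V"
  shows "(\<forall>\<Phi>\<in>F2_plus.
            (\<lambda>s. fun_calc \<Phi> (N0 + s *\<^sub>R V)) differentiable (at 0 within {0..1}) \<and>
            trace_class (taylor_remainder \<Phi> N0 V)) \<and>
         (\<exists>\<eta>\<in>L1_circle. trace_formula N0 V \<eta>) \<and>
         (\<forall>\<eta>\<in>L1_circle. \<forall>\<eta>'\<in>L1_circle.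
            trace_formula N0 V \<eta> \<longrightarrow> trace_formula N0 V \<eta>' \<longrightarrow>
            (\<lambda>z. \<eta> z - \<eta>' z) \<in> H1_circle) \<and>
         (\<forall>\<epsilon>>0. \<exists>\<eta>\<in>L1_circle. trace_formula N0 V \<eta> \<and>
            L1_norm \<eta> \<le> (1/2 + \<epsilon>) * (hs_norm V)\<^sup>2)"
proof -
  have bN: "blinfun_of (Cop N) = N" "norm (Cop N) \<le> 1" and bN0: "blinfun_of (Cop N0) = N0" "norm (Cop N0) \<le> 1"
    using assms(3,4) by (simp_all add: contraction_def norm_cop.rep_eq Cop_inverse')
  have Vd: "blinfun_of (Cop N - Cop N0) = V" by (simp add: minus_cop.rep_eq bN bN0 assms(6))
  then have "hs_cond (Cop N - Cop N0)" using assms(7) hilbert_schmidt_blinfun_of by metis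
  then have Vh: "hs_op (Hs (Cop N - Cop N0)) = Cop N - Cop N0" by (simp add: Hs_inverse)
  define W where "W = Hs (Cop N - Cop N0)"
  have W: "hs_op W = Cop N - Cop N0" "blinfun_of (hs_op W) = V" using Vh Vd by (simp_all add: W_def)
  interpret contraction_pair "Cop N0" "Cop N" W
    by unfold_locales (use bN bN0 W in simp_all)
  have count: "countable (some_onb :: 'h set)" by (rule countable_some_onb[OF assms(2)])
  have a: "summable (\<lambda>k. (real k)\<^sup>2 * cmod (fourier_coeff \<Phi> (int k)))" if "\<Phi> \<in> F2_plus" for \<Phi>
    using that by (simp add: F2_plus_def)
  have 1: "(\<lambda>s. fun_calc \<Phi> (N0 + s *\<^sub>R V)) differentiable (at 0 within {0..1})"
    "trace_class (taylor_remainder \<Phi> N0 V)" if "\<Phi> \<in> F2_plus" for \<Phi>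
    using fun_calc_taylor(1)[OF a[OF that]] taylor_remainder_trace(1)[OF a[OF that] count]
    unfolding bN0(1) W(2) by (blast intro: differentiableI_vector)+
  have formula: "trace_formula N0 V \<eta>"
    if \<eta>: "\<eta> \<in> L1_circle" "\<And>n. circle_integral (\<lambda>z. z ^ n * \<eta> z) = mom W (hs_adj W) n" for \<eta>
    unfolding trace_formula_def
  proof
    fix \<Phi> assume \<Phi>: "\<Phi> \<in> F2_plus"
    let ?b = "\<lambda>k. of_nat (k * (k - 1)) * fourier_coeff \<Phi> (int k)"
    have "summable (\<lambda>k. norm (?b k))"
    proof (rule summable_weight_le[OF a[OF \<Phi>]])
      fix k :: nat
      have "real (k * (k - 1)) \<le> (real k)\<^sup>2" unfolding power2_eq_square of_nat_mult[symmetric] by (intro of_nat_mono) simp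
      then have "real (k * (k - 1)) * cmod (fourier_coeff \<Phi> (int k)) \<le> (real k)\<^sup>2 * cmod (fourier_coeff \<Phi> (int k))"
        by (rule mult_right_mono) simp
      then show "norm (?b k) \<le> 1 * ((real k)\<^sup>2 * cmod (fourier_coeff \<Phi> (int k)))"
        by (simp only: norm_mult norm_of_nat mult_1)
    qed
    from circle_integral_series[OF \<eta>(1) this, of "\<lambda>k. k - 2"]
    have "(\<lambda>k. ?b k * mom W (hs_adj W) (k - 2)) sums circle_integral (\<lambda>z. second_deriv \<Phi> z * \<eta> z)"
      unfolding \<eta>(2) second_deriv_def .
    then have "(\<lambda>k. fourier_coeff \<Phi> (int k) * (of_nat (k * (k - 1)) * mom W (hs_adj W) (k - 2)))
        sums circle_integral (\<lambda>z. second_deriv \<Phi> z * \<eta> z)"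
      by (simp only: mult_ac)
    moreover note taylor_remainder_trace(2)[OF a[OF \<Phi>] count]
    ultimately show "op_trace (taylor_remainder \<Phi> N0 V) = circle_integral (\<lambda>z. second_deriv \<Phi> z * \<eta> z)"
      unfolding bN0(1) W(2) using sums_unique2 by blast
  qed
  have 4: "\<exists>\<eta>\<in>L1_circle. trace_formula N0 V \<eta> \<and> L1_norm \<eta> \<le> (1/2 + \<epsilon>) * (hs_norm V)\<^sup>2" if "\<epsilon> > 0" for \<epsilon>
  proof -
    have nV: "hs_norm V = norm W" using hs_norm_hs_op[of W] W by simp
    \<comment> \<open>For \<open>W = 0\<close> the required bound is 0 and leaves no room for the
      strict excess in \<open>circle_rep_mom\<close>; there the zero function serves.\<close>
    have "circle_rep (mom W (hs_adj W)) ((1/2 + \<epsilon>) * (norm W)\<^sup>2)"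
    proof (cases "W = 0")
      case True
      have "mom W (hs_adj W) n = 0" for n using cmod_mom_le[of W "hs_adj W" n] True by simp
      then show ?thesis using True by (intro circle_rep_cong[OF circle_rep_zero[of 0]]) simp_all
    next
      case False
      then have "0 < \<epsilon> * (norm W)\<^sup>2" using that by simp
      from circle_rep_mom[OF this] show ?thesis
        by (rule circle_rep_cong) (simp_all add: distrib_right)
    qed
    then show ?thesis unfolding circle_rep_def nV using formula by blast
  qed
  have 3: "(\<lambda>z. \<eta> z - \<eta>' z) \<in> H1_circle"
    if \<eta>: "\<eta> \<in> L1_circle" "\<eta>' \<in> L1_circle" "trace_formula N0 V \<eta>" "trace_formula N0 V \<eta>'" for \<eta> \<eta>'
  proof -
    \<comment> \<open>The test function \<open>z ^ (n + 2)\<close> isolates the \<open>n\<close>-th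
      moment up to a nonzero factor.\<close>
    have eq: "circle_integral (\<lambda>z. z ^ n * \<eta> z) = circle_integral (\<lambda>z. z ^ n * \<eta>' z)" for n
    proof -
      have "circle_integral (\<lambda>z. second_deriv (\<lambda>z. z ^ (n + 2)) z * \<eta> z)
          = circle_integral (\<lambda>z. second_deriv (\<lambda>z. z ^ (n + 2)) z * \<eta>' z)"
        using \<eta>(3,4) power_in_F2_plus[of "n + 2"] unfolding trace_formula_def by metis
      then have "of_nat ((n + 2) * (n + 2 - 1)) * circle_integral (\<lambda>z. z ^ n * \<eta> z)
          = of_nat ((n + 2) * (n + 2 - 1)) * circle_integral (\<lambda>z. z ^ n * \<eta>' z)"
        unfolding second_deriv_power mult.assoc circle_integral_cmult by (simp only: diff_add_inverse2)
      moreover have "of_nat ((n + 2) * (n + 2 - 1)) \<noteq> (0 :: complex)" unfolding of_nat_eq_0_iff by simp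
      ultimately show ?thesis by (simp only: mult_cancel_left) simp
    qed
    have int: "integrable (lebesgue_on {0..2*pi}) (\<lambda>t. (cis t ^ n * f (cis t)) * (\<i> * cis t))" if "f \<in> L1_circle" for f n
    proof -
      have "(\<lambda>t. cis t ^ n * (\<i> * cis t)) \<in> borel_measurable (lebesgue_on {0..2*pi})" by measurable
      from integrable_bounded_mult[OF that[unfolded L1_circle_iff] this, of 1]
      have "integrable (lebesgue_on {0..2*pi}) (\<lambda>t. (cis t ^ n * (\<i> * cis t)) * f (cis t))"
        by (simp add: norm_mult norm_power)
      then show ?thesis by (rule back_subst) (simp add: mult_ac)
    qed
    have diff: "(\<lambda>z. \<eta> z - \<eta>' z) \<in> L1_circle" using \<eta>(1,2) by (simp add: L1_circle_iff)
    have "fourier_coeff (\<lambda>z. \<eta> z - \<eta>' z) k = 0" if "k < 0" for k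
    proof -
      \<comment> \<open>The factor \<open>\<i> * cis t\<close> of \<open>circle_integral\<close>
        shifts indices by one: the Fourier coefficient at \<open>k\<close> is, up to a constant, the
        moment of index \<open>- k - 1\<close>.\<close>
      define n where "n = nat (- k - 1)"
      have k: "- of_int k = (1 + real n)" using that by (simp add: n_def)
      have "cis (- (of_int k * t)) = cis t ^ n * cis t" for t
        using k by (simp add: Complex.DeMoivre cis_mult flip: mult_minus_left) (simp add: algebra_simps)
      then have "(\<eta> (cis t) - \<eta>' (cis t)) * cis (- (of_int k * t))
          = ((cis t ^ n * \<eta> (cis t)) * (\<i> * cis t) - (cis t ^ n * \<eta>' (cis t)) * (\<i> * cis t)) * (- \<i>)" for t
        by (simp add: algebra_simps)
      then have "integral {0..2*pi} (\<lambda>t. (\<eta> (cis t) - \<eta>' (cis t)) * cis (- (of_int k * t)))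
          = integral {0..2*pi} (\<lambda>t. (cis t ^ n * \<eta> (cis t)) * (\<i> * cis t) - (cis t ^ n * \<eta>' (cis t)) * (\<i> * cis t)) * (- \<i>)"
        by (simp only: integral_mult_left)
      also have "integral {0..2*pi} (\<lambda>t. (cis t ^ n * \<eta> (cis t)) * (\<i> * cis t) - (cis t ^ n * \<eta>' (cis t)) * (\<i> * cis t))
          = circle_integral (\<lambda>z. z ^ n * \<eta> z) - circle_integral (\<lambda>z. z ^ n * \<eta>' z)"
        unfolding circle_integral_def
        by (intro Henstock_Kurzweil_Integration.integral_diff integrable_on_lebesgue_on int \<eta>) simp_all
      finally show ?thesis by (simp add: fourier_coeff_def eq)
    qed
    then show ?thesis using diff by (simp add: H1_circle_def)
  qed
  show ?thesis using 1 3 4 4[of 1] by (intro conjI) (blast | simp)+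
qed

end
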